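(* Let $(X,S,\phi)$ be a system such that the interaction $\phi$ is irreducibly quantified. If $X$ is transferable, or if $\phi$ is simple and $X$ is weakly transferable, then $$H^m_{\mathrm{unif}}(S^X)\cong\begin{cases}\mathrm{Consv}^\phi(S)& m=0,\\ \{0\}& m\ne0\end{cases}$$ as $\mathbb R$-linear spaces.
   Context: Locales. A locale $X=(X,E)$, $E\subset X\times X$, is a directed graph that is symmetric ($(x,y)\in E\Rightarrow(y,x)\in E$), simple ($(x,x)\notin E$), locally finite (each vertex lies on finitely many edges) and connected. Write $e=(o(e),t(e))$, $\bar e=(t(e),o(e))$. Paths are finite sequences of consecutive edges (length $0$ allowed); $d_X$ is the graph distance; a subset of $X$ is connected if the induced subgraph is connected. A ball is a set $B(x,R)=\{x'\in X: d_X(x,x')\le R\}$ with $x\in X$, $R>0$ ($R$ is its radius); $B(\Lambda,R)=\bigcup_{x\in\Lambda}B(x,R)$, and $B(e,R)=B(o(e),R)\cup B(t(e),R)$. $X$ is weakly transferable if for every ball $B$ the complement $X\setminus B$ is a nonempty finite disjoint union of connected infinite graphs. $X$ is transferable if it is weakly transferable and either (a) there is a ball $B$ such that $X\setminus B$ has three or more connected components, or (b) for any $r\in\mathbb N$ there is a ball $B$ of radius at least $r$ with $X\setminus B$ connected. Systems. $S$ is a nonempty set with a designated base state $*\in S$. An interaction is a map $\phi\colon S\times S\to S\times S$ such that $\hat\imath\circ\phi\circ\hat\imath\circ\phi(s_1,s_2)=(s_1,s_2)$ whenever $\phi(s_1,s_2)\ne(s_1,s_2)$, where $\hat\imath$ swaps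 the components. A system is a triple $(X,S,\phi)$ of a locale, a set of states and an interaction. $S^X=\prod_{x\in X}S$; $\star$ is the configuration with all components $*$; $S^X_*$ is the set of $\eta=(\eta_x)\in S^X$ with $\eta_x=*$ for all but finitely many $x$. For $e\in E$, $\eta^e$ is obtained from $\eta$ by replacing $(\eta_{o(e)},\eta_{t(e)})$ by $\phi(\eta_{o(e)},\eta_{t(e)})$. $\Phi=\{(\eta,\eta^e):\eta\in S^X,e\in E\}$, $\Phi_*=\Phi\cap(S^X_*\times S^X_* )$; $(S^X,\Phi)$ and $(S^X_*,\Phi_* )$ are symmetric directed graphs. Conserved quantities. A conserved quantity is $\xi\colon S\to\mathbb R$ with $\xi( * )=0$ and $\xi(s_1)+\xi(s_2)=\xi(s_1')+\xi(s_2')$ for all $(s_1,s_2)$, where $(s_1',s_2')=\phi(s_1,s_2)$; $\mathrm{Consv}^\phi(S)$ is the $\mathbb R$-linear space of these, $c_\phi$ its dimension. For a locale $Y$ and $\eta\in S^Y_*$, $\xi_Y(\eta)=\sum_{x\in Y}\xi(\eta_x)$. $\phi$ is irreducibly quantified if for any finite locale $Y$ and $\eta,\eta'\in S^Y$ with $\xi_Y(\eta)=\xi_Y(\eta')$ for all $\xi\in\mathrm{Consv}^\phi(S)$ there is a finite path from $\eta$ to $\eta'$ in $(S^Y,\Phi)$. $\phi$ is simple if $c_\phi=1$ and for any nonzero $\xi\in\mathrm{Consv}^\phi(S)$ the additive submonoid of $\mathbb R$ generated by $\xi(S)$ is isomorphic to $\mathbb N=\{0,1,\dots\}$ or $\mathbb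 Z$. Functions and forms. $C(A)$ is the space of functions $A\to\mathbb R$. For finite $\Lambda\subset X$, $C(S^\Lambda)$ is regarded as the subspace of $C(S^X_* )$ of functions depending only on $\eta|_\Lambda$; $C_\Lambda(S^X)$ is the space of $f\in C(S^\Lambda)$ with $f(\eta)=0$ whenever $\eta_x=*$ for some $x\in\Lambda$. Every $f\in C(S^X_* )$ has a unique expansion $f=\sum_{\Lambda\subset X,|\Lambda|<\infty}f_\Lambda$ with $f_\Lambda\in C_\Lambda(S^X)$; $f$ is uniform if there is $R>0$ with $f_\Lambda=0$ whenever $\mathrm{diam}(\Lambda)=\sup_{x,x'\in\Lambda}d_X(x,x')>R$. $C^0_{\mathrm{unif}}(S^X)$ is the space of uniform $f$ with $f(\star)=0$. A form is a function $\omega\colon\Phi_*\to\mathbb R$ with $\omega(\bar\varphi)=-\omega(\varphi)$ ($\bar\varphi$ the reversed transition), identified with $(\omega_e)_{e\in E}$, $\omega_e(\eta)=\omega((\eta,\eta^e))$. It is closed if its sum along every closed path of $(S^X_*,\Phi_* )$ is $0$, and uniform if there is $R>0$ such that $\omega_e\in C(S^{B(e,R)})$ for all $e\in E$. $Z^1_{\mathrm{unif}}(S^X)$ is the space of closed uniform forms. $\partial f=(\nabla_ef)_{e\in E}$, $\nabla_ef(\eta)=f(\eta^e)-f(\eta)$; $\partial$ maps $C^0_{\mathrm{unif}}(S^X)$ to $Z^1_{\mathrm{unif}}(S^X)$. Uniform cohomology. $H^m_{\mathrm{unif}}(S^X)$, $m\in\mathbb N$, is the cohomology of the complex $C^0_{\mathrm{unif}}(S^X)\xrightarrow{\partial}Z^1_{\mathrm{unif}}(S^X)$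 placed in degrees $0,1$: $H^0_{\mathrm{unif}}=\mathrm{Ker}\,\partial$, $H^1_{\mathrm{unif}}=Z^1_{\mathrm{unif}}(S^X)/\mathrm{Im}\,\partial$, and $H^m_{\mathrm{unif}}=\{0\}$ for $m\ne0,1$. *)

theory Defs
  imports
    Complex_Main
    "HOL-Algebra.AbelCoset"
    "HOL-Algebra.Elementary_Groups"
    "HOL-Algebra.Module"
    "HOL-Library.Function_Algebras"
begin

section \<open>Real vector spaces with explicit carriers\<close>

text \<open>
  The real vector spaces below live in different types, so they are carried by the library's
  \<open>module\<close> records. The fields \<open>mult\<close> and \<open>one\<close> of that record play no role.
\<close>

definition fun_scale :: "real \<Rightarrow> ('a \<Rightarrow> real) \<Rightarrow> 'a \<Rightarrow> real" where
  "fun_scale c f = (\<lambda>a. c * f a)"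

interpretation real_fun: vector_space "fun_scale :: real \<Rightarrow> ('a \<Rightarrow> real) \<Rightarrow> 'a \<Rightarrow> real"
  by unfold_locales (auto simp: fun_scale_def fun_eq_iff algebra_simps)

definition fun_space :: "('a \<Rightarrow> real) set \<Rightarrow> (real, 'a \<Rightarrow> real) module" where
  "fun_space W = \<lparr>carrier = W, monoid.mult = undefined, monoid.one = undefined,
     ring.zero = 0, ring.add = (+), module.smult = fun_scale\<rparr>"

definition zero_space :: "'a \<Rightarrow> (real, 'a) module" where
  "zero_space z = \<lparr>carrier = {z}, monoid.mult = undefined, monoid.one = undefined,
     ring.zero = z, ring.add = (\<lambda>_ _. z), module.smult = (\<lambda>_ _. z)\<rparr>"

text \<open>
  Scaling of cosets: \<open>c \<cdot> (v + N) = c \<cdot> v + N\<close>. Adding \<open>N\<close> once more makes the formula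
  correct for \<open>c = 0\<close> as well.
\<close>

definition quot_space :: "(real, 'a) module \<Rightarrow> 'a set \<Rightarrow> (real, 'a set) module" where
  "quot_space M N = \<lparr>carrier = a_rcosets\<^bsub>M\<^esub> N, monoid.mult = undefined, monoid.one = undefined,
     ring.zero = N, ring.add = (\<lambda>A B. A <+>\<^bsub>M\<^esub> B),
     module.smult = (\<lambda>c A. ((\<lambda>a. c \<odot>\<^bsub>M\<^esub> a) ` A) <+>\<^bsub>M\<^esub> N)\<rparr>"

definition lin_iso :: "(real, 'a) module \<Rightarrow> (real, 'b) module \<Rightarrow> bool" where
  "lin_iso M N \<longleftrightarrow> (\<exists>h. bij_betw h (carrier M) (carrier N) \<and>
     (\<forall>u\<in>carrier M. \<forall>v\<in>carrier M. h (u \<oplus>\<^bsub>M\<^esub> v) = h u \<oplus>\<^bsub>N\<^esub> h v) \<and>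
     (\<forall>c. \<forall>u\<in>carrier M. h (c \<odot>\<^bsub>M\<^esub> u) = c \<odot>\<^bsub>N\<^esub> h u))"

definition funs_on :: "'a set \<Rightarrow> ('a \<Rightarrow> real) set" where
  \<comment> \<open>the space \<open>C(A)\<close>; extending by \<open>0\<close> outside \<open>A\<close> keeps it closed under the operations\<close>
  "funs_on A = {f. \<forall>a. a \<notin> A \<longrightarrow> f a = 0}"


section \<open>Locales\<close>

definition connected_graph :: "('v \<times> 'v) set \<Rightarrow> 'v set \<Rightarrow> bool" where
  \<comment> \<open>the subgraph induced on \<open>A\<close> is connected; connected graphs are nonempty\<close>
  "connected_graph E A \<longleftrightarrow> A \<noteq> {} \<and> (\<forall>x\<in>A. \<forall>y\<in>A. (x, y) \<in> (E \<inter> A \<times> A)\<^sup>*)"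

definition locale_graph :: "'v set \<Rightarrow> ('v \<times> 'v) set \<Rightarrow> bool" where
  "locale_graph V E \<longleftrightarrow> E \<subseteq> V \<times> V \<and> sym E \<and> irrefl E \<and>
     (\<forall>x\<in>V. finite {e \<in> E. fst e = x \<or> snd e = x}) \<and> connected_graph E V"

definition gdist :: "('v \<times> 'v) set \<Rightarrow> 'v \<Rightarrow> 'v \<Rightarrow> nat" where
  "gdist E x y = (LEAST n. (x, y) \<in> E ^^ n)"

definition gdiam :: "('v \<times> 'v) set \<Rightarrow> 'v set \<Rightarrow> nat" where
  "gdiam E A = Sup {gdist E x y | x y. x \<in> A \<and> y \<in> A}"

definition gball :: "'v set \<Rightarrow> ('v \<times> 'v) set \<Rightarrow> 'v \<Rightarrow> real \<Rightarrow> 'v set" where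
  "gball V E x R = {y \<in> V. real (gdist E x y) \<le> R}"

definition edge_ball :: "'v set \<Rightarrow> ('v \<times> 'v) set \<Rightarrow> 'v \<times> 'v \<Rightarrow> real \<Rightarrow> 'v set" where
  "edge_ball V E e R = gball V E (fst e) R \<union> gball V E (snd e) R"

definition graph_components :: "('v \<times> 'v) set \<Rightarrow> 'v set \<Rightarrow> 'v set set" where
  "graph_components E A = {{y. (x, y) \<in> (E \<inter> A \<times> A)\<^sup>*} | x. x \<in> A}"

definition weakly_transferable :: "'v set \<Rightarrow> ('v \<times> 'v) set \<Rightarrow> bool" where
  "weakly_transferable V E \<longleftrightarrow>
     (\<forall>x\<in>V. \<forall>R>0. \<exists>P. finite P \<and> P \<noteq> {} \<and> \<Union>P = V - gball V E x R \<and>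
        (\<forall>A\<in>P. infinite A \<and> connected_graph E A) \<and>
        (\<forall>A\<in>P. \<forall>B\<in>P. A \<noteq> B \<longrightarrow> A \<inter> B = {} \<and> E \<inter> A \<times> B = {}))"

text \<open>
  Under weak transferability the set of components is finite, so that \<open>card\<close> counts it.
\<close>

definition transferable :: "'v set \<Rightarrow> ('v \<times> 'v) set \<Rightarrow> bool" where
  "transferable V E \<longleftrightarrow> weakly_transferable V E \<and>
     ((\<exists>x\<in>V. \<exists>R>0. card (graph_components E (V - gball V E x R)) \<ge> 3) \<or>
      (\<forall>r::nat. \<exists>x\<in>V. \<exists>R>0. R \<ge> real r \<and> connected_graph E (V - gball V E x R)))"

fun walk :: "('c \<times> 'c) set \<Rightarrow> 'c \<Rightarrow> ('c \<times> 'c) list \<Rightarrow> 'c \<Rightarrow> bool" where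
  "walk G u [] v \<longleftrightarrow> u = v"
| "walk G u (a # p) v \<longleftrightarrow> a \<in> G \<and> fst a = u \<and> walk G (snd a) p v"


section \<open>Systems\<close>

text \<open>
  The set of states is a type \<open>'s\<close> (hence nonempty), with the base state as a parameter.
\<close>

definition interaction :: "('s \<times> 's \<Rightarrow> 's \<times> 's) \<Rightarrow> bool" where
  "interaction \<phi> \<longleftrightarrow> (\<forall>s. \<phi> s \<noteq> s \<longrightarrow> prod.swap (\<phi> (prod.swap (\<phi> s))) = s)"

definition particle_system :: "'v set \<Rightarrow> ('v \<times> 'v) set \<Rightarrow> ('s \<times> 's \<Rightarrow> 's \<times> 's) \<Rightarrow> bool" where
  "particle_system V E \<phi> \<longleftrightarrow> locale_graph V E \<and> interaction \<phi>"

definition configs :: "'v set \<Rightarrow> ('v \<Rightarrow> 's) set" where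
  "configs V = V \<rightarrow>\<^sub>E UNIV"

definition base_config :: "'v set \<Rightarrow> 's \<Rightarrow> 'v \<Rightarrow> 's" where
  "base_config V b = (\<lambda>x\<in>V. b)"

definition fin_configs :: "'v set \<Rightarrow> 's \<Rightarrow> ('v \<Rightarrow> 's) set" where
  "fin_configs V b = {\<eta> \<in> configs V. finite {x \<in> V. \<eta> x \<noteq> b}}"

definition exch :: "('s \<times> 's \<Rightarrow> 's \<times> 's) \<Rightarrow> 'v \<times> 'v \<Rightarrow> ('v \<Rightarrow> 's) \<Rightarrow> 'v \<Rightarrow> 's" where
  "exch \<phi> e \<eta> = \<eta>(fst e := fst (\<phi> (\<eta> (fst e), \<eta> (snd e))),
                    snd e := snd (\<phi> (\<eta> (fst e), \<eta> (snd e))))"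

definition transitions ::
    "'v set \<Rightarrow> ('v \<times> 'v) set \<Rightarrow> ('s \<times> 's \<Rightarrow> 's \<times> 's) \<Rightarrow> (('v \<Rightarrow> 's) \<times> ('v \<Rightarrow> 's)) set" where
  "transitions V E \<phi> = {(\<eta>, exch \<phi> e \<eta>) | \<eta> e. \<eta> \<in> configs V \<and> e \<in> E}"

definition fin_transitions ::
    "'v set \<Rightarrow> ('v \<times> 'v) set \<Rightarrow> ('s \<times> 's \<Rightarrow> 's \<times> 's) \<Rightarrow> 's \<Rightarrow> (('v \<Rightarrow> 's) \<times> ('v \<Rightarrow> 's)) set" where
  "fin_transitions V E \<phi> b = transitions V E \<phi> \<inter> fin_configs V b \<times> fin_configs V b"


section \<open>Conserved quantities\<close>

definition Consv :: "('s \<times> 's \<Rightarrow> 's \<times> 's) \<Rightarrow> 's \<Rightarrow> ('s \<Rightarrow> real) set" where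
  "Consv \<phi> b = {\<xi>. \<xi> b = 0 \<and>
     (\<forall>s1 s2. \<xi> s1 + \<xi> s2 = \<xi> (fst (\<phi> (s1, s2))) + \<xi> (snd (\<phi> (s1, s2))))}"

text \<open>
  Every finite locale is isomorphic to one whose vertices are natural numbers, so finite
  locales are taken with vertex sets of type \<open>nat set\<close>.
\<close>

definition irreducibly_quantified :: "('s \<times> 's \<Rightarrow> 's \<times> 's) \<Rightarrow> 's \<Rightarrow> bool" where
  "irreducibly_quantified \<phi> b \<longleftrightarrow>
     (\<forall>(Y :: nat set) F. locale_graph Y F \<and> finite Y \<longrightarrow>
        (\<forall>\<eta>\<in>configs Y. \<forall>\<eta>'\<in>configs Y.
           (\<forall>\<xi>\<in>Consv \<phi> b. (\<Sum>x\<in>Y. \<xi> (\<eta> x)) = (\<Sum>x\<in>Y. \<xi> (\<eta>' x))) \<longrightarrow>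
           (\<exists>p. walk (transitions Y F \<phi>) \<eta> p \<eta>')))"

definition real_add_monoid :: "real monoid" where
  "real_add_monoid = \<lparr>carrier = UNIV, monoid.mult = (+), monoid.one = 0\<rparr>"

definition nat_add_monoid :: "nat monoid" where
  "nat_add_monoid = \<lparr>carrier = UNIV, monoid.mult = (+), monoid.one = 0\<rparr>"

definition generated_submonoid :: "real set \<Rightarrow> real monoid" where
  "generated_submonoid A =
     real_add_monoid\<lparr>carrier := \<Inter>{H. submonoid H real_add_monoid \<and> A \<subseteq> H}\<rparr>"

text \<open>
  \<open>real_fun.dim\<close> is \<open>0\<close> on infinite-dimensional spaces, so the value \<open>1\<close> is attained
  exactly in dimension one.
\<close>

definition simple_interaction :: "('s \<times> 's \<Rightarrow> 's \<times> 's) \<Rightarrow> 's \<Rightarrow> bool" where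
  "simple_interaction \<phi> b \<longleftrightarrow> real_fun.dim (Consv \<phi> b) = 1 \<and>
     (\<forall>\<xi>\<in>Consv \<phi> b. \<xi> \<noteq> 0 \<longrightarrow>
        generated_submonoid (range \<xi>) \<cong> nat_add_monoid \<or>
        generated_submonoid (range \<xi>) \<cong> integer_group)"


section \<open>Uniform functions and forms\<close>

text \<open>The subspace \<open>C(S\<^sup>\<Lambda>)\<close> of functions depending only on the coordinates in \<open>\<Lambda>\<close>.\<close>

definition local_funs :: "'v set \<Rightarrow> 's \<Rightarrow> 'v set \<Rightarrow> (('v \<Rightarrow> 's) \<Rightarrow> real) set" where
  "local_funs V b \<Lambda> = {f \<in> funs_on (fin_configs V b).
     \<forall>\<eta>\<in>fin_configs V b. \<forall>\<eta>'\<in>fin_configs V b. (\<forall>x\<in>\<Lambda>. \<eta> x = \<eta>' x) \<longrightarrow> f \<eta> = f \<eta>'}"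

text \<open>The space \<open>C\<^sub>\<Lambda>(S\<^sup>X)\<close>.\<close>

definition exact_funs :: "'v set \<Rightarrow> 's \<Rightarrow> 'v set \<Rightarrow> (('v \<Rightarrow> 's) \<Rightarrow> real) set" where
  "exact_funs V b \<Lambda> = {f \<in> local_funs V b \<Lambda>.
     \<forall>\<eta>\<in>fin_configs V b. (\<exists>x\<in>\<Lambda>. \<eta> x = b) \<longrightarrow> f \<eta> = 0}"

text \<open>
  The expansion \<open>f = \<Sum>\<^sub>\<Lambda> f\<^sub>\<Lambda>\<close> over the finite sets \<open>\<Lambda>\<close> of vertices. At \<open>\<eta>\<close> the terms with
  \<open>\<Lambda>\<close> not contained in the (finite) support of \<open>\<eta>\<close> vanish by definition of \<open>exact_funs\<close>,
  so the sum at \<open>\<eta>\<close> runs over the subsets of the support.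
\<close>

definition expansion :: "'v set \<Rightarrow> 's \<Rightarrow> (('v \<Rightarrow> 's) \<Rightarrow> real) \<Rightarrow> ('v set \<Rightarrow> ('v \<Rightarrow> 's) \<Rightarrow> real) \<Rightarrow> bool" where
  "expansion V b f g \<longleftrightarrow>
     (\<forall>\<Lambda>. finite \<Lambda> \<and> \<Lambda> \<subseteq> V \<longrightarrow> g \<Lambda> \<in> exact_funs V b \<Lambda>) \<and>
     (\<forall>\<eta>\<in>fin_configs V b. f \<eta> = (\<Sum>\<Lambda>\<in>Pow {x \<in> V. \<eta> x \<noteq> b}. g \<Lambda> \<eta>))"

definition uniform_fun :: "'v set \<Rightarrow> ('v \<times> 'v) set \<Rightarrow> 's \<Rightarrow> (('v \<Rightarrow> 's) \<Rightarrow> real) \<Rightarrow> bool" where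
  "uniform_fun V E b f \<longleftrightarrow> (\<exists>g. expansion V b f g \<and>
     (\<exists>R::real. R > 0 \<and>
        (\<forall>\<Lambda>. finite \<Lambda> \<and> \<Lambda> \<subseteq> V \<and> real (gdiam E \<Lambda>) > R \<longrightarrow> g \<Lambda> = 0)))"

definition C0_unif :: "'v set \<Rightarrow> ('v \<times> 'v) set \<Rightarrow> 's \<Rightarrow> (('v \<Rightarrow> 's) \<Rightarrow> real) set" where
  "C0_unif V E b = {f \<in> funs_on (fin_configs V b). uniform_fun V E b f \<and> f (base_config V b) = 0}"

definition forms :: "'v set \<Rightarrow> ('v \<times> 'v) set \<Rightarrow> ('s \<times> 's \<Rightarrow> 's \<times> 's) \<Rightarrow> 's \<Rightarrow>
    (('v \<Rightarrow> 's) \<times> ('v \<Rightarrow> 's) \<Rightarrow> real) set" where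
  "forms V E \<phi> b = {\<omega> \<in> funs_on (fin_transitions V E \<phi> b).
     \<forall>t\<in>fin_transitions V E \<phi> b. \<omega> (prod.swap t) = - \<omega> t}"

definition closed_form :: "'v set \<Rightarrow> ('v \<times> 'v) set \<Rightarrow> ('s \<times> 's \<Rightarrow> 's \<times> 's) \<Rightarrow> 's \<Rightarrow>
    (('v \<Rightarrow> 's) \<times> ('v \<Rightarrow> 's) \<Rightarrow> real) \<Rightarrow> bool" where
  "closed_form V E \<phi> b \<omega> \<longleftrightarrow>
     (\<forall>\<eta>\<in>fin_configs V b. \<forall>p. walk (fin_transitions V E \<phi> b) \<eta> p \<eta> \<longrightarrow> (\<Sum>t\<leftarrow>p. \<omega> t) = 0)"

text \<open>
  The component \<open>\<omega>\<^sub>e\<close> of a form is the function \<open>\<lambda>\<eta>. \<omega> (\<eta>, exch \<phi> e \<eta>)\<close>; it vanishes outside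
  \<open>fin_configs\<close> because \<open>\<omega>\<close> vanishes outside \<open>fin_transitions\<close>.
\<close>

definition uniform_form :: "'v set \<Rightarrow> ('v \<times> 'v) set \<Rightarrow> ('s \<times> 's \<Rightarrow> 's \<times> 's) \<Rightarrow> 's \<Rightarrow>
    (('v \<Rightarrow> 's) \<times> ('v \<Rightarrow> 's) \<Rightarrow> real) \<Rightarrow> bool" where
  "uniform_form V E \<phi> b \<omega> \<longleftrightarrow> (\<exists>R::real. R > 0 \<and>
     (\<forall>e\<in>E. (\<lambda>\<eta>. \<omega> (\<eta>, exch \<phi> e \<eta>)) \<in> local_funs V b (edge_ball V E e R)))"

definition Z1_unif :: "'v set \<Rightarrow> ('v \<times> 'v) set \<Rightarrow> ('s \<times> 's \<Rightarrow> 's \<times> 's) \<Rightarrow> 's \<Rightarrow>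
    (('v \<Rightarrow> 's) \<times> ('v \<Rightarrow> 's) \<Rightarrow> real) set" where
  "Z1_unif V E \<phi> b = {\<omega> \<in> forms V E \<phi> b. closed_form V E \<phi> b \<omega> \<and> uniform_form V E \<phi> b \<omega>}"

definition differential :: "'v set \<Rightarrow> ('v \<times> 'v) set \<Rightarrow> ('s \<times> 's \<Rightarrow> 's \<times> 's) \<Rightarrow> 's \<Rightarrow>
    (('v \<Rightarrow> 's) \<Rightarrow> real) \<Rightarrow> ('v \<Rightarrow> 's) \<times> ('v \<Rightarrow> 's) \<Rightarrow> real" where
  "differential V E \<phi> b f t =
     (if t \<in> fin_transitions V E \<phi> b then f (snd t) - f (fst t) else 0)"


section \<open>Uniform cohomology\<close>

text \<open>
  The elements of \<open>H\<^sup>0\<close> are functions and those of \<open>H\<^sup>1\<close> are classes of forms. Since these have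
  different types, degree \<open>0\<close> has its own constant; \<open>H_unif\<close> is the cohomology in the
  degrees \<open>m > 0\<close>.
\<close>

definition H0_unif :: "'v set \<Rightarrow> ('v \<times> 'v) set \<Rightarrow> ('s \<times> 's \<Rightarrow> 's \<times> 's) \<Rightarrow> 's \<Rightarrow>
    (real, ('v \<Rightarrow> 's) \<Rightarrow> real) module" where
  "H0_unif V E \<phi> b = fun_space {f \<in> C0_unif V E b. differential V E \<phi> b f = 0}"

definition H_unif :: "'v set \<Rightarrow> ('v \<times> 'v) set \<Rightarrow> ('s \<times> 's \<Rightarrow> 's \<times> 's) \<Rightarrow> 's \<Rightarrow> nat \<Rightarrow>
    (real, (('v \<Rightarrow> 's) \<times> ('v \<Rightarrow> 's) \<Rightarrow> real) set) module" where
  "H_unif V E \<phi> b m =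
     (if m = 1 then quot_space (fun_space (Z1_unif V E \<phi> b)) (differential V E \<phi> b ` C0_unif V E b)
      else zero_space {0})"

end

theory Submission
  imports Defs "HOL-Library.Multiset"
begin

text \<open>
  A closed form is a differential: integrating it along walks gives a function \<open>f\<close> on the
  configurations (\<open>closed_form_exact\<close>), unique up to a constant on each component of the transition
  graph. Since the interaction is irreducibly quantified and the locale is connected, the
  components are the sets of configurations with the same total charge. So the theorem asks which
  \<open>f\<close> with a uniform differential can be made uniform by subtracting a function of the charge, and
  which uniform functions depend on the charge alone.

  Let \<open>R\<close> be the range of the form. The obstruction is the defect
  \<open>H \<alpha> \<beta> = f (\<alpha> \<union> \<beta>) - f \<alpha> - f \<beta>\<close> for configurations with distant supports. If \<open>\<alpha>\<close> lives on a
  connected set \<open>K\<close> and \<open>\<beta>\<close> on a connected set \<open>L\<close> at distance more than \<open>R\<close>, the particles in \<open>K\<close>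
  can be rearranged without involving \<open>\<beta>\<close> and conversely, so \<open>H\<close> depends on the two charges
  only (\<open>H_good\<close>). The heart of the proof is that it does not depend on the sets \<open>K\<close> and \<open>L\<close>
  either, as long as \<open>L\<close> is infinite, and that the resulting function \<open>h\<close> of two charges is symmetric
  (\<open>pairing_exists\<close>). The tool for this is \<open>H_far\<close>: once \<open>\<beta>\<close> is far out, \<open>\<alpha>\<close> can be carried anywhere.
  If there are large balls with connected complement, carry \<open>\<alpha>\<close> into such a ball. If the complement
  of some ball has several components, carry \<open>\<alpha>\<close> into one of them while \<open>\<beta>\<close> is far out in another.
  With three components the sides can be exchanged by rotating through the third one, which gives
  symmetry. With two components symmetry can fail in general (a left and a right side are
  distinguished), and this is where simplicity of the interaction enters: all charges are then
  multiples of one charge, and a cocycle on such a monoid is symmetric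
  (\<open>cocycle_symmetric_if_cyclic\<close>).

  Comparing three distant configurations shows that \<open>h\<close> is a cocycle. As the real line is divisible,
  a symmetric cocycle is a coboundary, \<open>h A B = u (A + B) - u A - u B\<close> with a function \<open>u\<close> of the
  charge (\<open>charge_coboundary\<close>). Replacing \<open>f\<close> by \<open>f - u\<close> makes it additive on distant
  configurations without changing its differential. Additivity forces the second difference of \<open>f\<close>
  at two distant vertices to vanish (\<open>second_difference\<close>), and by Moebius inversion this means that
  the components of the expansion over sets of large diameter vanish. So \<open>f - u\<close> is uniform, and
  the first cohomology is zero.

  In degree zero, a uniform function that depends on the charge only is additive on distant
  configurations, hence an additive function of the charge, hence the total of a conserved
  quantity (\<open>kernel_charge\<close>).
\<close>

section \<open>Distances and connected sets in a locale\<close>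

lemma connected_graphI_root:
  assumes "sym E" "x \<in> A" "\<And>y. y \<in> A \<Longrightarrow> (x, y) \<in> (E \<inter> A \<times> A)\<^sup>*"
  shows "connected_graph E A"
proof -
  have s: "sym ((E \<inter> A \<times> A)\<^sup>*)"
    using assms(1) by (intro sym_rtrancl) (auto simp: sym_def)
  show ?thesis unfolding connected_graph_def
    using assms(2,3) s by (metis empty_iff rtrancl_trans symD)
qed

lemma connected_graph_Un:
  assumes "sym E" "connected_graph E A" "connected_graph E B" "z \<in> A" "z \<in> B"
  shows "connected_graph E (A \<union> B)"
proof (rule connected_graphI_root[OF assms(1), of z])
  have "(E \<inter> A \<times> A)\<^sup>* \<subseteq> (E \<inter> (A \<union> B) \<times> (A \<union> B))\<^sup>*" "(E \<inter> B \<times> B)\<^sup>* \<subseteq> (E \<inter> (A \<union> B) \<times> (A \<union> B))\<^sup>*"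
    by (intro rtrancl_mono; blast)+
  then show "(z, y) \<in> (E \<inter> (A \<union> B) \<times> (A \<union> B))\<^sup>*" if "y \<in> A \<union> B" for y
    using that assms(2-5) unfolding connected_graph_def by blast
qed (use assms in auto)

lemma connected_graph_edge:
  assumes "sym E" "(x, y) \<in> E"
  shows "connected_graph E {x, y}"
  by (rule connected_graphI_root[OF assms(1), of x]) (use assms in auto)

lemma finite_path_hull:
  assumes "sym E" "(x, y) \<in> (E \<inter> K \<times> K)\<^sup>*" "x \<in> K"
  shows "\<exists>T. finite T \<and> T \<subseteq> K \<and> x \<in> T \<and> y \<in> T \<and> connected_graph E T"
  using assms(2)
proof (induction rule: rtrancl_induct)
  case base
  show ?case using assms(3) by (intro exI[of _ "{x}"]) (auto simp: connected_graph_def)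
next
  case (step y z)
  then obtain T where T: "finite T" "T \<subseteq> K" "x \<in> T" "y \<in> T" "connected_graph E T" by blast
  have "connected_graph E (T \<union> {y, z})"
    using connected_graph_Un[OF assms(1) T(5) connected_graph_edge[OF assms(1)], of y z y] T step by auto
  with T step show ?case by (intro exI[of _ "T \<union> {y, z}"]) auto
qed

text \<open>
  This is what makes irreducible quantification, a statement about finite locales, applicable
  inside arbitrary connected subgraphs.
\<close>

lemma finite_connected_hull:
  assumes "sym E" "connected_graph E K" "finite F" "F \<subseteq> K"
  shows "\<exists>T. finite T \<and> F \<subseteq> T \<and> T \<subseteq> K \<and> connected_graph E T"
proof -
  obtain x where x: "x \<in> K" using assms(2) by (auto simp: connected_graph_def)
  have "\<exists>T. finite T \<and> insert x F \<subseteq> T \<and> T \<subseteq> K \<and> connected_graph E T"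
    using assms(3,4)
  proof (induction F)
    case empty
    show ?case using x by (intro exI[of _ "{x}"]) (auto simp: connected_graph_def)
  next
    case (insert y F)
    then obtain T where T: "finite T" "insert x F \<subseteq> T" "T \<subseteq> K" "connected_graph E T" by blast
    have "(x, y) \<in> (E \<inter> K \<times> K)\<^sup>*"
      using assms(2) x insert.prems by (auto simp: connected_graph_def)
    from finite_path_hull[OF assms(1) this x] obtain U where
      U: "finite U" "U \<subseteq> K" "x \<in> U" "y \<in> U" "connected_graph E U" by blast
    have "connected_graph E (T \<union> U)"
      using connected_graph_Un[OF assms(1) T(4) U(5), of x] T U by auto
    with T U show ?case by (intro exI[of _ "T \<union> U"]) auto
  qed
  then show ?thesis by blast
qed

locale graph_locale =
  fixes X :: "'x set" and E :: "('x \<times> 'x) set"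
  assumes locale_graph: "locale_graph X E"
begin

lemma E_sub: "E \<subseteq> X \<times> X" and sym_E: "sym E" and irrefl_E: "irrefl E"
  and connected_X: "connected_graph E X"
  using locale_graph by (auto simp: locale_graph_def)

lemma edge_in: "(x, y) \<in> E \<Longrightarrow> x \<in> X \<and> y \<in> X"
  using E_sub by auto

lemma relpow_in: "(x, y) \<in> E ^^ n \<Longrightarrow> x \<in> X \<Longrightarrow> y \<in> X"
  by (induction n arbitrary: y) (auto dest: edge_in)

lemma sym_relpow: "(x, y) \<in> E ^^ n \<Longrightarrow> (y, x) \<in> E ^^ n"
proof (induction n arbitrary: x y)
  case (Suc n)
  then obtain z where "(x, z) \<in> E ^^ n" "(z, y) \<in> E" by auto
  then have "(y, z) \<in> E" "(z, x) \<in> E ^^ n" using Suc.IH sym_E by (auto dest: symD)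
  then show ?case by (rule relpow_Suc_I2)
qed auto

lemma relpow_gdist:
  assumes "x \<in> X" "y \<in> X"
  shows "(x, y) \<in> E ^^ gdist E x y"
proof -
  have "E \<inter> X \<times> X = E" using E_sub by auto
  then have "(x, y) \<in> E\<^sup>*" using assms connected_X by (auto simp: connected_graph_def)
  then obtain n where "(x, y) \<in> E ^^ n" by (auto simp: rtrancl_power)
  then show ?thesis unfolding gdist_def by (rule LeastI)
qed

lemma gdist_le: "(x, y) \<in> E ^^ n \<Longrightarrow> gdist E x y \<le> n"
  unfolding gdist_def by (rule Least_le)

lemma gdist_same [simp]: "gdist E x x = 0"
  using gdist_le[of x x 0] by simp

lemma gdist_commute: "gdist E x y = gdist E y x"
proof -
  have "(\<lambda>n. (x, y) \<in> E ^^ n) = (\<lambda>n. (y, x) \<in> E ^^ n)" using sym_relpow by blast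
  then show ?thesis by (simp add: gdist_def)
qed

lemma gdist_triangle:
  assumes "x \<in> X" "y \<in> X" "z \<in> X"
  shows "gdist E x z \<le> gdist E x y + gdist E y z"
  by (rule gdist_le) (use assms in \<open>auto simp: relpow_add intro!: relcompI relpow_gdist\<close>)

lemma finite_relpow_image: "x \<in> X \<Longrightarrow> finite {y. (x, y) \<in> E ^^ n}"
proof (induction n)
  case (Suc n)
  have "finite {y. (z, y) \<in> E}" if "z \<in> X" for z
  proof -
    have "finite {e \<in> E. fst e = z \<or> snd e = z}" using locale_graph that by (auto simp: locale_graph_def)
    then show ?thesis by (rule finite_subset[rotated, OF finite_imageI[of _ snd]]) force
  qed
  moreover have "{y. (x, y) \<in> E ^^ Suc n} = (\<Union>z\<in>{y. (x, y) \<in> E ^^ n}. {y. (z, y) \<in> E})" by auto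
  ultimately show ?case using Suc relpow_in by auto
qed auto

lemma finite_gball:
  assumes "x \<in> X"
  shows "finite (gball X E x r)"
proof (rule finite_subset)
  show "gball X E x r \<subseteq> (\<Union>n\<le>nat \<lfloor>r\<rfloor>. {y. (x, y) \<in> E ^^ n})"
  proof
    fix y assume y: "y \<in> gball X E x r"
    then have "gdist E x y \<le> nat \<lfloor>r\<rfloor>" by (auto simp: gball_def) linarith
    moreover have "(x, y) \<in> E ^^ gdist E x y" using y assms by (intro relpow_gdist) (auto simp: gball_def)
    ultimately show "y \<in> (\<Union>n\<le>nat \<lfloor>r\<rfloor>. {y. (x, y) \<in> E ^^ n})" by blast
  qed
qed (use assms finite_relpow_image in auto)

lemma gdist_intermediate:
  assumes "x \<in> X" "y \<in> X" "j \<le> gdist E x y"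
  shows "\<exists>z\<in>X. gdist E x z = j \<and> gdist E z y = gdist E x y - j"
proof -
  have "(x, y) \<in> E ^^ (j + (gdist E x y - j))" using relpow_gdist[OF assms(1,2)] assms(3) by simp
  then obtain z where z: "(x, z) \<in> E ^^ j" "(z, y) \<in> E ^^ (gdist E x y - j)" by (auto simp: relpow_add)
  then have "z \<in> X" using relpow_in assms by blast
  moreover have "gdist E x z \<le> j" "gdist E z y \<le> gdist E x y - j" using z by (auto intro: gdist_le)
  moreover have "gdist E x y \<le> gdist E x z + gdist E z y" using gdist_triangle assms \<open>z \<in> X\<close> by auto
  ultimately show ?thesis using assms(3) by (intro bexI[of _ z]) auto
qed

lemma connected_gball:
  assumes "x \<in> X" "r \<ge> 0"
  shows "connected_graph E (gball X E x r)"
proof (rule connected_graphI_root[OF sym_E, of x])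
  let ?B = "gball X E x r"
  have "gdist E x y = n \<Longrightarrow> y \<in> ?B \<Longrightarrow> (x, y) \<in> (E \<inter> ?B \<times> ?B)\<^sup>*" for y n
  proof (induction n arbitrary: y)
    case 0
    then have "(x, y) \<in> E ^^ 0" using relpow_gdist[of x y] assms by (auto simp: gball_def)
    then show ?case by simp
  next
    case (Suc n)
    then have y: "y \<in> X" by (auto simp: gball_def)
    obtain z where z: "z \<in> X" "gdist E x z = n" "gdist E z y = 1"
      using gdist_intermediate[OF assms(1) y, of n] Suc by auto
    then have "(z, y) \<in> E" using relpow_gdist[OF z(1) y] by simp
    moreover have "z \<in> ?B" using z Suc.prems by (auto simp: gball_def)
    ultimately have "(z, y) \<in> E \<inter> ?B \<times> ?B" using Suc.prems by blast
    then show ?case by (rule rtrancl.rtrancl_into_rtrancl[OF Suc.IH[OF z(2) \<open>z \<in> ?B\<close>]])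
  qed
  then show "(x, y) \<in> (E \<inter> ?B \<times> ?B)\<^sup>*" if "y \<in> ?B" for y using that by blast
qed (use assms in \<open>auto simp: gball_def\<close>)

lemma finite_subset_gball:
  assumes "finite F" "F \<subseteq> X" "x \<in> X"
  shows "\<exists>n::nat. n > 0 \<and> F \<subseteq> gball X E x (real n)"
proof (intro exI conjI)
  show "F \<subseteq> gball X E x (real (Suc (\<Sum>y\<in>F. gdist E x y)))"
  proof
    fix y assume "y \<in> F"
    then have "gdist E x y \<le> (\<Sum>y\<in>F. gdist E x y)" using assms(1) by (intro member_le_sum) auto
    then have "gdist E x y \<le> Suc (\<Sum>y\<in>F. gdist E x y)" by simp
    then show "y \<in> gball X E x (real (Suc (\<Sum>y\<in>F. gdist E x y)))"
      using \<open>y \<in> F\<close> assms(2) by (auto simp: gball_def simp del: of_nat_Suc of_nat_sum)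
  qed
qed auto

definition separated :: "nat \<Rightarrow> 'x set \<Rightarrow> 'x set \<Rightarrow> bool" where
  "separated R K L \<longleftrightarrow> (\<forall>x\<in>K. \<forall>y\<in>L. gdist E x y > R)"

lemma separated_commute: "separated R K L \<longleftrightarrow> separated R L K"
  unfolding separated_def using gdist_commute by metis

lemma separated_mono: "separated R K L \<Longrightarrow> K' \<subseteq> K \<Longrightarrow> L' \<subseteq> L \<Longrightarrow> separated R K' L'"
  by (auto simp: separated_def)

lemma separated_disjoint: "separated R K L \<Longrightarrow> K \<inter> L = {}"
  by (force simp: separated_def)

lemma finite_near:
  assumes "finite F" "F \<subseteq> X"
  shows "finite {y \<in> X. \<exists>x\<in>F. gdist E x y \<le> R}"
proof -
  have "{y \<in> X. \<exists>x\<in>F. gdist E x y \<le> R} = (\<Union>x\<in>F. gball X E x (real R))"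
    by (auto simp: gball_def)
  then show ?thesis using assms finite_gball by auto
qed

end

section \<open>Weakly transferable locales\<close>

locale weakly_transferable_locale = graph_locale +
  assumes weakly_transferable: "weakly_transferable X E"
begin

text \<open>
  The components of the complement of a ball. Natural radii suffice because distances are natural
  numbers, and they keep the estimates free of coercions.
\<close>

definition pieces :: "'a \<Rightarrow> nat \<Rightarrow> 'a set set \<Rightarrow> bool" where
  "pieces x r P \<longleftrightarrow> finite P \<and> P \<noteq> {} \<and> \<Union>P = X - gball X E x r \<and>
     (\<forall>A\<in>P. infinite A \<and> connected_graph E A) \<and>
     (\<forall>A\<in>P. \<forall>B\<in>P. A \<noteq> B \<longrightarrow> A \<inter> B = {} \<and> E \<inter> A \<times> B = {})"

lemma piecesD:
  assumes "pieces x r P"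
  shows "finite P" "P \<noteq> {}" "\<Union>P = X - gball X E x r"
    and "C \<in> P \<Longrightarrow> infinite C" "C \<in> P \<Longrightarrow> connected_graph E C"
    and "C \<in> P \<Longrightarrow> D \<in> P \<Longrightarrow> u \<in> C \<Longrightarrow> u \<in> D \<Longrightarrow> C = D"
    and "C \<in> P \<Longrightarrow> D \<in> P \<Longrightarrow> u \<in> C \<Longrightarrow> v \<in> D \<Longrightarrow> (u, v) \<in> E \<Longrightarrow> C = D"
  using assms unfolding pieces_def by (simp, simp, simp, simp, simp, blast, blast)

lemma gball_floor:
  assumes "r \<ge> 0"
  shows "gball X E x r = gball X E x (real (nat \<lfloor>r\<rfloor>))"
proof -
  have "real n \<le> r \<longleftrightarrow> n \<le> nat \<lfloor>r\<rfloor>" for n using assms by linarith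
  then show ?thesis by (simp add: gball_def)
qed

lemma pieces_exist:
  assumes "x \<in> X"
  shows "\<exists>P. pieces x r P"
proof -
  \<comment> \<open>weak transferability speaks of positive radii; the shift by \<open>1/2\<close> covers \<open>r = 0\<close>\<close>
  have "gball X E x (real r + 1/2) = gball X E x (real r)"
    using gball_floor[of "real r + 1/2" x] by (simp add: floor_unique nat_eq_iff2)
  moreover have "real r + 1/2 > 0" by simp
  ultimately show ?thesis
    using weakly_transferable assms unfolding weakly_transferable_def pieces_def by metis
qed

lemma pieces_subset: "pieces x r P \<Longrightarrow> A \<in> P \<Longrightarrow> A \<subseteq> X"
  using piecesD(3) by (metis Diff_subset Union_upper dual_order.trans)

lemma infinite_X: "infinite X"
proof -
  obtain x where "x \<in> X" using connected_X by (auto simp: connected_graph_def)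
  then obtain P where P: "pieces x 1 P" using pieces_exist by blast
  then obtain A where "A \<in> P" using piecesD(2) by blast
  then show ?thesis using piecesD(4)[OF P] pieces_subset[OF P] finite_subset by blast
qed

lemma pieces_meet:
  assumes "pieces x r P" "x \<in> X" "infinite L" "L \<subseteq> X"
  shows "\<exists>A\<in>P. infinite (L \<inter> A)"
proof (rule ccontr)
  assume "\<not> ?thesis"
  then have "finite (\<Union>A\<in>P. L \<inter> A)" using piecesD(1)[OF assms(1)] by blast
  moreover have "L \<subseteq> (\<Union>A\<in>P. L \<inter> A) \<union> gball X E x r"
    using piecesD(3)[OF assms(1)] assms(4) by auto
  ultimately show False using assms(2,3) finite_gball finite_subset by blast
qed

lemma separated_gball_compl:
  assumes "x \<in> X" "L \<subseteq> X - gball X E x (real (n + R))" "F \<subseteq> gball X E x (real n)"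
  shows "separated R F L"
  unfolding separated_def
proof (intro ballI)
  fix u v assume "u \<in> F" "v \<in> L"
  then have "u \<in> X" "v \<in> X" "gdist E x u \<le> n" "gdist E x v > n + R"
    using assms by (auto simp: gball_def)
  then show "gdist E u v > R" using gdist_triangle[OF assms(1), of u v] by simp
qed

text \<open>
  All but finitely many vertices lie in the finitely many components outside a large ball around
  \<open>F\<close>, so one of these components contains infinitely many vertices of \<open>L\<close>.
\<close>

lemma far_connected_piece:
  assumes "finite F" "F \<subseteq> X" "infinite L" "L \<subseteq> X"
  shows "\<exists>A\<subseteq>X. connected_graph E A \<and> separated R F A \<and> infinite (L \<inter> A)"
proof -
  obtain x where x: "x \<in> X" using connected_X by (auto simp: connected_graph_def)
  obtain n where n: "n > 0" "F \<subseteq> gball X E x (real n)" using finite_subset_gball[OF assms(1,2) x] by blast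
  obtain P where P: "pieces x (n + R) P" using pieces_exist[OF x] by blast
  obtain A where A: "A \<in> P" "infinite (L \<inter> A)" using pieces_meet[OF P x assms(3,4)] by blast
  have "A \<subseteq> X - gball X E x (real (n + R))" "connected_graph E A"
    using piecesD(3,5)[OF P] A by auto
  then show ?thesis using separated_gball_compl[OF x _ n(2)] A by (intro exI[of _ A]) blast
qed

text \<open>
  Some vertex is at distance more than \<open>n\<close>, and a shortest path to it passes through every smaller
  distance.
\<close>

lemma card_gball:
  assumes "x \<in> X"
  shows "card (gball X E x (real n)) \<ge> n"
proof -
  have "\<not> X \<subseteq> gball X E x (real n)" using infinite_X finite_gball[OF assms] finite_subset by blast
  then obtain y where "y \<in> X" "\<not> gdist E x y \<le> n" by (auto simp: gball_def)
  then have y: "y \<in> X" "gdist E x y > n" by auto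
  have "\<forall>j. \<exists>z. j \<le> n \<longrightarrow> z \<in> X \<and> gdist E x z = j" using gdist_intermediate[OF assms y(1)] y(2)
    by (meson le_trans less_imp_le_nat)
  then obtain z where z: "\<And>j. j \<le> n \<Longrightarrow> z j \<in> X \<and> gdist E x (z j) = j" by metis
  have "inj_on z {..n}" using z by (metis atMost_iff inj_onI)
  then have "card (z ` {..n}) = Suc n" by (simp add: card_image)
  moreover have "z ` {..n} \<subseteq> gball X E x (real n)" using z by (auto simp: gball_def)
  ultimately show ?thesis using card_mono[OF finite_gball[OF assms]] by (metis Suc_leD)
qed

lemma pieces_step:
  assumes P: "pieces x r P" and x: "x \<in> X" and C: "C \<in> P" "u \<in> C"
    and d: "gdist E x u > r + R" and uv: "(u, v) \<in> E ^^ k" "k \<le> R"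
  shows "v \<in> C"
  using uv
proof (induction k arbitrary: v)
  case 0
  then show ?case using C by simp
next
  case (Suc k)
  then obtain w where w: "(u, w) \<in> E ^^ k" "(w, v) \<in> E" by auto
  have u: "u \<in> X" using C pieces_subset[OF P] by blast
  have v: "v \<in> X" using w edge_in by blast
  have "gdist E u v \<le> Suc k" using Suc.prems by (intro gdist_le)
  then have "gdist E x v > r"
    using d Suc.prems gdist_triangle[OF x v u] gdist_commute[of u v] by simp
  then have "v \<in> \<Union>P" using v piecesD(3)[OF P] by (auto simp: gball_def)
  then obtain D where "D \<in> P" "v \<in> D" by blast
  moreover have "w \<in> C" using Suc.IH w Suc.prems by simp
  ultimately show ?case using piecesD(7)[OF P C(1)] w by blast
qed

text \<open>
  A walk of length at most \<open>R\<close> that starts at distance more than \<open>r + R\<close> from the centre cannot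
  enter the ball of radius \<open>r\<close>, so it cannot change the component. Deep parts of a component are
  therefore separated from everything outside that component.
\<close>

lemma deep_part:
  assumes P: "pieces x r P" and x: "x \<in> X" and C: "C \<in> P"
  shows "\<exists>W\<subseteq>C. infinite W \<and> connected_graph E W \<and> separated R W (X - C)"
proof -
  have CX: "C \<subseteq> X" using P C by (rule pieces_subset)
  obtain P' where P': "pieces x (r + R) P'" using pieces_exist[OF x] by blast
  obtain W where W: "W \<in> P'" "infinite (C \<inter> W)"
    using pieces_meet[OF P' x _ CX] piecesD(4)[OF P C] by auto
  obtain c where c: "c \<in> C" "c \<in> W" using W by (metis IntE finite.emptyI ex_in_conv)
  have dW: "w \<in> X \<and> gdist E x w > r + R" if "w \<in> W" for w
  proof -
    have "w \<in> \<Union>P'" using that W by blast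
    then show ?thesis using piecesD(3)[OF P'] by (auto simp: gball_def)
  qed
  have conn: "connected_graph E W" "infinite W" using W piecesD(4,5)[OF P'] by auto
  have "W \<subseteq> C"
  proof
    fix w assume w: "w \<in> W"
    then have "(c, w) \<in> (E \<inter> W \<times> W)\<^sup>*" using conn c by (auto simp: connected_graph_def)
    then show "w \<in> C"
    proof (induction rule: rtrancl_induct)
      case base
      then show ?case using c by simp
    next
      case (step y z)
      have "z \<in> \<Union>P" using piecesD(3)[OF P] dW[of z] step by (auto simp: gball_def)
      then obtain D where "D \<in> P" "z \<in> D" by blast
      then show ?case using piecesD(7)[OF P C] step by blast
    qed
  qed
  moreover have "separated R W (X - C)" unfolding separated_def
  proof (intro ballI)
    fix u v assume uv: "u \<in> W" "v \<in> X - C"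
    then have "u \<in> C" "gdist E x u > r + R" "u \<in> X" using \<open>W \<subseteq> C\<close> dW by auto
    then show "gdist E u v > R"
      using pieces_step[OF P x C, of u R v "gdist E u v"] uv relpow_gdist[of u v] by force
  qed
  ultimately show ?thesis using conn by blast
qed

text \<open>
  Every component touches the ball, since the graph is connected, so the ball and all the other
  components hang together.
\<close>

lemma connected_compl_piece:
  assumes P: "pieces x r P" and x: "x \<in> X" and C: "C \<in> P"
  shows "connected_graph E (X - C)"
proof (rule connected_graphI_root[OF sym_E, of x])
  let ?B = "gball X E x (real r)"
  have PC: "\<Union>P = X - ?B" using piecesD(3)[OF P] .
  have xB: "x \<in> ?B" using x by (auto simp: gball_def)
  then show xC: "x \<in> X - C" using x PC C by blast
  let ?S = "(E \<inter> (X - C) \<times> (X - C))\<^sup>*"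
  have mono: "(E \<inter> A \<times> A)\<^sup>* \<subseteq> ?S" if "A \<subseteq> X - C" for A
    using that by (intro rtrancl_mono) auto
  have BC: "?B \<subseteq> X - C" using PC C by (auto simp: gball_def)
  have inB: "(x, y) \<in> ?S" if "y \<in> ?B" for y
    using connected_gball[OF x, of "real r"] that xB mono[OF BC] unfolding connected_graph_def by auto
  have symS: "sym ?S" using sym_E by (intro sym_rtrancl) (auto simp: sym_def)
  fix y assume y: "y \<in> X - C"
  show "(x, y) \<in> ?S"
  proof (cases "y \<in> ?B")
    case False
    then obtain D where D: "D \<in> P" "y \<in> D" using PC y by blast
    then have DC: "D \<subseteq> X - C" using C y pieces_subset[OF P] piecesD(6)[OF P] by blast
    have "E \<inter> X \<times> X = E" using E_sub by auto
    then have "(y, x) \<in> E\<^sup>*" using connected_X x y by (auto simp: connected_graph_def)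
    moreover have "x \<notin> D" using D xB PC by blast
    ultimately have "\<exists>u v. u \<in> D \<and> v \<notin> D \<and> (u, v) \<in> E" using \<open>y \<in> D\<close>
      by (induction rule: converse_rtrancl_induct) auto
    then obtain u v where uv: "u \<in> D" "v \<notin> D" "(u, v) \<in> E" by blast
    have "v \<in> ?B"
    proof (rule ccontr)
      assume "v \<notin> ?B"
      then obtain D' where "D' \<in> P" "v \<in> D'" using PC uv edge_in by blast
      then show False using piecesD(7)[OF P D(1)] uv by blast
    qed
    then have "(x, v) \<in> ?S" by (rule inB)
    moreover have "(v, u) \<in> ?S" using uv sym_E \<open>v \<in> ?B\<close> BC DC by (intro r_into_rtrancl) (auto dest: symD)
    moreover have "(u, y) \<in> ?S" 
      using mono[OF DC] piecesD(5)[OF P D(1)] D uv by (auto simp: connected_graph_def)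
    ultimately show ?thesis by (meson rtrancl_trans)
  qed (rule inB)
qed

lemma pieces_components:
  assumes P: "pieces x r P"
  shows "graph_components E (X - gball X E x (real r)) = P"
proof -
  let ?U = "X - gball X E x (real r)"
  have PU: "\<Union>P = ?U" using piecesD(3)[OF P] .
  have comp: "{z. (y, z) \<in> (E \<inter> ?U \<times> ?U)\<^sup>*} = C" if "C \<in> P" "y \<in> C" for C y
  proof
    show "{z. (y, z) \<in> (E \<inter> ?U \<times> ?U)\<^sup>*} \<subseteq> C"
    proof
      fix z assume "z \<in> {z. (y, z) \<in> (E \<inter> ?U \<times> ?U)\<^sup>*}"
      then have "(y, z) \<in> (E \<inter> ?U \<times> ?U)\<^sup>*" by simp
      then show "z \<in> C"
      proof (induction rule: rtrancl_induct)
        case (step u v)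
        then have "v \<in> \<Union>P" "(u, v) \<in> E" using PU by auto
        then obtain D where "D \<in> P" "v \<in> D" by blast
        then show ?case using piecesD(7)[OF P that(1)] step by blast
      qed (rule that)
    qed
    have "(E \<inter> C \<times> C)\<^sup>* \<subseteq> (E \<inter> ?U \<times> ?U)\<^sup>*" using that PU by (intro rtrancl_mono) blast
    then show "C \<subseteq> {z. (y, z) \<in> (E \<inter> ?U \<times> ?U)\<^sup>*}"
      using piecesD(5)[OF P that(1)] that by (auto simp: connected_graph_def)
  qed
  have "graph_components E ?U = {C. \<exists>y\<in>?U. C = {z. (y, z) \<in> (E \<inter> ?U \<times> ?U)\<^sup>*}}"
    by (auto simp: graph_components_def)
  also have "\<dots> = P"
  proof (intro equalityI subsetI)
    fix C assume "C \<in> {C. \<exists>y\<in>?U. C = {z. (y, z) \<in> (E \<inter> ?U \<times> ?U)\<^sup>*}}"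
    then obtain y where "y \<in> ?U" "C = {z. (y, z) \<in> (E \<inter> ?U \<times> ?U)\<^sup>*}" by blast
    moreover then obtain D where "D \<in> P" "y \<in> D" using PU by blast
    ultimately show "C \<in> P" using comp by simp
  next
    fix C assume C: "C \<in> P"
    then obtain y where "y \<in> C" using piecesD(5)[OF P C] by (auto simp: connected_graph_def)
    then show "C \<in> {C. \<exists>y\<in>?U. C = {z. (y, z) \<in> (E \<inter> ?U \<times> ?U)\<^sup>*}}" using comp[OF C] C PU by blast
  qed
  finally show ?thesis .
qed

end

section \<open>Cocycles on multisets\<close>

text \<open>
  The real line is divisible, hence injective among abelian groups. Over the rationals the
  argument is linear algebra: a maximal rationally independent subset \<open>B\<close> of the subgroup \<open>K\<close>
  spans it, a linear map that agrees with \<open>l\<close> on \<open>B\<close> exists, and clearing denominators shows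
  that it agrees with \<open>l\<close> on all of \<open>K\<close>.
\<close>

lemma additive_extension:
  fixes K :: "('a \<Rightarrow> real) set" and l :: "('a \<Rightarrow> real) \<Rightarrow> real"
  assumes zero: "0 \<in> K" and diff: "\<And>x y. x \<in> K \<Longrightarrow> y \<in> K \<Longrightarrow> x - y \<in> K"
    and l: "\<And>x y. x \<in> K \<Longrightarrow> y \<in> K \<Longrightarrow> l (x - y) = l x - l y"
  shows "\<exists>g. (\<forall>x y. g (x + y) = g x + g y) \<and> (\<forall>x\<in>K. g x = l x)"
proof -
  have l0: "l 0 = 0" using l[OF zero zero] by simp
  have neg: "- x \<in> K \<and> l (- x) = - l x" if "x \<in> K" for x
    using diff[OF zero that] l[OF zero that] l0 by simp
  have add: "x + y \<in> K \<and> l (x + y) = l x + l y" if "x \<in> K" "y \<in> K" for x y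
    using diff[of x "- y"] l[of x "- y"] neg[of y] that by simp
  have mult: "fun_scale (of_int k) x \<in> K \<and> l (fun_scale (of_int k) x) = of_int k * l x" if "x \<in> K" for x k
  proof (induction k rule: int_induct[where k = 0])
    case base
    then show ?case using zero l0 by (simp add: fun_scale_def zero_fun_def)
  next
    case (step1 i)
    have "fun_scale (of_int (i + 1)) x = fun_scale (of_int i) x + x"
      by (auto simp: fun_scale_def fun_eq_iff algebra_simps)
    then show ?case using add[of "fun_scale (of_int i) x" x] step1 that
      by (metis (no_types) mult.commute mult.right_neutral of_int_1 of_int_add ring_class.ring_distribs(1))
  next
    case (step2 i)
    have "fun_scale (of_int (i - 1)) x = fun_scale (of_int i) x - x"
      by (auto simp: fun_scale_def fun_eq_iff algebra_simps)
    then show ?case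
      using diff[of "fun_scale (of_int i) x" x] l[of "fun_scale (of_int i) x" x] step2 that
      by (metis (no_types) left_diff_distrib mult_1 of_int_1 of_int_diff)
  qed
  define sc :: "rat \<Rightarrow> ('a \<Rightarrow> real) \<Rightarrow> 'a \<Rightarrow> real" where "sc q = fun_scale (of_rat q)" for q
  define sr :: "rat \<Rightarrow> real \<Rightarrow> real" where "sr q r = of_rat q * r" for q r
  interpret vector_space_pair sc sr
    by unfold_locales (auto simp: sc_def sr_def fun_scale_def fun_eq_iff algebra_simps of_rat_add of_rat_mult)
  obtain B where B: "B \<subseteq> K" "vs1.independent B" "K \<subseteq> vs1.span B"
    using vs1.maximal_independent_subset[of K] by blast
  obtain g where g: "Vector_Spaces.linear sc sr g" "\<forall>x\<in>B. g x = l x"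
    using linear_independent_extend[OF B(2)] by blast
  interpret g: Vector_Spaces.linear sc sr g by (rule g(1))
  \<comment> \<open>the vectors at which \<open>g\<close> is what \<open>l\<close> dictates after clearing denominators\<close>
  define T where "T = {v. \<exists>n::int. n \<noteq> 0 \<and> fun_scale (of_int n) v \<in> K \<and>
    l (fun_scale (of_int n) v) = of_int n * g v}"
  have "vs1.subspace T"
  proof (rule vs1.subspaceI)
    show "0 \<in> T" unfolding T_def
      using zero l0 g.zero by (auto simp: fun_scale_def zero_fun_def intro!: exI[of _ 1])
  next
    fix v w assume "v \<in> T" "w \<in> T"
    then obtain n m :: int where n: "n \<noteq> 0" "fun_scale (of_int n) v \<in> K"
        "l (fun_scale (of_int n) v) = of_int n * g v"
      and m: "m \<noteq> 0" "fun_scale (of_int m) w \<in> K" "l (fun_scale (of_int m) w) = of_int m * g w"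
      by (auto simp: T_def)
    have *: "fun_scale (of_int (n * m)) (v + w) =
        fun_scale (of_int m) (fun_scale (of_int n) v) + fun_scale (of_int n) (fun_scale (of_int m) w)"
      by (auto simp: fun_scale_def fun_eq_iff algebra_simps)
    show "v + w \<in> T" unfolding T_def mem_Collect_eq
      by (rule exI[of _ "n * m"])
        (use n m mult[OF n(2), of m] mult[OF m(2), of n] add[OF mult[OF n(2), of m, THEN conjunct1] mult[OF m(2), of n, THEN conjunct1]]
          in \<open>auto simp: * g.add algebra_simps\<close>)
  next
    fix q v assume "v \<in> T"
    then obtain n :: int where n: "n \<noteq> 0" "fun_scale (of_int n) v \<in> K"
        "l (fun_scale (of_int n) v) = of_int n * g v"
      by (auto simp: T_def)
    obtain a d where q: "q = Fract a d" "d > 0" by (cases q) auto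
    then have qr: "(of_rat q :: real) = of_int a / of_int d" by (simp add: of_rat_rat)
    have *: "fun_scale (of_int (n * d)) (sc q v) = fun_scale (of_int a) (fun_scale (of_int n) v)"
      using q(2) by (auto simp: sc_def qr fun_scale_def fun_eq_iff)
    have "g (sc q v) = of_int a / of_int d * g v" using g.scale[of q v] by (simp add: sr_def qr)
    then have "of_int a * (of_int n * g v) = of_int (n * d) * g (sc q v)" using q(2) by simp
    then have "l (fun_scale (of_int (n * d)) (sc q v)) = of_int (n * d) * g (sc q v)"
      unfolding * using mult[OF n(2), of a] n(3) by metis
    moreover have "fun_scale (of_int (n * d)) (sc q v) \<in> K"
      unfolding * using mult[OF n(2), of a] by blast
    ultimately show "sc q v \<in> T" unfolding T_def mem_Collect_eq
      using n(1) q(2) by (intro exI[of _ "n * d"]) simp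
  qed
  moreover have "B \<subseteq> T"
  proof
    fix v assume v: "v \<in> B"
    then have "fun_scale (of_int 1) v = v" "v \<in> K" "g v = l v"
      using B g by (auto simp: fun_scale_def)
    then show "v \<in> T" unfolding T_def by (auto intro!: exI[of _ 1])
  qed
  ultimately have "K \<subseteq> T" using B(3) vs1.span_minimal by blast
  moreover have "g x = l x" if "x \<in> K" "x \<in> T" for x
    using mult[OF that(1)] that(2) by (auto simp: T_def)
  ultimately show ?thesis using g.add by blast
qed

text \<open>
  The identity satisfied by the factor set of a central extension, and by the defect of additivity
  of any function.
\<close>

definition cocycle :: "('a::comm_monoid_add \<Rightarrow> 'a \<Rightarrow> real) \<Rightarrow> bool" where
  "cocycle c \<longleftrightarrow> (\<forall>p q r. c p q + c (p + q) r = c q r + c p (q + r))"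

text \<open>
  On the free commutative monoid one adds the elements one at a time; symmetry makes the
  result independent of the order.
\<close>

lemma symmetric_cocycle_coboundary:
  fixes c :: "'s multiset \<Rightarrow> 's multiset \<Rightarrow> real"
  assumes c: "cocycle c" and sym: "\<And>A B. c A B = c B A"
  shows "\<exists>U. \<forall>A B. U (A + B) = U A + U B + c A B"
proof -
  have coc: "c p q + c (p + q) r = c q r + c p (q + r)" for p q r
    using c by (auto simp: cocycle_def)
  \<comment> \<open>the first component remembers the multiset built so far\<close>
  define F where "F s = (\<lambda>(A, v). (add_mset s A, v + c {#s#} A))" for s
  interpret comp_fun_commute F
  proof
    fix s t
    have "c {#s#} A + c {#t#} (add_mset s A) = c {#t#} A + c {#s#} (add_mset t A)" for A
      using coc[of "{#s#}" "{#t#}" A] coc[of "{#t#}" "{#s#}" A] sym[of "{#s#}" "{#t#}"]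
      by (simp add: add_mset_commute)
    then show "F t \<circ> F s = F s \<circ> F t" by (auto simp: F_def fun_eq_iff add_mset_commute)
  qed
  define G where "G A = fold_mset F ({#}, - c {#} {#}) A" for A
  have G: "G {#} = ({#}, - c {#} {#})" "G (add_mset s A) = F s (G A)" for s A
    by (simp_all add: G_def)
  have fst_G: "fst (G A) = A" for A
    by (induction A) (auto simp: G F_def split: prod.splits)
  define U where "U A = snd (G A)" for A
  have U: "U {#} = - c {#} {#}" "U (add_mset s A) = U A + c {#s#} A" for s A
    using fst_G[of A] by (auto simp: U_def G F_def split: prod.splits)
  have c0: "c {#} B = c {#} {#}" for B using coc[of "{#}" "{#}" B] by simp
  have "U (A + B) = U A + U B + c A B" for A B
  proof (induction A)
    case empty
    then show ?case using U c0 by simp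
  next
    case (add s A)
    then show ?case using coc[of "{#s#}" A B] U by simp
  qed
  then show ?thesis by blast
qed

definition same_charge :: "('s \<Rightarrow> real) set \<Rightarrow> 's multiset \<Rightarrow> 's multiset \<Rightarrow> bool" where
  "same_charge \<Xi> A B \<longleftrightarrow> (\<forall>\<xi>\<in>\<Xi>. (\<Sum>s\<in>#A. \<xi> s) = (\<Sum>s\<in>#B. \<xi> s))"

lemma same_charge_refl [simp]: "same_charge \<Xi> A A"
  and same_charge_sym: "same_charge \<Xi> A B \<Longrightarrow> same_charge \<Xi> B A"
  and same_charge_trans: "same_charge \<Xi> A B \<Longrightarrow> same_charge \<Xi> B C \<Longrightarrow> same_charge \<Xi> A C"
  and same_charge_add: "same_charge \<Xi> A B \<Longrightarrow> same_charge \<Xi> A' B' \<Longrightarrow> same_charge \<Xi> (A + A') (B + B')"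
  by (auto simp: same_charge_def)

text \<open>
  A primitive \<open>U\<close> on multisets need not respect the charge. On multisets of equal charge its
  increments define an additive map on the group of relations between the charges; subtracting
  an additive extension of this map repairs \<open>U\<close>.
\<close>

lemma charge_coboundary:
  fixes c :: "'s multiset \<Rightarrow> 's multiset \<Rightarrow> real"
  assumes c: "cocycle c" and sym: "\<And>A B. c A B = c B A"
    and inv: "\<And>A A' B. same_charge \<Xi> A A' \<Longrightarrow> c A B = c A' B"
  shows "\<exists>u. (\<forall>A B. u (A + B) = u A + u B + c A B) \<and> (\<forall>A B. same_charge \<Xi> A B \<longrightarrow> u A = u B)"
proof -
  obtain U where U: "\<And>A B. U (A + B) = U A + U B + c A B"
    using symmetric_cocycle_coboundary[OF c sym] by blast
  define ch :: "'s multiset \<Rightarrow> 's \<Rightarrow> real" where "ch A = (\<lambda>s. real (count A s))" for A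
  have ch_add: "ch (A + B) = ch A + ch B" for A B by (auto simp: ch_def)
  have ch_inj: "A = B" if "ch A = ch B" for A B
    using that by (intro multiset_eqI) (auto simp: ch_def fun_eq_iff)
  define K where "K = {ch A - ch B | A B. same_charge \<Xi> A B}"
  have well: "U A - U B = U A' - U B'"
    if "same_charge \<Xi> A B" "same_charge \<Xi> A' B'" "ch A - ch B = ch A' - ch B'" for A B A' B'
  proof -
    have "ch (A + B') = ch (A' + B)" unfolding ch_add using that(3) by (simp add: algebra_simps)
    then have "A + B' = A' + B" by (rule ch_inj)
    moreover have "c A B' = c A' B"
      using inv[OF that(1)] inv[OF that(2)] sym by metis
    ultimately show ?thesis using U[of A B'] U[of A' B] by simp
  qed
  define l where "l x = (THE r. \<exists>A B. same_charge \<Xi> A B \<and> x = ch A - ch B \<and> r = U A - U B)" for x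
  have l: "l (ch A - ch B) = U A - U B" if "same_charge \<Xi> A B" for A B
    unfolding l_def
  proof (rule the_equality)
    fix r assume "\<exists>A' B'. same_charge \<Xi> A' B' \<and> ch A - ch B = ch A' - ch B' \<and> r = U A' - U B'"
    then show "r = U A - U B" using well that by metis
  qed (use that in blast)
  have diff: "x - y \<in> K \<and> l (x - y) = l x - l y" if xy: "x \<in> K" "y \<in> K" for x y
  proof -
    obtain A B A' B' where AB: "same_charge \<Xi> A B" "x = ch A - ch B"
      and AB': "same_charge \<Xi> A' B'" "y = ch A' - ch B'" using xy unfolding K_def by blast
    have e: "x - y = ch (A + B') - ch (B + A')" unfolding AB AB' ch_add by simp
    have s: "same_charge \<Xi> (A + B') (B + A')"
      using AB(1) AB'(1) same_charge_sym same_charge_add by blast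
    have "c A B' = c B A'" using inv[OF AB(1)] inv[OF AB'(1)] sym by metis
    then show ?thesis using e s l[OF s] l[OF AB(1)] l[OF AB'(1)] U[of A B'] U[of B A'] AB AB'
      unfolding K_def by auto
  qed
  have "0 \<in> K" unfolding K_def by (auto intro!: exI[of _ "{#}"])
  then obtain g where g: "\<And>x y. g (x + y) = g x + g y" "\<And>x. x \<in> K \<Longrightarrow> g x = l x"
    using additive_extension[of K l] diff by blast
  have "g 0 = 0" using g(1)[of 0 0] by simp
  then have g_diff: "g (x - y) = g x - g y" for x y
    using g(1)[of "x - y" y] by simp
  show ?thesis
  proof (intro exI[of _ "\<lambda>A. U A - g (ch A)"] conjI allI impI)
    fix A B
    show "U (A + B) - g (ch (A + B)) = U A - g (ch A) + (U B - g (ch B)) + c A B"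
      by (simp add: U ch_add g)
    assume s: "same_charge \<Xi> A B"
    then have "ch A - ch B \<in> K" by (auto simp: K_def)
    then show "U A - g (ch A) = U B - g (ch B)" using g(2) g_diff l[OF s] by fastforce
  qed
qed

text \<open>
  The antisymmetrization of a cocycle is biadditive. If all charges are multiples of one
  charge, it is determined by its value at that charge against itself, which is zero.
\<close>

lemma cocycle_symmetric_if_cyclic:
  fixes c :: "'s multiset \<Rightarrow> 's multiset \<Rightarrow> real"
  assumes c: "cocycle c"
    and inv: "\<And>A A' B. same_charge \<Xi> A A' \<Longrightarrow> c A B = c A' B"
      "\<And>A B B'. same_charge \<Xi> B B' \<Longrightarrow> c A B = c A B'"
    and cyclic: "\<And>A. \<exists>m n. same_charge \<Xi> (A + repeat_mset m \<Gamma>) (repeat_mset n \<Gamma>)"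
  shows "c A B = c B A"
proof -
  have coc: "c p q + c (p + q) r = c q r + c p (q + r)" for p q r
    using c by (auto simp: cocycle_def)
  define k where "k p q = c p q - c q p" for p q
  have k_add: "k (p + q) r = k p r + k q r" for p q r
    using coc[of p q r] coc[of r p q] coc[of p r q] by (simp add: k_def add.commute)
  have k_inv: "k p r = k p' r" if "same_charge \<Xi> p p'" for p p' r
    using inv that by (simp add: k_def)
  have k_rep: "k (repeat_mset n p) r = real n * k p r" for n p r
  proof (induction n)
    case 0
    show ?case using k_add[of "{#}" "{#}" r] by simp
  next
    case (Suc n)
    then show ?case using k_add[of p "repeat_mset n p" r] by (simp add: algebra_simps)
  qed
  have k_mult: "\<exists>z. \<forall>r. k p r = z * k \<Gamma> r" for p
  proof -
    obtain m n where "same_charge \<Xi> (p + repeat_mset m \<Gamma>) (repeat_mset n \<Gamma>)" using cyclic by blast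
    then have "k p r = (real n - real m) * k \<Gamma> r" for r
      using k_inv[of "p + repeat_mset m \<Gamma>" "repeat_mset n \<Gamma>" r] k_add k_rep by (simp add: algebra_simps)
    then show ?thesis by blast
  qed
  obtain z where z: "\<And>r. k A r = z * k \<Gamma> r" using k_mult by blast
  obtain w where w: "\<And>r. k B r = w * k \<Gamma> r" using k_mult by blast
  have "k \<Gamma> B = - k B \<Gamma>" "k \<Gamma> \<Gamma> = 0" by (simp_all add: k_def)
  then have "k A B = 0" using z w by simp
  then show ?thesis by (simp add: k_def)
qed

section \<open>Simple interactions\<close>

lemma Consv_spanned_if_simple:
  assumes "simple_interaction \<phi> b"
  shows "\<exists>\<xi>\<in>Consv \<phi> b. \<xi> \<noteq> 0 \<and> (\<forall>\<zeta>\<in>Consv \<phi> b. \<exists>r. \<zeta> = fun_scale r \<xi>)"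
proof -
  obtain B where B: "B \<subseteq> Consv \<phi> b" "real_fun.independent B" "Consv \<phi> b \<subseteq> real_fun.span B"
      "card B = real_fun.dim (Consv \<phi> b)"
    using real_fun.basis_exists by blast
  then obtain \<xi> where \<xi>: "B = {\<xi>}"
    using assms by (auto simp: simple_interaction_def card_1_singleton_iff)
  then have "\<xi> \<noteq> 0" using B(2) real_fun.dependent_zero by blast
  moreover have "\<exists>r. \<zeta> = fun_scale r \<xi>" if "\<zeta> \<in> Consv \<phi> b" for \<zeta>
    using B(3) that unfolding \<xi> real_fun.span_singleton by blast
  ultimately show ?thesis using B(1) \<xi> by blast
qed

text \<open>
  A generator of this monoid is thus the total charge of some multiset of states.
\<close>

lemma generated_submonoid_charges:
  "carrier (generated_submonoid (range \<xi>)) = {\<Sum>s\<in>#A. \<xi> s | A. True}"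
proof
  let ?G = "{\<Sum>s\<in>#A. \<xi> s | A. True}"
  have "submonoid ?G real_add_monoid"
    by unfold_locales (auto simp: real_add_monoid_def intro: exI[of _ "{#}"] exI[of _ "_ + _"])
  moreover have "range \<xi> \<subseteq> ?G" by (auto intro!: exI[of _ "{#_#}"])
  ultimately show "carrier (generated_submonoid (range \<xi>)) \<subseteq> ?G"
    by (auto simp: generated_submonoid_def)
  have "(\<Sum>s\<in>#A. \<xi> s) \<in> H" if "submonoid H real_add_monoid" "range \<xi> \<subseteq> H" for A H
  proof (induction A)
    case empty
    then show ?case using submonoid.one_closed[OF that(1)] by (simp add: real_add_monoid_def)
  next
    case (add s A)
    then show ?case using submonoid.m_closed[OF that(1), of "\<xi> s" "\<Sum>s\<in>#A. \<xi> s"] that(2)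
      by (auto simp: real_add_monoid_def)
  qed
  then show "?G \<subseteq> carrier (generated_submonoid (range \<xi>))"
    by (auto simp: generated_submonoid_def)
qed

text \<open>
  An isomorphism from the monoid of charges to the natural numbers or the integers sends the charge
  of some \<open>\<Gamma>\<close> to \<open>1\<close>. Copies of \<open>\<Gamma>\<close> appear on both sides because a charge can be a negative
  multiple.
\<close>

lemma cyclic_charges_if_simple:
  assumes "simple_interaction \<phi> b"
  shows "\<exists>\<Gamma>. \<forall>A. \<exists>m n. same_charge (Consv \<phi> b) (A + repeat_mset m \<Gamma>) (repeat_mset n \<Gamma>)"
proof -
  obtain \<xi> where \<xi>: "\<xi> \<in> Consv \<phi> b" "\<xi> \<noteq> 0" "\<And>\<zeta>. \<zeta> \<in> Consv \<phi> b \<Longrightarrow> \<exists>r. \<zeta> = fun_scale r \<xi>"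
    using Consv_spanned_if_simple[OF assms] by blast
  define tot where "tot A = (\<Sum>s\<in>#A. \<xi> s)" for A
  have tot_add: "tot (A + B) = tot A + tot B" for A B by (simp add: tot_def)
  have tot_rep: "tot (repeat_mset n A) = real n * tot A" for n A
    by (induction n) (auto simp: tot_def algebra_simps)
  have same: "same_charge (Consv \<phi> b) A B" if "tot A = tot B" for A B
    unfolding same_charge_def
  proof
    fix \<zeta> assume "\<zeta> \<in> Consv \<phi> b"
    then obtain r where "\<zeta> = fun_scale r \<xi>" using \<xi>(3) by blast
    then have "(\<Sum>s\<in>#A. \<zeta> s) = r * tot A" for A
      by (simp add: fun_scale_def tot_def sum_mset_distrib_left)
    then show "(\<Sum>s\<in>#A. \<zeta> s) = (\<Sum>s\<in>#B. \<zeta> s)" using that by simp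
  qed
  let ?G = "generated_submonoid (range \<xi>)"
  have carr: "carrier ?G = range tot"
    unfolding generated_submonoid_charges tot_def by auto
  have mult: "x \<otimes>\<^bsub>?G\<^esub> y = x + y" for x y by (simp add: generated_submonoid_def real_add_monoid_def)
  have "?G \<cong> nat_add_monoid \<or> ?G \<cong> integer_group"
    using assms \<xi> by (auto simp: simple_interaction_def)
  then have "\<exists>\<Gamma>. \<forall>A. \<exists>m n. tot (A + repeat_mset m \<Gamma>) = tot (repeat_mset n \<Gamma>)"
  proof
    assume "?G \<cong> nat_add_monoid"
    then obtain \<theta> where \<theta>: "\<theta> \<in> hom ?G nat_add_monoid" "bij_betw \<theta> (range tot) (UNIV :: nat set)"
      by (auto simp: is_iso_def iso_def carr nat_add_monoid_def)
    have h: "\<theta> (tot A + tot B) = \<theta> (tot A) + \<theta> (tot B)" for A B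
      using \<theta>(1) carr mult by (auto simp: hom_def nat_add_monoid_def)
    have inj: "tot A = tot B" if "\<theta> (tot A) = \<theta> (tot B)" for A B
      using \<theta>(2) that by (auto simp: bij_betw_def inj_on_def)
    have "1 \<in> \<theta> ` range tot" using \<theta>(2) by (auto simp: bij_betw_def)
    then obtain \<Gamma> where \<Gamma>: "\<theta> (tot \<Gamma>) = 1" by auto
    have z: "\<theta> (tot {#}) = 0" using h[of "{#}" "{#}"] by (simp add: tot_def)
    have r: "\<theta> (tot (repeat_mset n \<Gamma>)) = n" for n
      by (induction n) (auto simp: z \<Gamma> tot_add h)
    have "tot (A + repeat_mset 0 \<Gamma>) = tot (repeat_mset (\<theta> (tot A)) \<Gamma>)" for A
      by (rule inj) (simp add: r)
    then show ?thesis by blast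
  next
    assume "?G \<cong> integer_group"
    then obtain \<theta> where \<theta>: "\<theta> \<in> hom ?G integer_group" "bij_betw \<theta> (range tot) (UNIV :: int set)"
      by (auto simp: is_iso_def iso_def carr)
    have h: "\<theta> (tot A + tot B) = \<theta> (tot A) + \<theta> (tot B)" for A B
      using \<theta>(1) carr mult by (auto simp: hom_def)
    have inj: "tot A = tot B" if "\<theta> (tot A) = \<theta> (tot B)" for A B
      using \<theta>(2) that by (auto simp: bij_betw_def inj_on_def)
    have "1 \<in> \<theta> ` range tot" using \<theta>(2) by (auto simp: bij_betw_def)
    then obtain \<Gamma> where \<Gamma>: "\<theta> (tot \<Gamma>) = 1" by auto
    have z: "\<theta> (tot {#}) = 0" using h[of "{#}" "{#}"] by (simp add: tot_def)
    have r: "\<theta> (tot (repeat_mset n \<Gamma>)) = int n" for n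
      by (induction n) (auto simp: z \<Gamma> tot_add h)
    have "tot (A + repeat_mset (nat (- \<theta> (tot A))) \<Gamma>) = tot (repeat_mset (nat (\<theta> (tot A))) \<Gamma>)" for A
      by (rule inj) (simp add: tot_add h r)
    then show ?thesis by blast
  qed
  then show ?thesis using same by blast
qed

section \<open>Configurations and their content\<close>

lemma walk_rtrancl: "walk G u p v \<Longrightarrow> (u, v) \<in> G\<^sup>*"
  by (induction G u p v rule: walk.induct) (auto intro: converse_rtrancl_into_rtrancl)

locale particle_locale = weakly_transferable_locale +
  fixes \<phi> :: "'s \<times> 's \<Rightarrow> 's \<times> 's" and b :: 's
  assumes interaction: "interaction \<phi>" and irreducible: "irreducibly_quantified \<phi> b"
begin

abbreviation FC :: "('a \<Rightarrow> 's) set" where "FC \<equiv> fin_configs X b"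

abbreviation base :: "'a \<Rightarrow> 's" where "base \<equiv> base_config X b"

abbreviation eqc :: "'s multiset \<Rightarrow> 's multiset \<Rightarrow> bool" where "eqc \<equiv> same_charge (Consv \<phi> b)"

definition supp :: "('a \<Rightarrow> 's) \<Rightarrow> 'a set" where "supp \<eta> = {x \<in> X. \<eta> x \<noteq> b}"

text \<open>
  The states of the particles present. Base states are left out: they carry no charge, and
  leaving them out makes the content a finite multiset.
\<close>

definition content :: "('a \<Rightarrow> 's) \<Rightarrow> 's multiset" where
  "content \<eta> = image_mset \<eta> (mset_set (supp \<eta>))"

text \<open>
  The superposition of two configurations, of interest for disjoint supports.
\<close>

definition merge :: "('a \<Rightarrow> 's) \<Rightarrow> ('a \<Rightarrow> 's) \<Rightarrow> 'a \<Rightarrow> 's" where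
  "merge \<alpha> \<beta> = (\<lambda>x\<in>X. if \<alpha> x = b then \<beta> x else \<alpha> x)"

definition cut :: "('a \<Rightarrow> 's) \<Rightarrow> 'a set \<Rightarrow> 'a \<Rightarrow> 's" where
  "cut \<eta> A = (\<lambda>x\<in>X. if x \<in> A then \<eta> x else b)"

lemma FC_iff: "\<eta> \<in> FC \<longleftrightarrow> \<eta> \<in> extensional X \<and> finite (supp \<eta>)"
  by (auto simp: fin_configs_def configs_def supp_def PiE_def)

lemma finite_supp: "\<eta> \<in> FC \<Longrightarrow> finite (supp \<eta>)" by (simp add: FC_iff)

lemma supp_sub: "supp \<eta> \<subseteq> X" by (auto simp: supp_def)

lemma FC_eqI: "\<eta> \<in> FC \<Longrightarrow> \<eta>' \<in> FC \<Longrightarrow> (\<And>x. x \<in> X \<Longrightarrow> \<eta> x = \<eta>' x) \<Longrightarrow> \<eta> = \<eta>'"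
  by (auto simp: FC_iff intro: extensionalityI)

lemma base_FC [simp]: "base \<in> FC" and supp_base [simp]: "supp base = {}"
  and content_base [simp]: "content base = {#}"
  by (auto simp: FC_iff base_config_def supp_def content_def)

lemma supp_merge: "supp (merge \<alpha> \<beta>) = supp \<alpha> \<union> supp \<beta>"
  by (auto simp: supp_def merge_def)

lemma supp_cut: "supp (cut \<eta> A) = supp \<eta> \<inter> A"
  by (auto simp: supp_def cut_def)

lemma merge_FC [simp]: "\<alpha> \<in> FC \<Longrightarrow> \<beta> \<in> FC \<Longrightarrow> merge \<alpha> \<beta> \<in> FC"
  by (simp add: FC_iff supp_merge) (simp add: merge_def)

lemma cut_FC [simp]: "\<eta> \<in> FC \<Longrightarrow> cut \<eta> A \<in> FC"
  by (simp add: FC_iff supp_cut) (simp add: cut_def)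

lemma merge_base [simp]: "\<alpha> \<in> FC \<Longrightarrow> merge \<alpha> base = \<alpha>" "\<alpha> \<in> FC \<Longrightarrow> merge base \<alpha> = \<alpha>"
  by (intro FC_eqI merge_FC base_FC; simp add: merge_def base_config_def)+

lemma merge_commute: "supp \<alpha> \<inter> supp \<beta> = {} \<Longrightarrow> merge \<alpha> \<beta> = merge \<beta> \<alpha>"
  by (auto simp: merge_def supp_def fun_eq_iff restrict_def)

lemma merge_assoc: "merge (merge \<alpha> \<beta>) \<gamma> = merge \<alpha> (merge \<beta> \<gamma>)"
  by (auto simp: merge_def fun_eq_iff restrict_def)

lemma merge_cut: "\<eta> \<in> FC \<Longrightarrow> merge (cut \<eta> A) (cut \<eta> (X - A)) = \<eta>"
  by (intro FC_eqI merge_FC cut_FC) (auto simp: merge_def cut_def)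

lemma content_merge:
  assumes "\<alpha> \<in> FC" "\<beta> \<in> FC" "supp \<alpha> \<inter> supp \<beta> = {}"
  shows "content (merge \<alpha> \<beta>) = content \<alpha> + content \<beta>"
proof -
  have "mset_set (supp \<alpha> \<union> supp \<beta>) = mset_set (supp \<alpha>) + mset_set (supp \<beta>)"
    using assms finite_supp by (intro mset_set_Union) auto
  moreover have "image_mset (merge \<alpha> \<beta>) (mset_set (supp \<alpha>)) = image_mset \<alpha> (mset_set (supp \<alpha>))"
    by (rule image_mset_cong) (use assms finite_supp in \<open>auto simp: merge_def supp_def\<close>)
  moreover have "image_mset (merge \<alpha> \<beta>) (mset_set (supp \<beta>)) = image_mset \<beta> (mset_set (supp \<beta>))"
    by (rule image_mset_cong) (use assms finite_supp in \<open>auto simp: merge_def supp_def\<close>)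
  ultimately show ?thesis by (simp add: content_def supp_merge)
qed

lemma charge_sum:
  assumes "\<xi> \<in> Consv \<phi> b" "finite K" "K \<subseteq> X" "supp \<eta> \<subseteq> K"
  shows "(\<Sum>s\<in>#content \<eta>. \<xi> s) = (\<Sum>x\<in>K. \<xi> (\<eta> x))"
proof -
  have "(\<Sum>s\<in>#content \<eta>. \<xi> s) = (\<Sum>x\<in>supp \<eta>. \<xi> (\<eta> x))"
    by (simp add: content_def sum_unfold_sum_mset image_mset.compositionality comp_def)
  also have "\<dots> = (\<Sum>x\<in>K. \<xi> (\<eta> x))"
    using assms by (intro sum.mono_neutral_left) (auto simp: supp_def Consv_def)
  finally show ?thesis .
qed

lemma content_insert:
  assumes "\<alpha> \<in> FC" "x \<in> X" "\<alpha> x = b"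
  shows "\<alpha>(x := s) \<in> FC" "supp (\<alpha>(x := s)) \<subseteq> insert x (supp \<alpha>)"
    and "eqc (content (\<alpha>(x := s))) (add_mset s (content \<alpha>))"
proof -
  show sub: "supp (\<alpha>(x := s)) \<subseteq> insert x (supp \<alpha>)" by (auto simp: supp_def)
  then have "finite (supp (\<alpha>(x := s)))" using assms(1) finite_supp finite_subset by blast
  then show "\<alpha>(x := s) \<in> FC" using assms by (auto simp: FC_iff extensional_def)
  show "eqc (content (\<alpha>(x := s))) (add_mset s (content \<alpha>))" unfolding same_charge_def
  proof
    fix \<xi> assume \<xi>: "\<xi> \<in> Consv \<phi> b"
    let ?K = "insert x (supp \<alpha>)"
    have K: "finite ?K" "?K \<subseteq> X" "x \<notin> supp \<alpha>" using assms finite_supp by (auto simp: supp_def)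
    have "(\<Sum>z\<in>supp \<alpha>. \<xi> ((\<alpha>(x := s)) z)) = (\<Sum>z\<in>supp \<alpha>. \<xi> (\<alpha> z))"
      using K(3) by (intro sum.cong) auto
    then show "(\<Sum>s\<in>#content (\<alpha>(x := s)). \<xi> s) = (\<Sum>s\<in>#add_mset s (content \<alpha>). \<xi> s)"
      using charge_sum[OF \<xi> K(1,2) sub] charge_sum[OF \<xi> _ supp_sub order_refl] K by simp
  qed
qed

text \<open>
  The content can differ from \<open>A\<close> itself, because \<open>A\<close> may contain the base state.
\<close>

lemma placement_exists:
  assumes "L \<subseteq> X" "infinite L \<or> size A \<le> card L"
  shows "\<exists>\<alpha>\<in>FC. supp \<alpha> \<subseteq> L \<and> eqc (content \<alpha>) A"
proof -
  have "\<exists>\<alpha>\<in>FC. supp \<alpha> \<subseteq> T \<and> eqc (content \<alpha>) A" if "finite T" "T \<subseteq> X" "card T = size A" for T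
    using that
  proof (induction A arbitrary: T)
    case empty
    then show ?case by (intro bexI[of _ base]) auto
  next
    case (add s A)
    then obtain t T' where T: "T = insert t T'" "t \<notin> T'" "card T' = size A" "finite T'"
      by (metis card_Suc_eq finite_insert size_add_mset)
    then obtain \<alpha> where \<alpha>: "\<alpha> \<in> FC" "supp \<alpha> \<subseteq> T'" "eqc (content \<alpha>) A"
      using add by blast
    have t: "t \<in> X" "\<alpha> t = b" using T \<alpha> add.prems by (auto simp: supp_def)
    have "eqc (add_mset s (content \<alpha>)) (add_mset s A)"
      using same_charge_add[OF same_charge_refl[of _ "{#s#}"] \<alpha>(3)] by simp
    then show ?case using content_insert[OF \<alpha>(1) t, of s] T \<alpha>(2) same_charge_trans
      by (intro bexI[of _ "\<alpha>(t := s)"]) blast+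
  qed
  moreover have "\<exists>T. finite T \<and> T \<subseteq> L \<and> card T = size A"
    using assms(2) by (metis infinite_arbitrarily_large obtain_subset_with_card_n)
  ultimately show ?thesis using assms(1) by (meson order_trans)
qed

lemma far_placement:
  assumes "L \<subseteq> X" "infinite L" "finite F"
  shows "\<exists>\<alpha>\<in>FC. supp \<alpha> \<subseteq> L \<and> supp \<alpha> \<inter> F = {} \<and> eqc (content \<alpha>) A"
proof -
  have "L - F \<subseteq> X" "infinite (L - F)" using assms by auto
  then show ?thesis using placement_exists[of "L - F" A] by blast
qed

section \<open>Moving particles inside connected sets\<close>

lemma exch_apply:
  assumes "(x, y) \<in> E"
  shows "exch \<phi> (x, y) \<eta> z = (if z = x then fst (\<phi> (\<eta> x, \<eta> y))
    else if z = y then snd (\<phi> (\<eta> x, \<eta> y)) else \<eta> z)"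
  using assms irrefl_E by (auto simp: exch_def irrefl_def)

lemma exch_FC:
  assumes "\<eta> \<in> FC" "(x, y) \<in> E"
  shows "exch \<phi> (x, y) \<eta> \<in> FC" "supp (exch \<phi> (x, y) \<eta>) \<subseteq> supp \<eta> \<union> {x, y}"
proof -
  show sub: "supp (exch \<phi> (x, y) \<eta>) \<subseteq> supp \<eta> \<union> {x, y}"
    by (auto simp: supp_def exch_def split: if_splits)
  have "finite (supp (exch \<phi> (x, y) \<eta>))" using assms(1) finite_supp finite_subset[OF sub] by simp
  then show "exch \<phi> (x, y) \<eta> \<in> FC" using assms edge_in by (auto simp: FC_iff extensional_def exch_def)
qed

lemma exch_charge:
  assumes "\<eta> \<in> FC" "(x, y) \<in> E"
  shows "eqc (content (exch \<phi> (x, y) \<eta>)) (content \<eta>)"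
  unfolding same_charge_def
proof
  fix \<xi> assume \<xi>: "\<xi> \<in> Consv \<phi> b"
  let ?K = "supp \<eta> - {x, y}"
  have xy: "x \<noteq> y" "x \<in> X" "y \<in> X" using assms irrefl_E edge_in by (auto simp: irrefl_def)
  have K: "finite (insert x (insert y ?K))" "insert x (insert y ?K) \<subseteq> X"
    using assms(1) finite_supp xy by (auto simp: supp_def)
  have sub: "supp (exch \<phi> (x, y) \<eta>) \<subseteq> insert x (insert y ?K)" "supp \<eta> \<subseteq> insert x (insert y ?K)"
    using exch_FC[OF assms] by auto
  have "(\<Sum>z\<in>?K. \<xi> (exch \<phi> (x, y) \<eta> z)) = (\<Sum>z\<in>?K. \<xi> (\<eta> z))"
    by (intro sum.cong) (auto simp: exch_def)
  moreover have "\<xi> (\<eta> x) + \<xi> (\<eta> y) = \<xi> (fst (\<phi> (\<eta> x, \<eta> y))) + \<xi> (snd (\<phi> (\<eta> x, \<eta> y)))"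
    using \<xi> by (auto simp: Consv_def)
  ultimately show "(\<Sum>s\<in>#content (exch \<phi> (x, y) \<eta>). \<xi> s) = (\<Sum>s\<in>#content \<eta>. \<xi> s)"
    using charge_sum[OF \<xi> K sub(1)] charge_sum[OF \<xi> K sub(2)] K xy assms(2) by (simp add: exch_apply)
qed

lemma fin_transitions_iff:
  "(\<eta>, \<eta>') \<in> fin_transitions X E \<phi> b \<longleftrightarrow> \<eta> \<in> FC \<and> (\<exists>e\<in>E. \<eta>' = exch \<phi> e \<eta>)"
  using exch_FC by (auto simp: fin_transitions_def transitions_def fin_configs_def)

definition steps :: "'a set \<Rightarrow> (('a \<Rightarrow> 's) \<times> ('a \<Rightarrow> 's)) set" where
  "steps K = {(\<eta>, exch \<phi> e \<eta>) | \<eta> e. \<eta> \<in> FC \<and> e \<in> E \<inter> K \<times> K}"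

lemma steps_mono: "K \<subseteq> L \<Longrightarrow> steps K \<subseteq> steps L"
  unfolding steps_def by blast

text \<open>
  Irreducible quantification speaks of finite locales with natural numbers as vertices: number the
  vertices of \<open>K\<close>, find a path there and transport it back.
\<close>

lemma finite_steps:
  assumes K: "finite K" "K \<subseteq> X" "connected_graph E K"
    and \<eta>: "\<eta> \<in> FC" "\<eta>' \<in> FC" "supp \<eta> \<subseteq> K" "supp \<eta>' \<subseteq> K" "eqc (content \<eta>) (content \<eta>')"
  shows "(\<eta>, \<eta>') \<in> (steps K)\<^sup>*"
proof -
  obtain enc :: "'a \<Rightarrow> nat" where enc: "inj_on enc K"
    using finite_imp_inj_to_nat_seg[OF K(1)] by blast
  define Y where "Y = enc ` K"
  define F where "F = {(enc x, enc y) | x y. (x, y) \<in> E \<inter> K \<times> K}"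
  have FY: "F \<subseteq> Y \<times> Y" by (auto simp: F_def Y_def)
  have fin: "finite Y" using K by (simp add: Y_def)
  have enc_eq: "enc x = enc y \<longleftrightarrow> x = y" if "x \<in> K" "y \<in> K" for x y
    using enc that by (auto simp: inj_on_def)
  obtain x0 where x0: "x0 \<in> K" using K by (auto simp: connected_graph_def)
  have symF: "sym F" using sym_E by (auto simp: F_def sym_def)
  have "connected_graph F Y"
  proof (rule connected_graphI_root[OF symF, of "enc x0"])
    fix y assume "y \<in> Y"
    then obtain z where z: "z \<in> K" "y = enc z" by (auto simp: Y_def)
    then have "(x0, z) \<in> (E \<inter> K \<times> K)\<^sup>*" using K x0 by (auto simp: connected_graph_def)
    then have "(enc x0, enc z) \<in> F\<^sup>*"
    proof (induction rule: rtrancl_induct)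
      case (step u v)
      then have "(enc u, enc v) \<in> F" by (auto simp: F_def)
      then show ?case using step.IH by (rule rtrancl.rtrancl_into_rtrancl[rotated])
    qed auto
    moreover have "F \<inter> Y \<times> Y = F" using FY by auto
    ultimately show "(enc x0, y) \<in> (F \<inter> Y \<times> Y)\<^sup>*" using z by simp
  qed (use x0 in \<open>auto simp: Y_def\<close>)
  moreover have "finite F" using FY fin finite_subset by blast
  moreover have "irrefl F" using irrefl_E enc_eq by (auto simp: irrefl_def F_def)
  ultimately have YF: "locale_graph Y F"
    using FY symF by (auto simp: locale_graph_def)
  define code :: "('a \<Rightarrow> 's) \<Rightarrow> nat \<Rightarrow> 's" where "code \<zeta> = (\<lambda>i\<in>Y. \<zeta> (inv_into K enc i))" for \<zeta>
  have code_enc: "code \<zeta> (enc x) = \<zeta> x" if "x \<in> K" for \<zeta> x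
    using that enc by (simp add: code_def Y_def)
  have code_conf: "code \<zeta> \<in> configs Y" for \<zeta> by (auto simp: code_def configs_def)
  have "(\<Sum>i\<in>Y. \<xi> (code \<eta> i)) = (\<Sum>i\<in>Y. \<xi> (code \<eta>' i))" if "\<xi> \<in> Consv \<phi> b" for \<xi>
  proof -
    have "(\<Sum>i\<in>Y. \<xi> (code \<zeta> i)) = (\<Sum>s\<in>#content \<zeta>. \<xi> s)" if "supp \<zeta> \<subseteq> K" for \<zeta>
      unfolding charge_sum[OF \<open>\<xi> \<in> Consv \<phi> b\<close> K(1,2) that] Y_def sum.reindex[OF enc]
      by (intro sum.cong) (auto simp: code_enc)
    then show ?thesis using \<eta> that by (simp add: same_charge_def)
  qed
  then obtain p where "walk (transitions Y F \<phi>) (code \<eta>) p (code \<eta>')"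
    using irreducible YF fin code_conf unfolding irreducibly_quantified_def by blast
  then have path: "(code \<eta>, code \<eta>') \<in> (transitions Y F \<phi>)\<^sup>*" by (rule walk_rtrancl)
  define dec where "dec \<zeta> = (\<lambda>x\<in>X. if x \<in> K then \<zeta> (enc x) else b)" for \<zeta> :: "nat \<Rightarrow> 's"
  have dec_FC: "dec \<zeta> \<in> FC" for \<zeta>
  proof -
    have "supp (dec \<zeta>) \<subseteq> K" by (auto simp: supp_def dec_def split: if_splits)
    then have "finite (supp (dec \<zeta>))" using K(1) finite_subset by blast
    then show ?thesis by (simp add: FC_iff) (simp add: dec_def)
  qed
  have dec_code: "dec (code \<zeta>) = \<zeta>" if "\<zeta> \<in> FC" "supp \<zeta> \<subseteq> K" for \<zeta>
    by (rule FC_eqI[OF dec_FC that(1)]) (use that code_enc in \<open>auto simp: dec_def supp_def\<close>)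
  have "(dec (code \<eta>), dec \<zeta>) \<in> (steps K)\<^sup>*" if "(code \<eta>, \<zeta>) \<in> (transitions Y F \<phi>)\<^sup>*" for \<zeta>
    using that
  proof (induction rule: rtrancl_induct)
    case (step \<zeta> \<zeta>')
    obtain e where e: "\<zeta>' = exch \<phi> e \<zeta>" "e \<in> F" using step by (auto simp: transitions_def)
    then obtain x y where xy: "e = (enc x, enc y)" "(x, y) \<in> E" "x \<in> K" "y \<in> K" by (auto simp: F_def)
    have "dec \<zeta>' = exch \<phi> (x, y) (dec \<zeta>)"
      by (rule FC_eqI[OF dec_FC exch_FC(1)[OF dec_FC xy(2)]])
        (use xy K enc_eq in \<open>auto simp: e exch_def dec_def\<close>)
    then have "(dec \<zeta>, dec \<zeta>') \<in> steps K" using xy dec_FC by (auto simp: steps_def)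
    then show ?case using step.IH by simp
  qed auto
  from this[OF path] show ?thesis using dec_code \<eta> by simp
qed

lemma connected_steps:
  assumes "K \<subseteq> X" "connected_graph E K"
    and "\<eta> \<in> FC" "\<eta>' \<in> FC" "supp \<eta> \<subseteq> K" "supp \<eta>' \<subseteq> K" "eqc (content \<eta>) (content \<eta>')"
  shows "(\<eta>, \<eta>') \<in> (steps K)\<^sup>*"
proof -
  obtain T where "finite T" "supp \<eta> \<union> supp \<eta>' \<subseteq> T" "T \<subseteq> K" "connected_graph E T"
    using finite_connected_hull[OF sym_E assms(2), of "supp \<eta> \<union> supp \<eta>'"] assms finite_supp by auto
  then show ?thesis
    using finite_steps[of T \<eta> \<eta>'] assms rtrancl_mono[OF steps_mono[of T K]] by blast
qed

end

section \<open>The interaction of distant configurations\<close>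

text \<open>
  An integral \<open>f\<close> of a form of range \<open>R\<close>: its increment along an edge depends only on the states
  near that edge.
\<close>

locale potential = particle_locale X E \<phi> b
  for X :: "'a set" and E :: "('a \<times> 'a) set" and \<phi> :: "'s \<times> 's \<Rightarrow> 's \<times> 's" and b :: 's +
  fixes f :: "('a \<Rightarrow> 's) \<Rightarrow> real" and R :: nat
  assumes f_base: "f base = 0"
    and local: "\<And>e \<eta> \<eta>'. e \<in> E \<Longrightarrow> \<eta> \<in> FC \<Longrightarrow> \<eta>' \<in> FC \<Longrightarrow>
      (\<And>x. x \<in> edge_ball X E e (real R) \<Longrightarrow> \<eta> x = \<eta>' x) \<Longrightarrow>
      f (exch \<phi> e \<eta>) - f \<eta> = f (exch \<phi> e \<eta>') - f \<eta>'"
begin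

text \<open>
  Rearranging particles inside \<open>K\<close> uses edges inside \<open>K\<close> only, and the increments of \<open>f\<close> along
  these do not see the surroundings beyond distance \<open>R\<close>.
\<close>

lemma move:
  assumes K: "K \<subseteq> X" "connected_graph E K"
    and \<alpha>: "\<alpha> \<in> FC" "\<alpha>' \<in> FC" "supp \<alpha> \<subseteq> K" "supp \<alpha>' \<subseteq> K" "eqc (content \<alpha>) (content \<alpha>')"
    and \<eta>: "\<eta>1 \<in> FC" "\<eta>2 \<in> FC" "supp \<eta>1 \<inter> K = {}" "supp \<eta>2 \<inter> K = {}"
    and near: "\<And>k x. k \<in> K \<Longrightarrow> x \<in> X \<Longrightarrow> gdist E k x \<le> R \<Longrightarrow> \<eta>1 x = \<eta>2 x"
  shows "f (merge \<alpha> \<eta>1) - f (merge \<alpha>' \<eta>1) = f (merge \<alpha> \<eta>2) - f (merge \<alpha>' \<eta>2)"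
proof -
  have "\<zeta> \<in> FC \<and> supp \<zeta> \<subseteq> K \<and>
      f (merge \<alpha> \<eta>1) - f (merge \<zeta> \<eta>1) = f (merge \<alpha> \<eta>2) - f (merge \<zeta> \<eta>2)"
    if "(\<alpha>, \<zeta>) \<in> (steps K)\<^sup>*" for \<zeta>
    using that
  proof (induction rule: rtrancl_induct)
    case base
    then show ?case using \<alpha> by simp
  next
    case (step \<zeta> \<zeta>')
    then obtain x y where xy: "\<zeta>' = exch \<phi> (x, y) \<zeta>" "(x, y) \<in> E" "x \<in> K" "y \<in> K"
      by (auto simp: steps_def)
    have \<zeta>': "\<zeta>' \<in> FC" "supp \<zeta>' \<subseteq> K" using exch_FC[OF _ xy(2)] step.IH xy by blast+
    have comm: "merge \<zeta>' \<eta> = exch \<phi> (x, y) (merge \<zeta> \<eta>)" if "\<eta> \<in> FC" "supp \<eta> \<inter> K = {}" for \<eta>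
    proof (rule FC_eqI)
      fix z assume z: "z \<in> X"
      have "\<eta> x = b" "\<eta> y = b" using that xy edge_in by (auto simp: supp_def)
      then show "merge \<zeta>' \<eta> z = exch \<phi> (x, y) (merge \<zeta> \<eta>) z"
        using z xy edge_in by (auto simp: merge_def exch_def)
    qed (use that \<zeta>' step.IH exch_FC[OF _ xy(2)] in auto)
    have "merge \<zeta> \<eta>1 z = merge \<zeta> \<eta>2 z" if "z \<in> edge_ball X E (x, y) (real R)" for z
      using that near xy by (auto simp: edge_ball_def gball_def merge_def)
    then have "f (merge \<zeta>' \<eta>1) - f (merge \<zeta> \<eta>1) = f (merge \<zeta>' \<eta>2) - f (merge \<zeta> \<eta>2)"
      unfolding comm[OF \<eta>(1,3)] comm[OF \<eta>(2,4)] using step.IH \<eta> xy(2) by (intro local) auto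
    then show ?case using step.IH \<zeta>' by simp
  qed
  from this[OF connected_steps[OF K \<alpha>]] show ?thesis by blast
qed

text \<open>
  The defect of additivity of \<open>f\<close>.
\<close>

definition H :: "('a \<Rightarrow> 's) \<Rightarrow> ('a \<Rightarrow> 's) \<Rightarrow> real" where
  "H \<alpha> \<beta> = f (merge \<alpha> \<beta>) - f \<alpha> - f \<beta>"

definition placed :: "('a \<Rightarrow> 's) \<Rightarrow> 'a set \<Rightarrow> 's multiset \<Rightarrow> bool" where
  "placed \<alpha> K A \<longleftrightarrow> \<alpha> \<in> FC \<and> supp \<alpha> \<subseteq> K \<and> eqc (content \<alpha>) A"

definition good :: "'a set \<Rightarrow> 'a set \<Rightarrow> bool" where
  "good K L \<longleftrightarrow> K \<subseteq> X \<and> L \<subseteq> X \<and> connected_graph E K \<and> connected_graph E L \<and> separated R K L"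

lemma good_commute: "good K L \<Longrightarrow> good L K"
  by (auto simp: good_def separated_commute)

lemma placed_mono: "placed \<alpha> K A \<Longrightarrow> K \<subseteq> L \<Longrightarrow> placed \<alpha> L A"
  by (auto simp: placed_def)

lemma placed_X: "placed \<alpha> K A \<Longrightarrow> placed \<alpha> X A"
  using supp_sub by (auto simp: placed_def)

lemma placed_eqc: "eqc A A' \<Longrightarrow> placed \<alpha> K A \<Longrightarrow> placed \<alpha> K A'"
  using same_charge_trans by (auto simp: placed_def)

lemma placed_exists: "L \<subseteq> X \<Longrightarrow> infinite L \<or> size A \<le> card L \<Longrightarrow> \<exists>\<alpha>. placed \<alpha> L A"
  using placement_exists[of L A] by (auto simp: placed_def)

lemma placed_far: "L \<subseteq> X \<Longrightarrow> infinite L \<Longrightarrow> finite F \<Longrightarrow> \<exists>\<alpha>. placed \<alpha> L A \<and> supp \<alpha> \<inter> F = {}"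
  using far_placement[of L F A] by (auto simp: placed_def)

lemma placed_merge:
  assumes "placed \<alpha> K A" "placed \<beta> L B" "supp \<alpha> \<inter> supp \<beta> = {}"
  shows "placed (merge \<alpha> \<beta>) (K \<union> L) (A + B)"
  using assms content_merge[of \<alpha> \<beta>] same_charge_add by (auto simp: placed_def supp_merge)

lemma H_commute: "supp \<alpha> \<inter> supp \<beta> = {} \<Longrightarrow> H \<alpha> \<beta> = H \<beta> \<alpha>"
  by (simp add: H_def merge_commute[of \<alpha> \<beta>])

lemma good_disjoint: "good K L \<Longrightarrow> placed \<alpha> K A \<Longrightarrow> placed \<beta> L B \<Longrightarrow> supp \<alpha> \<inter> supp \<beta> = {}"
  using separated_disjoint unfolding good_def placed_def by blast

lemma H_move:
  assumes "K \<subseteq> X" "connected_graph E K" "placed \<alpha> K A" "placed \<alpha>' K A"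
    and "\<beta> \<in> FC" "separated R K (supp \<beta>)"
  shows "H \<alpha> \<beta> = H \<alpha>' \<beta>"
proof -
  have "eqc (content \<alpha>) (content \<alpha>')"
    using assms same_charge_trans same_charge_sym unfolding placed_def by blast
  moreover have "\<beta> x = base x" if "k \<in> K" "x \<in> X" "gdist E k x \<le> R" for k x
    using that assms(6) by (force simp: separated_def supp_def base_config_def)
  moreover have "supp \<beta> \<inter> K = {}" using separated_disjoint[OF assms(6)] by blast
  ultimately have "f (merge \<alpha> \<beta>) - f (merge \<alpha>' \<beta>) = f (merge \<alpha> base) - f (merge \<alpha>' base)"
    using assms by (intro move[of K]) (auto simp: placed_def)
  then show ?thesis using assms by (simp add: H_def placed_def)
qed

text \<open>
  On a separated pair of connected sets the particles of either side can be rearranged without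
  the other side noticing, so \<open>H\<close> sees only the two charges.
\<close>

lemma H_good:
  assumes KL: "good K L" and "placed \<alpha> K A" "placed \<alpha>' K A" "placed \<beta> L B" "placed \<beta>' L B"
  shows "H \<alpha> \<beta> = H \<alpha>' \<beta>'"
proof -
  have K: "K \<subseteq> X" "connected_graph E K" "L \<subseteq> X" "connected_graph E L" and sep: "separated R K L"
    using KL by (auto simp: good_def)
  have FC: "\<beta> \<in> FC" "\<alpha>' \<in> FC" and sub: "supp \<beta> \<subseteq> L" "supp \<alpha>' \<subseteq> K"
    using assms by (auto simp: placed_def)
  have sep': "separated R K (supp \<beta>)" "separated R L (supp \<alpha>')"
    using separated_mono[OF sep order_refl sub(1)] separated_mono[OF sep sub(2) order_refl]
      separated_commute by blast+
  have "H \<alpha> \<beta> = H \<alpha>' \<beta>" by (rule H_move[OF K(1,2) assms(2,3) FC(1) sep'(1)])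
  also have "\<dots> = H \<beta> \<alpha>'" using good_disjoint[OF KL] assms by (intro H_commute) blast
  also have "\<dots> = H \<beta>' \<alpha>'" by (rule H_move[OF K(3,4) assms(4,5) FC(2) sep'(2)])
  also have "\<dots> = H \<alpha>' \<beta>'" using good_disjoint[OF KL assms(3,5)] by (intro H_commute) blast
  finally show ?thesis .
qed

text \<open>
  Two configurations of the same charge are joined by moves in some finite connected set, and
  a configuration far from that set does not notice these moves.
\<close>

lemma H_far:
  assumes "placed \<alpha> X A" "placed \<alpha>' X A"
  shows "\<exists>F. finite F \<and> (\<forall>\<beta>. \<beta> \<in> FC \<longrightarrow> supp \<beta> \<inter> F = {} \<longrightarrow> H \<alpha> \<beta> = H \<alpha>' \<beta>)"
proof -
  have "finite (supp \<alpha> \<union> supp \<alpha>')" "supp \<alpha> \<union> supp \<alpha>' \<subseteq> X"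
    using assms finite_supp by (auto simp: placed_def)
  then obtain K where K: "finite K" "supp \<alpha> \<union> supp \<alpha>' \<subseteq> K" "K \<subseteq> X" "connected_graph E K"
    using finite_connected_hull[OF sym_E connected_X, of "supp \<alpha> \<union> supp \<alpha>'"] by blast
  let ?F = "{y \<in> X. \<exists>x\<in>K. gdist E x y \<le> R}"
  have "H \<alpha> \<beta> = H \<alpha>' \<beta>" if \<beta>: "\<beta> \<in> FC" "supp \<beta> \<inter> ?F = {}" for \<beta>
  proof (rule H_move[OF K(3,4) _ _ \<beta>(1), where A = A])
    show "separated R K (supp \<beta>)" unfolding separated_def
    proof (intro ballI)
      fix x y assume "x \<in> K" "y \<in> supp \<beta>"
      then have "y \<in> X" "y \<notin> ?F" using \<beta> supp_sub by blast+
      then show "R < gdist E x y" using \<open>x \<in> K\<close> by (auto simp: not_le)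
    qed
  qed (use assms K in \<open>auto simp: placed_def\<close>)
  then show ?thesis using finite_near[OF K(1,3)] by blast
qed

text \<open>
  Two ways of expanding \<open>f\<close> at a superposition of three configurations; this is where the cocycle
  identities come from.
\<close>

lemma H_assoc:
  "H \<alpha> \<beta> + H (merge \<alpha> \<beta>) \<gamma> = H \<beta> \<gamma> + H \<alpha> (merge \<beta> \<gamma>)"
  by (simp add: H_def merge_assoc)

text \<open>
  Here \<open>L\<close> has to be infinite, since only then can the particles on \<open>L\<close> be moved far away, while
  \<open>K\<close> may be any connected set; for instance a large ball is paired with a component of the complement
  of a larger ball.
\<close>

definition on_pairs :: "('s multiset \<Rightarrow> 's multiset \<Rightarrow> real) \<Rightarrow> bool" where
  "on_pairs h \<longleftrightarrow> (\<forall>K L \<alpha> \<beta> A B. good K L \<longrightarrow> infinite L \<longrightarrow> placed \<alpha> K A \<longrightarrow> placed \<beta> L B \<longrightarrow> H \<alpha> \<beta> = h A B)"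

lemma on_pairsD:
  "on_pairs h \<Longrightarrow> good K L \<Longrightarrow> infinite L \<Longrightarrow> placed \<alpha> K A \<Longrightarrow> placed \<beta> L B \<Longrightarrow> H \<alpha> \<beta> = h A B"
  unfolding on_pairs_def by blast

text \<open>
  If each of two distant configurations lives on the small side of a pair whose large side
  contains the other one, \<open>H\<close> can be computed from both pairs.
\<close>

lemma on_pairs_symmetric:
  assumes h: "on_pairs h" and KL: "good K L" "infinite L" and KL': "good K' L'" "infinite L'"
    and sub: "K \<subseteq> L'" "K' \<subseteq> L" and K: "infinite K \<or> size A \<le> card K" "infinite K' \<or> size B \<le> card K'"
  shows "h A B = h B A"
proof -
  obtain \<alpha> where \<alpha>: "placed \<alpha> K A" using placed_exists[of K A] KL(1) K(1) by (auto simp: good_def)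
  obtain \<beta> where \<beta>: "placed \<beta> K' B" using placed_exists[of K' B] KL'(1) K(2) by (auto simp: good_def)
  note \<alpha>' = placed_mono[OF \<alpha> sub(1)] and \<beta>' = placed_mono[OF \<beta> sub(2)]
  have "H \<alpha> \<beta> = H \<beta> \<alpha>" using good_disjoint[OF KL(1) \<alpha> \<beta>'] by (rule H_commute)
  then show ?thesis using on_pairsD[OF h KL \<alpha> \<beta>'] on_pairsD[OF h KL' \<beta> \<alpha>'] by simp
qed

subsection \<open>Large sets with connected complement\<close>

text \<open>
  Arbitrarily large connected sets \<open>K\<close> that leave almost everything connected. This is weaker than
  having one end: the sets \<open>K\<close> for different sizes may lie anywhere.
\<close>

definition nonseparating :: bool where
  "nonseparating \<longleftrightarrow> (\<forall>n. \<exists>K L. good K L \<and> n \<le> card K \<and> finite (X - L))"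

lemma good_gball:
  assumes "x \<in> X" "r \<ge> real (n + R)" "connected_graph E (X - gball X E x r)"
  shows "good (gball X E x (real n)) (X - gball X E x r)"
proof -
  have "gball X E x (real (n + R)) \<subseteq> gball X E x r" using assms(2) by (auto simp: gball_def)
  then have "separated R (gball X E x (real n)) (X - gball X E x r)"
    by (intro separated_gball_compl[OF assms(1)]) auto
  then show ?thesis using assms connected_gball[OF assms(1), of "real n"]
    by (auto simp: good_def gball_def)
qed

lemma nonseparatingI:
  assumes "\<And>n. \<exists>x\<in>X. \<exists>r. r \<ge> real n \<and> connected_graph E (X - gball X E x r)"
  shows "nonseparating"
  unfolding nonseparating_def
proof
  fix n
  obtain x r where x: "x \<in> X" "r \<ge> real (n + R)" "connected_graph E (X - gball X E x r)"
    using assms by blast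
  have "finite (X - (X - gball X E x r))"
    using finite_gball[OF x(1), of r] by (rule finite_subset[rotated]) blast
  then show "\<exists>K L. good K L \<and> n \<le> card K \<and> finite (X - L)"
    using good_gball[OF x] card_gball[OF x(1), of n] by blast
qed

text \<open>
  Carry \<open>\<alpha>\<close> into a large set \<open>K\<close>; the remaining configuration, being far out, can then move freely
  in the connected set \<open>L\<close>.
\<close>

lemma nonseparating_value:
  assumes nonseparating
  shows "\<exists>v. \<forall>\<alpha>. placed \<alpha> X A \<longrightarrow> (\<exists>F. finite F \<and> (\<forall>\<beta>. placed \<beta> X B \<longrightarrow> supp \<beta> \<inter> F = {} \<longrightarrow> H \<alpha> \<beta> = v))"
proof -
  obtain K L where KL: "good K L" "size A \<le> card K" "finite (X - L)"
    using assms unfolding nonseparating_def by blast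
  have "infinite L" using infinite_X KL(3) finite_Diff2 by blast
  then obtain \<beta>0 where \<beta>0: "placed \<beta>0 L B" using placed_exists[of L B] KL(1) by (auto simp: good_def)
  obtain \<alpha>0 where \<alpha>0: "placed \<alpha>0 K A" using placed_exists[of K A] KL(1,2) by (auto simp: good_def)
  have "\<exists>F. finite F \<and> (\<forall>\<beta>. placed \<beta> X B \<longrightarrow> supp \<beta> \<inter> F = {} \<longrightarrow> H \<alpha> \<beta> = H \<alpha>0 \<beta>0)"
    if \<alpha>: "placed \<alpha> X A" for \<alpha>
  proof -
    obtain F where F: "finite F" "\<And>\<beta>. \<beta> \<in> FC \<Longrightarrow> supp \<beta> \<inter> F = {} \<Longrightarrow> H \<alpha> \<beta> = H \<alpha>0 \<beta>"
      using H_far[OF \<alpha> placed_X[OF \<alpha>0]] by blast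
    have "H \<alpha> \<beta> = H \<alpha>0 \<beta>0" if \<beta>: "placed \<beta> X B" "supp \<beta> \<inter> (F \<union> (X - L)) = {}" for \<beta>
    proof -
      have "supp \<beta> \<inter> F = {}" "supp \<beta> \<subseteq> L" using \<beta> supp_sub[of \<beta>] by blast+
      then have "placed \<beta> L B" "H \<alpha> \<beta> = H \<alpha>0 \<beta>" using \<beta> F by (auto simp: placed_def)
      then show ?thesis using H_good[OF KL(1) \<alpha>0 \<alpha>0 _ \<beta>0] by metis
    qed
    then show ?thesis using F(1) KL(3) by (metis finite_UnI)
  qed
  then show ?thesis by blast
qed

lemma nonseparating_pairs:
  assumes nonseparating
  shows "\<exists>h. on_pairs h"
proof -
  obtain h where h: "\<And>A B \<alpha>. placed \<alpha> X A \<Longrightarrow>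
      \<exists>F. finite F \<and> (\<forall>\<beta>. placed \<beta> X B \<longrightarrow> supp \<beta> \<inter> F = {} \<longrightarrow> H \<alpha> \<beta> = h A B)"
    using nonseparating_value[OF assms] by metis
  have "H \<alpha> \<beta> = h A B"
    if KL: "good K L" "infinite L" and \<alpha>: "placed \<alpha> K A" and \<beta>: "placed \<beta> L B" for K L \<alpha> \<beta> A B
  proof -
    obtain F where F: "finite F" "\<And>\<beta>. placed \<beta> X B \<Longrightarrow> supp \<beta> \<inter> F = {} \<Longrightarrow> H \<alpha> \<beta> = h A B"
      using h[OF placed_X[OF \<alpha>]] by blast
    obtain \<beta>' where \<beta>': "placed \<beta>' L B" "supp \<beta>' \<inter> F = {}"
      using placed_far KL F(1) by (metis good_def)
    have "H \<alpha> \<beta> = H \<alpha> \<beta>'" by (rule H_good[OF KL(1) \<alpha> \<alpha> \<beta> \<beta>'(1)])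
    also have "\<dots> = h A B" using F(2)[OF placed_X[OF \<beta>'(1)] \<beta>'(2)] .
    finally show ?thesis .
  qed
  then show ?thesis unfolding on_pairs_def by blast
qed

text \<open>
  Both pairs are needed: \<open>X - C\<close> with \<open>W\<close> to remove particles from \<open>C\<close>, and \<open>W\<close> with another
  component to compare different components.
\<close>

lemma deep_good:
  assumes P: "pieces x r P" and x: "x \<in> X" and C: "C \<in> P"
  shows "\<exists>W\<subseteq>C. infinite W \<and> good (X - C) W \<and> (\<forall>D\<in>P. D \<noteq> C \<longrightarrow> good W D)"
proof -
  obtain W where W: "W \<subseteq> C" "infinite W" "connected_graph E W" "separated R W (X - C)"
    using deep_part[OF P x C] by blast
  have CX: "C \<subseteq> X" using pieces_subset[OF P C] .
  have "good (X - C) W" using W CX connected_compl_piece[OF P x C] separated_commute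
    unfolding good_def by blast
  moreover have "good W D" if D: "D \<in> P" "D \<noteq> C" for D
  proof -
    have "D \<subseteq> X - C" using pieces_subset[OF P D(1)] piecesD(6)[OF P C D(1)] D(2) by blast
    then have "separated R W D" using separated_mono[OF W(4)] by blast
    then show ?thesis using W CX pieces_subset[OF P D(1)] piecesD(5)[OF P D(1)]
      unfolding good_def by blast
  qed
  ultimately show ?thesis using W by blast
qed

text \<open>
  A deep part of one component and another component are both infinite, so either of them can serve
  as the large side of a pair.
\<close>

lemma symmetric_if_two_pieces:
  assumes h: "on_pairs h" and P: "pieces x r P" and x: "x \<in> X" and CD: "C \<in> P" "D \<in> P" "C \<noteq> D"
  shows "h A B = h B A"
proof -
  obtain W where W: "infinite W" "good W D" using deep_good[OF P x CD(1)] CD by blast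
  have "infinite D" using piecesD(4)[OF P CD(2)] .
  then show ?thesis using on_pairs_symmetric[OF h W(2) _ good_commute[OF W(2)] W(1)] W by blast
qed

text \<open>
  Each of two large balls far apart lies in the connected complement of the other one.
\<close>

lemma symmetric_if_balls_nonseparating:
  assumes h: "on_pairs h" and conn: "\<And>x r. x \<in> X \<Longrightarrow> connected_graph E (X - gball X E x (real r))"
  shows "h A B = h B A"
proof -
  define n where "n = max (size A) (size B)"
  obtain x where x: "x \<in> X" using connected_X by (auto simp: connected_graph_def)
  have "\<not> X \<subseteq> gball X E x (real (2 * n + 2 * R))"
    using infinite_X finite_gball[OF x] finite_subset by blast
  then obtain y where "y \<in> X" "\<not> gdist E x y \<le> 2 * n + 2 * R"
    by (auto simp: gball_def simp del: of_nat_add of_nat_mult)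
  then have y: "y \<in> X" "gdist E x y > 2 * n + 2 * R" by auto
  let ?K = "\<lambda>z. gball X E z (real n)" and ?L = "\<lambda>z. X - gball X E z (real (n + R))"
  have good: "good (?K z) (?L z)" "infinite (?L z)" "n \<le> card (?K z)" if "z \<in> X" for z
    using good_gball[OF that order_refl conn[OF that]] card_gball[OF that] infinite_X
      finite_gball[OF that] by (auto simp: finite_Diff2 simp del: of_nat_add)
  have sub: "?K z \<subseteq> ?L w" if "z \<in> X" "w \<in> X" "gdist E w z > 2 * n + 2 * R" for z w
  proof
    fix u assume "u \<in> ?K z"
    then have u: "u \<in> X" "gdist E z u \<le> n" by (auto simp: gball_def)
    then have "gdist E w u > n + R"
      using gdist_triangle[OF that(2) u(1) that(1)] gdist_commute[of u z] that(3) by simp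
    then show "u \<in> ?L w" using u by (auto simp: gball_def)
  qed
  have "?K x \<subseteq> ?L y" "?K y \<subseteq> ?L x" using sub x y gdist_commute[of x y] by auto
  moreover have "size A \<le> card (?K x)" "size B \<le> card (?K y)"
    using good(3)[OF x] good(3)[OF y(1)] by (auto simp: n_def)
  ultimately show ?thesis
    using on_pairs_symmetric[OF h good(1,2)[OF x] good(1,2)[OF y(1)]] by blast
qed

end

subsection \<open>Balls whose complement has several components\<close>

locale several_pieces = potential X E \<phi> b f R
  for X :: "'a set" and E :: "('a \<times> 'a) set" and \<phi> :: "'s \<times> 's \<Rightarrow> 's \<times> 's" and b :: 's
    and f :: "('a \<Rightarrow> 's) \<Rightarrow> real" and R :: nat +
  fixes x :: 'a and r :: nat and P :: "'a set set"
  assumes x: "x \<in> X" and P: "pieces x r P" and two: "\<exists>C\<in>P. \<exists>D\<in>P. C \<noteq> D"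
begin

text \<open>
  Two components themselves may be close to each other across the ball; a deep part of one
  component is separated from every other component.
\<close>

definition W :: "'a set \<Rightarrow> 'a set" where
  "W C = (SOME W. W \<subseteq> C \<and> infinite W \<and> (\<forall>D\<in>P. D \<noteq> C \<longrightarrow> good W D))"

lemma W:
  assumes "C \<in> P"
  shows W_sub: "W C \<subseteq> C" and W_infinite: "infinite (W C)"
    and W_good: "D \<in> P \<Longrightarrow> C \<noteq> D \<Longrightarrow> good (W C) D"
proof -
  have "W C \<subseteq> C \<and> infinite (W C) \<and> (\<forall>D\<in>P. D \<noteq> C \<longrightarrow> good (W C) D)"
    unfolding W_def by (rule someI_ex) (use deep_good[OF P x assms] in blast)
  then show "W C \<subseteq> C" "infinite (W C)" "D \<in> P \<Longrightarrow> C \<noteq> D \<Longrightarrow> good (W C) D"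
    by auto
qed

text \<open>
  The common value of \<open>H\<close> with first charge in (the deep part of) \<open>C\<close> and second charge in
  \<open>D\<close>.
\<close>

definition c :: "'a set \<Rightarrow> 'a set \<Rightarrow> 's multiset \<Rightarrow> 's multiset \<Rightarrow> real" where
  "c C D A B = (SOME v. \<exists>\<alpha> \<beta>. placed \<alpha> (W C) A \<and> placed \<beta> D B \<and> v = H \<alpha> \<beta>)"

lemma W_placed: "C \<in> P \<Longrightarrow> finite F \<Longrightarrow> \<exists>\<alpha>. placed \<alpha> (W C) A \<and> supp \<alpha> \<inter> F = {}"
  using placed_far[of "W C" F A] W_sub[of C] W_infinite[of C] pieces_subset[OF P, of C] by auto

lemma piece_placed: "C \<in> P \<Longrightarrow> finite F \<Longrightarrow> \<exists>\<alpha>. placed \<alpha> C A \<and> supp \<alpha> \<inter> F = {}"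
  using placed_far[of C F A] piecesD(4)[OF P, of C] pieces_subset[OF P, of C] by auto

lemma c:
  assumes "C \<in> P" "D \<in> P" "C \<noteq> D" "placed \<alpha> (W C) A" "placed \<beta> D B"
  shows "H \<alpha> \<beta> = c C D A B"
proof -
  have "\<exists>\<alpha>' \<beta>'. placed \<alpha>' (W C) A \<and> placed \<beta>' D B \<and> c C D A B = H \<alpha>' \<beta>'"
    unfolding c_def by (rule someI_ex) (use assms in blast)
  then obtain \<alpha>' \<beta>' where "placed \<alpha>' (W C) A" "placed \<beta>' D B" "c C D A B = H \<alpha>' \<beta>'" by blast
  then show ?thesis using H_good[OF W_good[OF assms(1-3)] assms(4) _ assms(5)] by metis
qed

lemma c_swap:
  assumes "C \<in> P" "D \<in> P" "C \<noteq> D"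
  shows "c C D A B = c D C B A"
proof -
  obtain \<alpha> \<beta> where \<alpha>: "placed \<alpha> (W C) A" and \<beta>: "placed \<beta> (W D) B"
    using W_placed[OF assms(1), of "{}"] W_placed[OF assms(2), of "{}"] by blast
  have sub: "placed \<alpha> C A" "placed \<beta> D B"
    using placed_mono[OF \<alpha> W_sub[OF assms(1)]] placed_mono[OF \<beta> W_sub[OF assms(2)]] by auto
  have "H \<alpha> \<beta> = H \<beta> \<alpha>" by (rule H_commute[OF good_disjoint[OF W_good[OF assms] \<alpha> sub(2)]])
  then show ?thesis using c[OF assms \<alpha> sub(2)] c[OF assms(2,1) _ \<beta> sub(1)] assms by simp
qed

text \<open>
  With \<open>\<alpha>\<close> far out in \<open>C\<close>, the other configuration can be carried from \<open>D\<close> to \<open>D'\<close>.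
\<close>

lemma c_target:
  assumes "C \<in> P" "D \<in> P" "D' \<in> P" "C \<noteq> D" "C \<noteq> D'"
  shows "c C D A B = c C D' A B"
proof -
  obtain \<beta> \<beta>' where \<beta>: "placed \<beta> D B" and \<beta>': "placed \<beta>' D' B"
    using piece_placed[OF assms(2), of "{}"] piece_placed[OF assms(3), of "{}"] by blast
  obtain F where F: "finite F" "\<And>\<alpha>. \<alpha> \<in> FC \<Longrightarrow> supp \<alpha> \<inter> F = {} \<Longrightarrow> H \<beta> \<alpha> = H \<beta>' \<alpha>"
    using H_far[OF placed_X[OF \<beta>] placed_X[OF \<beta>']] by blast
  obtain \<alpha> where \<alpha>: "placed \<alpha> (W C) A" "supp \<alpha> \<inter> F = {}"
    using W_placed[OF assms(1) F(1)] by blast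
  have "supp \<alpha> \<inter> supp \<beta> = {}" "supp \<alpha> \<inter> supp \<beta>' = {}"
    using good_disjoint[OF W_good \<alpha>(1) \<beta>] good_disjoint[OF W_good \<alpha>(1) \<beta>'] assms by auto
  then have "H \<alpha> \<beta> = H \<alpha> \<beta>'" using H_commute[of \<alpha>] F(2)[of \<alpha>] \<alpha> by (simp add: placed_def)
  then show ?thesis
    using c[OF assms(1,2,4) \<alpha>(1) \<beta>] c[OF assms(1,3,5) \<alpha>(1) \<beta>'] by simp
qed

lemma c_eqc:
  assumes "C \<in> P" "D \<in> P" "C \<noteq> D"
  shows "eqc A A' \<Longrightarrow> c C D A B = c C D A' B" "eqc B B' \<Longrightarrow> c C D A B = c C D A B'"
proof -
  obtain \<alpha> \<beta> where "placed \<alpha> (W C) A" "placed \<beta> D B"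
    using W_placed[OF assms(1), of "{}"] piece_placed[OF assms(2), of "{}"] by blast
  note * = c[OF assms this] c[OF assms placed_eqc[OF _ this(1)] this(2), of A']
    c[OF assms this(1) placed_eqc[OF _ this(2)], of B']
  show "eqc A A' \<Longrightarrow> c C D A B = c C D A' B" "eqc B B' \<Longrightarrow> c C D A B = c C D A B'"
    using * by auto
qed

text \<open>
  Put the first configuration in \<open>C\<close>, the second in \<open>D\<close> and the third far out in \<open>D\<close>. Where the
  second one belongs to the left argument, it can be carried over to \<open>C\<close> out of sight of the
  third.
\<close>

lemma c_cocycle:
  assumes CD: "C \<in> P" "D \<in> P" "C \<noteq> D"
  shows "cocycle (c C D)"
  unfolding cocycle_def
proof (intro allI)
  fix p q r
  obtain \<alpha> \<beta> \<beta>' \<delta> where \<alpha>: "placed \<alpha> (W C) p" and \<beta>: "placed \<beta> D q"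
    and \<beta>': "placed \<beta>' (W C) q" and \<delta>: "placed \<delta> (W C) (p + q)"
    using W_placed[OF CD(1) finite.emptyI] piece_placed[OF CD(2) finite.emptyI] by metis
  have good: "good (W C) D" using W_good CD by blast
  have ab: "placed (merge \<alpha> \<beta>) X (p + q)"
    using placed_merge[OF \<alpha> \<beta> good_disjoint[OF good \<alpha> \<beta>]] placed_X by blast
  obtain F where F: "finite F" "\<And>\<gamma>. \<gamma> \<in> FC \<Longrightarrow> supp \<gamma> \<inter> F = {} \<Longrightarrow> H \<beta> \<gamma> = H \<beta>' \<gamma>"
    using H_far[OF placed_X[OF \<beta>] placed_X[OF \<beta>']] by blast
  obtain F' where F': "finite F'" "\<And>\<gamma>. \<gamma> \<in> FC \<Longrightarrow> supp \<gamma> \<inter> F' = {} \<Longrightarrow> H (merge \<alpha> \<beta>) \<gamma> = H \<delta> \<gamma>"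
    using H_far[OF ab placed_X[OF \<delta>]] by blast
  have "finite (F \<union> F' \<union> supp \<beta>)" using F(1) F'(1) \<beta> finite_supp by (simp add: placed_def)
  from piece_placed[OF CD(2) this, of r]
  obtain \<gamma> where \<gamma>: "placed \<gamma> D r" "supp \<gamma> \<inter> (F \<union> F' \<union> supp \<beta>) = {}" by blast
  have \<gamma>_FC: "\<gamma> \<in> FC" and disj: "supp \<gamma> \<inter> F = {}" "supp \<gamma> \<inter> F' = {}" "supp \<beta> \<inter> supp \<gamma> = {}"
    using \<gamma> by (auto simp: placed_def simp del: Int_Un_distrib)
  have "placed (merge \<beta> \<gamma>) D (q + r)" using placed_merge[OF \<beta> \<gamma>(1) disj(3)] by simp
  then have "H \<alpha> (merge \<beta> \<gamma>) = c C D p (q + r)" by (rule c[OF CD \<alpha>])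
  moreover have "H \<alpha> \<beta> = c C D p q" by (rule c[OF CD \<alpha> \<beta>])
  moreover have "H \<beta> \<gamma> = c C D q r" using F(2)[OF \<gamma>_FC disj(1)] c[OF CD \<beta>' \<gamma>(1)] by simp
  moreover have "H (merge \<alpha> \<beta>) \<gamma> = c C D (p + q) r"
    using F'(2)[OF \<gamma>_FC disj(2)] c[OF CD \<delta> \<gamma>(1)] by simp
  ultimately show "c C D p q + c C D (p + q) r = c C D q r + c C D p (q + r)"
    using H_assoc[of \<alpha> \<beta> \<gamma>] by simp
qed

text \<open>
  Rotate through a third component: the two configurations exchange their sides without ever
  coming close.
\<close>

lemma c_symmetric_three:
  assumes three: "\<And>C D. C \<in> P \<Longrightarrow> D \<in> P \<Longrightarrow> \<exists>T\<in>P. T \<noteq> C \<and> T \<noteq> D"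
    and CD: "C \<in> P" "D \<in> P" "C \<noteq> D"
  shows "c C D A B = c C D B A"
proof -
  obtain T where T: "T \<in> P" "T \<noteq> C" "T \<noteq> D" using three[OF CD(1,2)] by blast
  have "c C D A B = c C T A B" by (rule c_target) (use T CD in auto)
  also have "\<dots> = c T C B A" by (rule c_swap) (use T CD in auto)
  also have "\<dots> = c T D B A" by (rule c_target) (use T CD in auto)
  also have "\<dots> = c D T A B" by (rule c_swap) (use T CD in auto)
  also have "\<dots> = c D C A B" by (rule c_target) (use T CD in auto)
  also have "\<dots> = c C D B A" by (rule c_swap) (use CD in auto)
  finally show ?thesis .
qed

lemma c_symmetric_simple:
  assumes "simple_interaction \<phi> b" "C \<in> P" "D \<in> P" "C \<noteq> D"
  shows "c C D A B = c C D B A"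
proof -
  obtain \<Gamma> where \<Gamma>: "\<And>A. \<exists>m n. eqc (A + repeat_mset m \<Gamma>) (repeat_mset n \<Gamma>)"
    using cyclic_charges_if_simple[OF assms(1)] by blast
  show ?thesis
    by (rule cocycle_symmetric_if_cyclic[OF c_cocycle[OF assms(2-)] c_eqc[OF assms(2-)] \<Gamma>])
qed

text \<open>
  Symmetry makes all the functions \<open>c C D\<close> equal. An arbitrary infinite \<open>L\<close> meets some component
  \<open>D\<close> in an infinite set, so \<open>\<beta>\<close> can be moved far out in \<open>D\<close> and then \<open>\<alpha>\<close> to another component.
\<close>

lemma symmetric_pairs:
  assumes sym: "\<And>C D A B. C \<in> P \<Longrightarrow> D \<in> P \<Longrightarrow> C \<noteq> D \<Longrightarrow> c C D A B = c C D B A"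
  shows "\<exists>h. on_pairs h \<and> (\<forall>A B. h A B = h B A)"
proof -
  obtain C0 D0 where CD0: "C0 \<in> P" "D0 \<in> P" "C0 \<noteq> D0" using two by blast
  have rev: "c C D A B = c D C A B" if "C \<in> P" "D \<in> P" "C \<noteq> D" for C D A B
    unfolding c_swap[OF that] by (rule sym) (use that in auto)
  have all: "c C D A B = c C0 D0 A B" if CD: "C \<in> P" "D \<in> P" "C \<noteq> D" for C D A B
  proof (cases "C = D0")
    case True
    then have "c C D A B = c D0 C0 A B" using c_target CD CD0 by blast
    then show ?thesis using rev CD0 by simp
  next
    case False
    have "c C D A B = c C D0 A B" by (rule c_target) (use False CD CD0 in auto)
    also have "\<dots> = c D0 C A B" by (rule rev) (use False CD CD0 in auto)
    also have "\<dots> = c D0 C0 A B" by (rule c_target) (use False CD CD0 in auto)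
    also have "\<dots> = c C0 D0 A B" by (rule rev) (use CD0 in auto)
    finally show ?thesis .
  qed
  have "H \<alpha> \<beta> = c C0 D0 A B"
    if KL: "good K L" "infinite L" and \<alpha>: "placed \<alpha> K A" and \<beta>: "placed \<beta> L B" for K L \<alpha> \<beta> A B
  proof -
    have LX: "L \<subseteq> X" using KL by (simp add: good_def)
    then obtain D where D: "D \<in> P" "infinite (L \<inter> D)" using pieces_meet[OF P x KL(2)] by blast
    obtain C where C: "C \<in> P" "C \<noteq> D" using CD0 by metis
    obtain \<alpha>' where \<alpha>': "placed \<alpha>' (W C) A" using W_placed[OF C(1), of "{}"] by blast
    obtain F where F: "finite F" "\<And>\<beta>. \<beta> \<in> FC \<Longrightarrow> supp \<beta> \<inter> F = {} \<Longrightarrow> H \<alpha> \<beta> = H \<alpha>' \<beta>"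
      using H_far[OF placed_X[OF \<alpha>] placed_X[OF \<alpha>']] by blast
    obtain \<beta>' where \<beta>': "placed \<beta>' (L \<inter> D) B" "supp \<beta>' \<inter> F = {}"
      using placed_far[of "L \<inter> D" F] D(2) F(1) LX by blast
    have "H \<alpha> \<beta> = H \<alpha> \<beta>'" using H_good[OF KL(1) \<alpha> \<alpha> \<beta>] placed_mono[OF \<beta>'(1)] by blast
    also have "\<dots> = H \<alpha>' \<beta>'" using F(2) \<beta>' by (auto simp: placed_def)
    also have "\<dots> = c C D A B" using c[OF C(1) D(1) C(2) \<alpha>'] placed_mono[OF \<beta>'(1)] by blast
    also have "\<dots> = c C0 D0 A B" using all C D by blast
    finally show ?thesis .
  qed
  then have "on_pairs (c C0 D0)" unfolding on_pairs_def by blast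
  then show ?thesis using sym[OF CD0] by blast
qed

end

subsection \<open>Existence of the pairing\<close>

context potential
begin

text \<open>
  Either no ball separates the locale, or some ball leaves at least two components. In the second
  case, symmetry comes from a simple interaction, from a ball leaving three components, or from
  large balls with connected complement together with the two components.
\<close>

theorem pairing_exists:
  assumes "transferable X E \<or> simple_interaction \<phi> b"
  shows "\<exists>h. on_pairs h \<and> (\<forall>A B. h A B = h B A)"
proof (cases "\<exists>x\<in>X. \<exists>r P. pieces x r P \<and> (\<exists>C\<in>P. \<exists>D\<in>P. C \<noteq> D)")
  case False
  have conn: "connected_graph E (X - gball X E x (real r))" if x: "x \<in> X" for x r
  proof -
    obtain P where P: "pieces x r P" using pieces_exist[OF x] by blast
    obtain C where C: "C \<in> P" using piecesD(2)[OF P] by blast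
    have "D = C" if "D \<in> P" for D using False x P C that by metis
    then have "P = {C}" using C by blast
    then show ?thesis using piecesD(3,5)[OF P] by auto
  qed
  obtain x where "x \<in> X" using connected_X by (auto simp: connected_graph_def)
  then have nonseparating using conn by (intro nonseparatingI) blast
  then obtain h where "on_pairs h" using nonseparating_pairs by blast
  then show ?thesis using symmetric_if_balls_nonseparating conn by blast
next
  case True
  then obtain x r P C D where P: "x \<in> X" "pieces x r P" "C \<in> P" "D \<in> P" "C \<noteq> D" by blast
  consider "simple_interaction \<phi> b"
    | (many) y \<rho> where "y \<in> X" "\<rho> > 0" "card (graph_components E (X - gball X E y \<rho>)) \<ge> 3"
    | (big) "\<forall>n::nat. \<exists>x\<in>X. \<exists>r>0. r \<ge> real n \<and> connected_graph E (X - gball X E x r)"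
    using assms unfolding transferable_def by blast
  then show ?thesis
  proof cases
    case 1
    interpret several_pieces X E \<phi> b f R x r P by unfold_locales (use P in blast)+
    show ?thesis using symmetric_pairs c_symmetric_simple[OF 1] by blast
  next
    case many
    define s where "s = nat \<lfloor>\<rho>\<rfloor>"
    obtain Q where Q: "pieces y s Q" using pieces_exist[OF many(1)] by blast
    have "card Q \<ge> 3"
      using many pieces_components[OF Q] gball_floor[of \<rho> y] by (simp add: s_def)
    then have three: "\<exists>T\<in>Q. T \<noteq> C \<and> T \<noteq> D" for C D
      using card_mono[of "{C, D}" Q] card_insert_le_m1[of 2 "{D}" C] by fastforce
    moreover have "\<exists>C\<in>Q. \<exists>D\<in>Q. C \<noteq> D" using three by metis
    ultimately interpret several_pieces X E \<phi> b f R y s Q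
      by unfold_locales (use many Q in blast)+
    show ?thesis using symmetric_pairs c_symmetric_three[OF three] by blast
  next
    case big
    then have nonseparating by (intro nonseparatingI) blast
    then obtain h where "on_pairs h" using nonseparating_pairs by blast
    then show ?thesis using symmetric_if_two_pieces[OF _ P(2,1,3-)] by blast
  qed
qed

end

section \<open>Correction by a function of the charge\<close>

context potential
begin

lemma good_pair_over:
  assumes "finite F" "F \<subseteq> X" "infinite L" "L \<subseteq> X"
  shows "\<exists>K L'. F \<subseteq> K \<and> good K L' \<and> infinite (L \<inter> L')"
proof -
  obtain K where K: "finite K" "F \<subseteq> K" "K \<subseteq> X" "connected_graph E K"
    using finite_connected_hull[OF sym_E connected_X assms(1,2)] by blast
  obtain L' where "L' \<subseteq> X" "connected_graph E L'" "separated R K L'" "infinite (L \<inter> L')"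
    using far_connected_piece[OF K(1,3) assms(3,4)] by blast
  then show ?thesis using K by (auto simp: good_def)
qed

lemma placed_good_pair:
  assumes "infinite L" "L \<subseteq> X"
  shows "\<exists>K L' \<alpha>. good K L' \<and> infinite (L \<inter> L') \<and> placed \<alpha> K A"
proof -
  obtain F where F: "finite F" "F \<subseteq> X" "card F = size A"
    using infinite_arbitrarily_large[OF infinite_X] by blast
  obtain K L' where K: "F \<subseteq> K" "good K L'" "infinite (L \<inter> L')"
    using good_pair_over[OF F(1,2) assms] by blast
  have "infinite K \<or> size A \<le> card K" using card_mono[OF _ K(1)] F by auto
  then show ?thesis using K placed_exists[of K A] by (auto simp: good_def)
qed

lemma on_pairs_eqc:
  assumes h: "on_pairs h" and eq: "eqc A A'"
  shows "h A B = h A' B"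
proof -
  obtain K L \<alpha> where KL: "good K L" "infinite (X \<inter> L)" and \<alpha>: "placed \<alpha> K A"
    using placed_good_pair[OF infinite_X order_refl] by blast
  have L: "L \<subseteq> X" "infinite L" using KL by (auto simp: good_def)
  obtain \<beta> where \<beta>: "placed \<beta> L B" using placed_exists L by blast
  show ?thesis
    using on_pairsD[OF h KL(1) L(2) \<alpha> \<beta>] on_pairsD[OF h KL(1) L(2) placed_eqc[OF eq \<alpha>] \<beta>] by simp
qed

text \<open>
  Place three configurations further and further out. The last one must lie both in the infinite
  set \<open>L\<close> that contains the second and in an infinite connected set away from the first two.
\<close>

lemma on_pairs_cocycle:
  assumes h: "on_pairs h"
  shows "cocycle h"
  unfolding cocycle_def
proof (intro allI)
  fix p q r
  obtain K L \<alpha> where KL: "good K L" "infinite (X \<inter> L)" and \<alpha>: "placed \<alpha> K p"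
    using placed_good_pair[OF infinite_X order_refl] by blast
  have L: "L \<subseteq> X" "infinite L" using KL by (auto simp: good_def)
  obtain \<beta> where \<beta>: "placed \<beta> L q" using placed_exists L by blast
  have fin: "finite (supp \<alpha> \<union> supp \<beta>)" "supp \<alpha> \<union> supp \<beta> \<subseteq> X"
    using \<alpha> \<beta> finite_supp supp_sub by (auto simp: placed_def)
  obtain K' L' where KL': "supp \<alpha> \<union> supp \<beta> \<subseteq> K'" "good K' L'" "infinite (L \<inter> L')"
    using good_pair_over[OF fin L(2,1)] by blast
  obtain \<gamma> where \<gamma>: "placed \<gamma> (L \<inter> L') r" using placed_exists[of "L \<inter> L'"] KL'(3) L by blast
  have \<gamma>L: "placed \<gamma> L r" and \<gamma>L': "placed \<gamma> L' r" using placed_mono[OF \<gamma>] by auto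
  have \<alpha>': "placed \<alpha> K' p" and \<beta>': "placed \<beta> K' q" using \<alpha> \<beta> KL'(1) by (auto simp: placed_def)
  have inf: "infinite L'" using KL'(3) by auto
  have "placed (merge \<alpha> \<beta>) K' (p + q)"
    using placed_merge[OF \<alpha>' \<beta>' good_disjoint[OF KL(1) \<alpha> \<beta>]] by simp
  then have "H (merge \<alpha> \<beta>) \<gamma> = h (p + q) r" by (rule on_pairsD[OF h KL'(2) inf _ \<gamma>L'])
  moreover have "placed (merge \<beta> \<gamma>) L (q + r)"
    using placed_merge[OF \<beta> \<gamma>L good_disjoint[OF KL'(2) \<beta>' \<gamma>L']] by simp
  then have "H \<alpha> (merge \<beta> \<gamma>) = h p (q + r)" by (rule on_pairsD[OF h KL(1) L(2) \<alpha>])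
  moreover have "H \<alpha> \<beta> = h p q" by (rule on_pairsD[OF h KL(1) L(2) \<alpha> \<beta>])
  moreover have "H \<beta> \<gamma> = h q r" by (rule on_pairsD[OF h KL'(2) inf \<beta>' \<gamma>L'])
  ultimately show "h p q + h (p + q) r = h q r + h p (q + r)"
    using H_assoc[of \<alpha> \<beta> \<gamma>] by simp
qed

lemma on_pairs_empty:
  assumes h: "on_pairs h"
  shows "h {#} {#} = 0"
proof -
  obtain K L \<alpha> where KL: "good K L" "infinite (X \<inter> L)" and "placed \<alpha> K {#}"
    using placed_good_pair[OF infinite_X order_refl] by blast
  have "infinite L" using KL by auto
  then have "H base base = h {#} {#}" by (rule on_pairsD[OF h KL(1)]) (auto simp: placed_def)
  then show ?thesis by (simp add: H_def f_base)
qed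

end

locale additive_potential = potential X E \<phi> b f R
  for X :: "'a set" and E :: "('a \<times> 'a) set" and \<phi> :: "'s \<times> 's \<Rightarrow> 's \<times> 's" and b :: 's
    and f :: "('a \<Rightarrow> 's) \<Rightarrow> real" and R :: nat +
  assumes additive: "\<And>K L \<alpha> \<beta>. good K L \<Longrightarrow> infinite L \<Longrightarrow> \<alpha> \<in> FC \<Longrightarrow> \<beta> \<in> FC \<Longrightarrow>
    supp \<alpha> \<subseteq> K \<Longrightarrow> supp \<beta> \<subseteq> L \<Longrightarrow> f (merge \<alpha> \<beta>) = f \<alpha> + f \<beta>"

text \<open>
  A function of the charge is constant along transitions, so subtracting a primitive of the
  pairing leaves the differential unchanged.
\<close>

theorem (in potential) correction_exists:
  assumes "transferable X E \<or> simple_interaction \<phi> b"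
  shows "\<exists>u. (\<forall>e\<in>E. \<forall>\<eta>\<in>FC. u (content (exch \<phi> e \<eta>)) = u (content \<eta>)) \<and>
    additive_potential X E \<phi> b (\<lambda>\<eta>. f \<eta> - u (content \<eta>)) R"
proof -
  obtain h where h: "on_pairs h" and sym: "\<And>A B. h A B = h B A"
    using pairing_exists[OF assms] by blast
  obtain u where u: "\<And>A B. u (A + B) = u A + u B + h A B" and inv: "\<And>A B. eqc A B \<Longrightarrow> u A = u B"
    using charge_coboundary[OF on_pairs_cocycle[OF h] sym on_pairs_eqc[OF h]] by metis
  have exch: "u (content (exch \<phi> e \<eta>)) = u (content \<eta>)" if "e \<in> E" "\<eta> \<in> FC" for e \<eta>
    using inv exch_charge[of \<eta> "fst e" "snd e"] that by simp
  have "u {#} = 0" using u[of "{#}" "{#}"] on_pairs_empty[OF h] by simp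
  interpret f': potential X E \<phi> b "\<lambda>\<eta>. f \<eta> - u (content \<eta>)" R
  proof
    show "f base - u (content base) = 0" using f_base \<open>u {#} = 0\<close> by simp
    fix e \<eta> \<eta>'
    assume e: "e \<in> E" "\<eta> \<in> FC" "\<eta>' \<in> FC" "\<And>x. x \<in> edge_ball X E e (real R) \<Longrightarrow> \<eta> x = \<eta>' x"
    show "f (exch \<phi> e \<eta>) - u (content (exch \<phi> e \<eta>)) - (f \<eta> - u (content \<eta>)) =
        f (exch \<phi> e \<eta>') - u (content (exch \<phi> e \<eta>')) - (f \<eta>' - u (content \<eta>'))"
      using local[OF e] exch e by simp
  qed
  have "additive_potential X E \<phi> b (\<lambda>\<eta>. f \<eta> - u (content \<eta>)) R"
  proof
    fix K L \<alpha> \<beta>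
    assume KL: "f'.good K L" "infinite L" and \<alpha>: "\<alpha> \<in> FC" "supp \<alpha> \<subseteq> K" and \<beta>: "\<beta> \<in> FC" "supp \<beta> \<subseteq> L"
    have KL': "good K L" using KL(1) unfolding good_def f'.good_def .
    have pl: "placed \<alpha> K (content \<alpha>)" "placed \<beta> L (content \<beta>)" using \<alpha> \<beta> by (auto simp: placed_def)
    have "H \<alpha> \<beta> = h (content \<alpha>) (content \<beta>)" by (rule on_pairsD[OF h KL' KL(2) pl])
    moreover have "content (merge \<alpha> \<beta>) = content \<alpha> + content \<beta>"
      using content_merge[OF \<alpha>(1) \<beta>(1) good_disjoint[OF KL' pl]] .
    ultimately show "f (merge \<alpha> \<beta>) - u (content (merge \<alpha> \<beta>)) =
        f \<alpha> - u (content \<alpha>) + (f \<beta> - u (content \<beta>))"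
      by (simp add: H_def u)
  qed
  then show ?thesis using exch by blast
qed

section \<open>Uniformity\<close>

text \<open>
  Let \<open>C\<close> be the component of \<open>y\<close> outside the \<open>R\<close>-ball around \<open>x\<close>. Moving the particles in \<open>C\<close>
  deep into \<open>C\<close> changes \<open>f\<close> by an amount that does not depend on the state at \<open>x\<close>, and once they
  are there additivity removes them. So the effect of the state at \<open>x\<close> does not depend on the
  states in \<open>C\<close>, and in particular not on the state at \<open>y\<close>.
\<close>

lemma (in additive_potential) second_difference:
  assumes xy: "x \<in> X" "y \<in> X" "gdist E x y > R" and \<zeta>: "\<zeta> \<in> FC"
  shows "f \<zeta> - f (cut \<zeta> (X - {x})) - f (cut \<zeta> (X - {y})) + f (cut \<zeta> (X - {x, y})) = 0"
proof -
  obtain P where P: "pieces x R P" using pieces_exist[OF xy(1)] by blast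
  have "y \<in> X - gball X E x (real R)" using xy by (auto simp: gball_def)
  then obtain C where C: "C \<in> P" "y \<in> C" using piecesD(3)[OF P] by blast
  have C_far: "gdist E x z > R" "z \<in> X" if "z \<in> C" for z
  proof -
    have "z \<in> X - gball X E x (real R)" using piecesD(3)[OF P] C that by blast
    then show "gdist E x z > R" "z \<in> X" by (auto simp: gball_def)
  qed
  have xC: "x \<notin> C" using C_far(1)[of x] by auto
  have CX: "C \<subseteq> X" using C_far by blast
  obtain W where W: "W \<subseteq> C" "infinite W" "good (X - C) W"
    using deep_good[OF P xy(1) C(1)] by blast
  have claim: "f \<zeta> - f (cut \<zeta> (X - {x})) = f (cut \<zeta> (X - C)) - f (cut (cut \<zeta> (X - C)) (X - {x}))"
    if \<zeta>: "\<zeta> \<in> FC" for \<zeta>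
  proof -
    define \<zeta>1 \<zeta>0 \<zeta>0' where "\<zeta>1 = cut \<zeta> C" and "\<zeta>0 = cut \<zeta> (X - C)" and "\<zeta>0' = cut \<zeta>0 (X - {x})"
    have FC: "\<zeta>1 \<in> FC" "\<zeta>0 \<in> FC" "\<zeta>0' \<in> FC" using \<zeta> by (auto simp: \<zeta>1_def \<zeta>0_def \<zeta>0'_def)
    have split: "\<zeta> = merge \<zeta>1 \<zeta>0" using merge_cut[OF \<zeta>, of C] by (simp add: \<zeta>1_def \<zeta>0_def)
    have split': "cut \<zeta> (X - {x}) = merge \<zeta>1 \<zeta>0'"
    proof (rule FC_eqI)
      show "cut \<zeta> (X - {x}) \<in> FC" "merge \<zeta>1 \<zeta>0' \<in> FC" using \<zeta> FC by simp_all
    qed (use xC in \<open>auto simp: merge_def cut_def \<zeta>1_def \<zeta>0_def \<zeta>0'_def\<close>)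
    obtain \<zeta>1' where "placed \<zeta>1' W (content \<zeta>1)"
      using placed_exists[of W] W(1,2) CX by blast
    then have \<zeta>1': "\<zeta>1' \<in> FC" "supp \<zeta>1' \<subseteq> W" "eqc (content \<zeta>1) (content \<zeta>1')"
      using same_charge_sym by (auto simp: placed_def)
    have sup: "supp \<zeta>1 \<subseteq> C" "supp \<zeta>0 \<subseteq> X - C" "supp \<zeta>0' \<subseteq> X - C"
      by (auto simp: supp_cut \<zeta>1_def \<zeta>0_def \<zeta>0'_def)
    have "f (merge \<zeta>1 \<zeta>0) - f (merge \<zeta>1' \<zeta>0) = f (merge \<zeta>1 \<zeta>0') - f (merge \<zeta>1' \<zeta>0')"
    proof (rule move[OF CX piecesD(5)[OF P C(1)] FC(1) \<zeta>1'(1) sup(1) _ \<zeta>1'(3) FC(2,3)])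
      fix k z assume "k \<in> C" "z \<in> X" "gdist E k z \<le> R"
      moreover then have "z \<noteq> x" using C_far(1)[of k] gdist_commute[of k x] by auto
      ultimately show "\<zeta>0 z = \<zeta>0' z" by (simp add: \<zeta>0'_def cut_def)
    qed (use sup \<zeta>1' W in auto)
    moreover have "f (merge \<zeta>1' \<beta>) = f \<beta> + f \<zeta>1'" if \<beta>: "\<beta> \<in> FC" "supp \<beta> \<subseteq> X - C" for \<beta>
    proof -
      have "merge \<zeta>1' \<beta> = merge \<beta> \<zeta>1'" by (rule merge_commute) (use \<beta> \<zeta>1'(2) W(1) in blast)
      then show ?thesis using additive[OF W(3,2) \<beta>(1) \<zeta>1'(1) \<beta>(2) \<zeta>1'(2)] by simp
    qed
    ultimately have "f \<zeta> - f (cut \<zeta> (X - {x})) = f \<zeta>0 - f \<zeta>0'"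
      using FC sup unfolding split' by (subst split) simp
    then show ?thesis by (simp only: \<zeta>0_def \<zeta>0'_def)
  qed
  have cc: "cut (cut \<zeta> (X - {y})) (X - C) = cut \<zeta> (X - C)"
    using C by (auto simp: cut_def fun_eq_iff restrict_def)
  have xy': "cut (cut \<zeta> (X - {y})) (X - {x}) = cut \<zeta> (X - {x, y})"
    by (auto simp: cut_def fun_eq_iff restrict_def)
  show ?thesis
    using claim[OF \<zeta>] claim[OF cut_FC[OF \<zeta>], of "X - {y}"] unfolding cc xy' by simp
qed

text \<open>
  The coefficients of the expansion of \<open>f\<close> at a configuration \<open>\<eta>\<close> are obtained from
  \<open>F A = f (\<eta> restricted to A)\<close> in this way.
\<close>

definition moebius :: "('a set \<Rightarrow> real) \<Rightarrow> 'a set \<Rightarrow> real" where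
  "moebius F S = (\<Sum>A\<in>Pow S. (-1) ^ card (S - A) * F A)"

lemma moebius_insert:
  assumes "finite S" "x \<notin> S"
  shows "moebius F (insert x S) = moebius (\<lambda>A. F (insert x A)) S - moebius F S"
proof -
  have inj: "inj_on (insert x) (Pow S)" using assms(2) by (auto simp: inj_on_def)
  have "moebius F (insert x S) = (\<Sum>A\<in>Pow S. (-1) ^ card (insert x S - A) * F A) +
      (\<Sum>A\<in>insert x ` Pow S. (-1) ^ card (insert x S - A) * F A)"
    unfolding moebius_def Pow_insert using assms by (intro sum.union_disjoint) auto
  also have "(\<Sum>A\<in>Pow S. (-1) ^ card (insert x S - A) * F A) = - moebius F S"
    unfolding moebius_def sum_negf[symmetric]
  proof (rule sum.cong[OF refl])
    fix A assume "A \<in> Pow S"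
    then have "insert x S - A = insert x (S - A)" "x \<notin> S - A" using assms by auto
    then show "(-1) ^ card (insert x S - A) * F A = - ((-1) ^ card (S - A) * F A)"
      using assms(1) by simp
  qed
  also have "(\<Sum>A\<in>insert x ` Pow S. (-1) ^ card (insert x S - A) * F A) = moebius (\<lambda>A. F (insert x A)) S"
    unfolding moebius_def sum.reindex[OF inj] comp_def
  proof (rule sum.cong[OF refl])
    fix A assume "A \<in> Pow S"
    then have "insert x S - insert x A = S - A" using assms by auto
    then show "(-1) ^ card (insert x S - insert x A) * F (insert x A) = (-1) ^ card (S - A) * F (insert x A)"
      by simp
  qed
  finally show ?thesis by simp
qed

lemma moebius_sum: "finite S \<Longrightarrow> (\<Sum>T\<in>Pow S. moebius F T) = F S"
proof (induction S arbitrary: F rule: finite_induct)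
  case empty
  then show ?case by (simp add: moebius_def)
next
  case (insert x S)
  have inj: "inj_on (insert x) (Pow S)" using insert(2) by (auto simp: inj_on_def)
  have "(\<Sum>T\<in>Pow (insert x S). moebius F T) =
      (\<Sum>T\<in>Pow S. moebius F T) + (\<Sum>T\<in>insert x ` Pow S. moebius F T)"
    unfolding Pow_insert using insert by (intro sum.union_disjoint) auto
  also have "(\<Sum>T\<in>insert x ` Pow S. moebius F T) =
      (\<Sum>T\<in>Pow S. moebius (\<lambda>A. F (insert x A)) T - moebius F T)"
    unfolding sum.reindex[OF inj] comp_def
  proof (rule sum.cong[OF refl])
    fix T assume "T \<in> Pow S"
    then have "finite T" "x \<notin> T" using insert(1,2) by (auto intro: finite_subset)
    then show "moebius F (insert x T) = moebius (\<lambda>A. F (insert x A)) T - moebius F T"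
      by (rule moebius_insert)
  qed
  also have "\<dots> = F (insert x S) - F S"
    using insert.IH by (simp add: sum_subtractf)
  finally show ?case using insert.IH by simp
qed

text \<open>
  If \<open>F\<close> ignores the point \<open>x\<close>, the terms for \<open>A\<close> and \<open>insert x A\<close> cancel. Applied to the state at
  \<open>x\<close> being the base state, this is the vanishing condition on the components of the expansion.
\<close>

lemma moebius_eq_0:
  assumes "finite S" "x \<in> S" "\<And>A. A \<subseteq> S - {x} \<Longrightarrow> F (insert x A) = F A"
  shows "moebius F S = 0"
proof -
  have "moebius (\<lambda>A. F (insert x A)) (S - {x}) = moebius F (S - {x})"
    unfolding moebius_def by (intro sum.cong) (use assms(3) in auto)
  then show ?thesis using moebius_insert[of "S - {x}" x F] assms(1,2) by (simp add: insert_absorb)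
qed

lemma moebius_diff: "moebius (\<lambda>A. F A - G A) S = moebius F S - moebius G S"
  by (simp add: moebius_def right_diff_distrib sum_subtractf)

lemma moebius_eq_0_second_difference:
  assumes "finite S" "x \<in> S" "y \<in> S" "x \<noteq> y"
    and "\<And>A. A \<subseteq> S - {x, y} \<Longrightarrow> F (insert y (insert x A)) - F (insert y A) = F (insert x A) - F A"
  shows "moebius F S = 0"
proof -
  have "moebius F S = moebius (\<lambda>A. F (insert x A) - F A) (S - {x})"
    using moebius_insert[of "S - {x}" x F] assms(1,2) by (simp add: insert_absorb moebius_diff)
  also have "\<dots> = 0"
  proof (rule moebius_eq_0[of _ y])
    fix A assume "A \<subseteq> S - {x} - {y}"
    then have "A \<subseteq> S - {x, y}" by blast
    then show "F (insert x (insert y A)) - F (insert y A) = F (insert x A) - F A"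
      using assms(5) by (simp only: insert_commute[of x y])
  qed (use assms(1,3,4) in simp_all)
  finally show ?thesis .
qed

context particle_locale
begin

lemma cut_cong: "(\<And>z. z \<in> A \<Longrightarrow> z \<in> X \<Longrightarrow> \<eta> z = \<eta>' z) \<Longrightarrow> cut \<eta> A = cut \<eta>' A"
  by (auto simp: cut_def fun_eq_iff restrict_def)

lemma gdiam_witness:
  assumes "gdiam E \<Lambda> > r"
  shows "\<exists>x\<in>\<Lambda>. \<exists>y\<in>\<Lambda>. gdist E x y > r"
proof (rule ccontr)
  assume none: "\<not> ?thesis"
  let ?D = "{gdist E x y | x y. x \<in> \<Lambda> \<and> y \<in> \<Lambda>}"
  have "?D \<noteq> {}"
  proof
    assume "?D = {}"
    then have "gdiam E \<Lambda> = Sup {}" by (simp only: gdiam_def)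
    then show False using assms by (simp add: Sup_nat_def)
  qed
  moreover have "\<forall>n\<in>?D. n \<le> r" using none by (auto simp: not_less)
  ultimately have "Sup ?D \<le> r" by (intro cSup_least) auto
  then show False using assms by (simp add: gdiam_def)
qed

text \<open>
  A set of diameter more than \<open>r\<close> contains two vertices at distance more than \<open>r\<close>, and the
  corresponding component of the expansion is an alternating sum of second differences at these
  two vertices.
\<close>

lemma uniform_fun_if_second_difference:
  assumes sd: "\<And>x y \<zeta>. x \<in> X \<Longrightarrow> y \<in> X \<Longrightarrow> gdist E x y > r \<Longrightarrow> \<zeta> \<in> FC \<Longrightarrow>
      f \<zeta> - f (cut \<zeta> (X - {x})) - f (cut \<zeta> (X - {y})) + f (cut \<zeta> (X - {x, y})) = 0"
  shows "uniform_fun X E b f"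
proof -
  define g where "g \<Lambda> \<eta> = (if \<eta> \<in> FC then moebius (\<lambda>A. f (cut \<eta> A)) \<Lambda> else 0)" for \<Lambda> \<eta>
  have "g \<Lambda> \<in> exact_funs X b \<Lambda>" if \<Lambda>: "finite \<Lambda>" "\<Lambda> \<subseteq> X" for \<Lambda>
    unfolding exact_funs_def local_funs_def funs_on_def mem_Collect_eq
  proof (intro conjI allI ballI impI)
    fix \<eta> \<eta>' assume \<eta>: "\<eta> \<in> FC" "\<eta>' \<in> FC" "\<forall>x\<in>\<Lambda>. \<eta> x = \<eta>' x"
    have "cut \<eta> A = cut \<eta>' A" if "A \<in> Pow \<Lambda>" for A using that \<eta>(3) by (intro cut_cong) auto
    then show "g \<Lambda> \<eta> = g \<Lambda> \<eta>'" using \<eta> by (auto simp: g_def moebius_def intro!: sum.cong)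
  next
    fix \<eta> assume \<eta>: "\<eta> \<in> FC" "\<exists>x\<in>\<Lambda>. \<eta> x = b"
    then obtain x where x: "x \<in> \<Lambda>" "\<eta> x = b" by blast
    have "cut \<eta> (insert x A) = cut \<eta> A" for A using x by (auto simp: cut_def fun_eq_iff restrict_def)
    then show "g \<Lambda> \<eta> = 0" using \<eta> moebius_eq_0[OF \<Lambda>(1) x(1)] by (simp add: g_def)
  qed (simp add: g_def)
  moreover have "f \<eta> = (\<Sum>\<Lambda>\<in>Pow {x \<in> X. \<eta> x \<noteq> b}. g \<Lambda> \<eta>)" if \<eta>: "\<eta> \<in> FC" for \<eta>
  proof -
    have "cut \<eta> (supp \<eta>) = \<eta>"
      by (intro FC_eqI cut_FC) (use \<eta> in \<open>auto simp: cut_def supp_def\<close>)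
    then show ?thesis
      using moebius_sum[OF finite_supp[OF \<eta>], of "\<lambda>A. f (cut \<eta> A)"] \<eta> by (simp add: g_def supp_def)
  qed
  ultimately have "expansion X b f g" by (auto simp: expansion_def)
  moreover have "g \<Lambda> = 0" if \<Lambda>: "finite \<Lambda>" "\<Lambda> \<subseteq> X" "real (gdiam E \<Lambda>) > real r + 1" for \<Lambda>
  proof
    fix \<eta>
    have "gdiam E \<Lambda> > r" using \<Lambda>(3) by linarith
    then obtain x y where xy: "x \<in> \<Lambda>" "y \<in> \<Lambda>" "gdist E x y > r" using gdiam_witness by blast
    then have "x \<noteq> y" by auto
    have "moebius (\<lambda>A. f (cut \<eta> A)) \<Lambda> = 0" if \<eta>: "\<eta> \<in> FC"
    proof (rule moebius_eq_0_second_difference[OF \<Lambda>(1) xy(1,2) \<open>x \<noteq> y\<close>])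
      fix A assume A: "A \<subseteq> \<Lambda> - {x, y}"
      let ?\<zeta> = "cut \<eta> (insert y (insert x A))"
      have *: "cut ?\<zeta> B = cut \<eta> (insert y (insert x A) \<inter> B)" for B
        by (auto simp: cut_def fun_eq_iff restrict_def)
      have int: "insert y (insert x A) \<inter> (X - {x}) = insert y A" "insert y (insert x A) \<inter> (X - {y}) = insert x A"
        "insert y (insert x A) \<inter> (X - {x, y}) = A"
        using A xy \<Lambda>(2) \<open>x \<noteq> y\<close> by auto
      have "x \<in> X" "y \<in> X" using xy \<Lambda>(2) by auto
      from sd[OF this xy(3) cut_FC[OF \<eta>], of "insert y (insert x A)"]
      show "f ?\<zeta> - f (cut \<eta> (insert y A)) = f (cut \<eta> (insert x A)) - f (cut \<eta> A)"
        unfolding * int by linarith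
    qed
    then show "g \<Lambda> \<eta> = 0 \<eta>" by (simp add: g_def zero_fun_def)
  qed
  \<comment> \<open>one more than \<open>r\<close>, since a positive bound is required and \<open>r\<close> may be \<open>0\<close>\<close>
  moreover have "real r + 1 > 0" by linarith
  ultimately show ?thesis unfolding uniform_fun_def by blast
qed

end

section \<open>Closed forms are exact\<close>

lemma walk_append: "walk G u p v \<Longrightarrow> walk G v q w \<Longrightarrow> walk G u (p @ q) w"
  by (induction G u p v rule: walk.induct) auto

lemma rtrancl_walk:
  assumes "(u, v) \<in> G\<^sup>*"
  shows "\<exists>p. walk G u p v"
  using assms
proof (induction rule: rtrancl_induct)
  case base
  show ?case by (intro exI[of _ "[]"]) simp
next
  case (step v w)
  then obtain p where "walk G u p v" by blast
  moreover have "walk G v [(v, w)] w" using step by simp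
  ultimately have "walk G u (p @ [(v, w)]) w" by (rule walk_append)
  then show ?case by blast
qed

lemma walk_reverse:
  assumes "walk G u p v" and "\<And>t. t \<in> G \<Longrightarrow> prod.swap t \<in> G \<and> \<omega> (prod.swap t) = - \<omega> t"
  shows "\<exists>q. walk G v q u \<and> (\<Sum>t\<leftarrow>q. \<omega> t) = - (\<Sum>t\<leftarrow>p. \<omega> t :: real)"
  using assms(1)
proof (induction p arbitrary: u)
  case Nil
  then show ?case by (intro exI[of _ "[]"]) auto
next
  case (Cons a p)
  then obtain q where q: "walk G v q (snd a)" "(\<Sum>t\<leftarrow>q. \<omega> t) = - (\<Sum>t\<leftarrow>p. \<omega> t)" by auto
  have "walk G (snd a) [prod.swap a] u" using Cons.prems assms(2)[of a] by auto
  with q(1) have "walk G v (q @ [prod.swap a]) u" by (rule walk_append)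
  then show ?case using q(2) assms(2)[of a] Cons.prems by (intro exI[of _ "q @ [prod.swap a]"]) auto
qed

context particle_locale
begin

abbreviation T :: "(('a \<Rightarrow> 's) \<times> ('a \<Rightarrow> 's)) set" where "T \<equiv> fin_transitions X E \<phi> b"

lemma T_exch: "\<eta> \<in> FC \<Longrightarrow> e \<in> E \<Longrightarrow> (\<eta>, exch \<phi> e \<eta>) \<in> T"
  by (auto simp: fin_transitions_iff)

lemma T_FC: "(\<eta>, \<eta>') \<in> T \<Longrightarrow> \<eta> \<in> FC \<and> \<eta>' \<in> FC"
  by (auto simp: fin_transitions_def)

text \<open>
  If the transition moves anything, the defining identity of an interaction says that the
  transition along the reversed edge undoes it; otherwise the transition is a loop.
\<close>

lemma T_swap:
  assumes "t \<in> T"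
  shows "prod.swap t \<in> T"
proof -
  obtain \<eta> x y where t: "t = (\<eta>, exch \<phi> (x, y) \<eta>)" "\<eta> \<in> FC" "(x, y) \<in> E"
    using assms by (cases t) (auto simp: fin_transitions_iff)
  have yx: "(y, x) \<in> E" using t(3) sym_E by (auto dest: symD)
  show ?thesis
  proof (cases "\<phi> (\<eta> x, \<eta> y) = (\<eta> x, \<eta> y)")
    case True
    then have "exch \<phi> (x, y) \<eta> = \<eta>" by (auto simp: exch_def)
    then show ?thesis using assms t by simp
  next
    case False
    have xy: "x \<noteq> y" using t irrefl_E by (auto simp: irrefl_def)
    obtain u v where uv: "\<phi> (\<eta> x, \<eta> y) = (u, v)" by fastforce
    have "prod.swap (\<phi> (prod.swap (\<phi> (\<eta> x, \<eta> y)))) = (\<eta> x, \<eta> y)"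
      using interaction False unfolding interaction_def by blast
    then have "prod.swap (\<phi> (v, u)) = (\<eta> x, \<eta> y)" by (simp add: uv)
    then have "\<phi> (v, u) = (\<eta> y, \<eta> x)" by (metis swap_simp swap_swap)
    then have "\<eta> = exch \<phi> (y, x) (exch \<phi> (x, y) \<eta>)"
      using xy by (auto simp: exch_def uv fun_eq_iff)
    then have "(exch \<phi> (x, y) \<eta>, \<eta>) \<in> T"
      using T_exch[OF exch_FC(1)[OF t(2,3)] yx] by simp
    then show ?thesis by (simp add: t)
  qed
qed

text \<open>
  Integrate the form along walks from one chosen root in every component of the transition
  graph; closedness makes the result independent of the walk.
\<close>

lemma closed_form_exact:
  assumes \<omega>: "\<omega> \<in> forms X E \<phi> b" and closed: "closed_form X E \<phi> b \<omega>"
  shows "\<exists>f. f base = 0 \<and> (\<forall>(\<eta>, \<eta>')\<in>T. \<omega> (\<eta>, \<eta>') = f \<eta>' - f \<eta>)"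
proof -
  have rev: "prod.swap t \<in> T \<and> \<omega> (prod.swap t) = - \<omega> t" if "t \<in> T" for t
    using \<omega> T_swap[OF that] that by (auto simp: forms_def)
  have symT: "sym T" using rev by (force simp: sym_def)
  define root where "root \<zeta> = (SOME \<rho>. (\<rho>, \<zeta>) \<in> T\<^sup>*)" for \<zeta>
  have root: "(root \<zeta>, \<zeta>) \<in> T\<^sup>*" for \<zeta> unfolding root_def by (rule someI[of _ \<zeta>]) simp
  have root_FC: "root \<zeta> \<in> FC" if "\<zeta> \<in> FC" for \<zeta>
    using root[of \<zeta>] that by (cases rule: converse_rtranclE) (auto dest: T_FC)
  have root_eq: "root \<zeta> = root \<zeta>'" if "(\<zeta>, \<zeta>') \<in> T" for \<zeta> \<zeta>'
  proof -
    have "(\<zeta>', \<zeta>) \<in> T" using that symT by (auto dest: symD)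
    then have "(\<lambda>\<rho>. (\<rho>, \<zeta>) \<in> T\<^sup>*) = (\<lambda>\<rho>. (\<rho>, \<zeta>') \<in> T\<^sup>*)"
      using that by (intro ext) (meson rtrancl.rtrancl_into_rtrancl)
    then show ?thesis by (simp add: root_def)
  qed
  define path where "path \<zeta> = (SOME p. walk T (root \<zeta>) p \<zeta>)" for \<zeta>
  have path: "walk T (root \<zeta>) (path \<zeta>) \<zeta>" for \<zeta>
    unfolding path_def by (rule someI_ex) (rule rtrancl_walk[OF root])
  define f where "f \<zeta> = (\<Sum>t\<leftarrow>path \<zeta>. \<omega> t)" for \<zeta>
  have "\<omega> (\<zeta>, \<zeta>') = f \<zeta>' - f \<zeta>" if t: "(\<zeta>, \<zeta>') \<in> T" for \<zeta> \<zeta>'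
  proof -
    obtain q where q: "walk T \<zeta>' q (root \<zeta>')" "(\<Sum>t\<leftarrow>q. \<omega> t) = - f \<zeta>'"
      using walk_reverse[OF path[of \<zeta>'] rev] by (auto simp: f_def)
    have "walk T (root \<zeta>) (path \<zeta> @ [(\<zeta>, \<zeta>')]) \<zeta>'" by (rule walk_append[OF path]) (use t in simp)
    then have "walk T (root \<zeta>) ((path \<zeta> @ [(\<zeta>, \<zeta>')]) @ q) (root \<zeta>)"
      using q(1) unfolding root_eq[OF t, symmetric] by (rule walk_append)
    moreover have "root \<zeta> \<in> FC" using root_FC T_FC[OF t] by blast
    ultimately have "(\<Sum>t\<leftarrow>(path \<zeta> @ [(\<zeta>, \<zeta>')]) @ q. \<omega> t) = 0"
      using closed unfolding closed_form_def by blast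
    then show ?thesis using q(2) by (simp add: f_def)
  qed
  then show ?thesis by (intro exI[of _ "\<lambda>\<zeta>. f \<zeta> - f base"]) auto
qed

section \<open>The kernel of the differential\<close>

text \<open>
  A component of the expansion over a set that meets both supports vanishes, because such a set has
  large diameter. The empty set is counted on both sides, which is harmless as \<open>f\<close> vanishes at the
  base configuration.
\<close>

lemma uniform_additive:
  assumes "uniform_fun X E b f" and f0: "f base = 0"
  shows "\<exists>r. \<forall>\<alpha>\<in>FC. \<forall>\<beta>\<in>FC. separated r (supp \<alpha>) (supp \<beta>) \<longrightarrow> f (merge \<alpha> \<beta>) = f \<alpha> + f \<beta>"
proof -
  obtain g \<rho> where g: "expansion X b f g"
    and \<rho>: "\<And>\<Lambda>. finite \<Lambda> \<Longrightarrow> \<Lambda> \<subseteq> X \<Longrightarrow> real (gdiam E \<Lambda>) > \<rho> \<Longrightarrow> g \<Lambda> = 0"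
    using assms(1) unfolding uniform_fun_def by blast
  have exp: "f \<eta> = (\<Sum>\<Lambda>\<in>Pow (supp \<eta>). g \<Lambda> \<eta>)" if "\<eta> \<in> FC" for \<eta>
    using g that by (simp add: expansion_def supp_def)
  have loc: "g \<Lambda> \<eta> = g \<Lambda> \<eta>'"
    if "finite \<Lambda>" "\<Lambda> \<subseteq> X" "\<eta> \<in> FC" "\<eta>' \<in> FC" "\<And>x. x \<in> \<Lambda> \<Longrightarrow> \<eta> x = \<eta>' x" for \<Lambda> \<eta> \<eta>'
  proof -
    have "g \<Lambda> \<in> local_funs X b \<Lambda>" using g that(1,2) by (auto simp: expansion_def exact_funs_def)
    then show ?thesis using that(3-5) unfolding local_funs_def by blast
  qed
  have "g {} base = 0" using exp[of base] f0 by simp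
  then have g0: "g {} \<eta> = 0" if "\<eta> \<in> FC" for \<eta> using loc[of "{}" \<eta> base] that by simp
  have "f (merge \<alpha> \<beta>) = f \<alpha> + f \<beta>"
    if \<alpha>: "\<alpha> \<in> FC" and \<beta>: "\<beta> \<in> FC" and sep: "separated (nat \<lceil>\<rho>\<rceil>) (supp \<alpha>) (supp \<beta>)" for \<alpha> \<beta>
  proof -
    let ?m = "merge \<alpha> \<beta>" and ?A = "Pow (supp \<alpha>)" and ?B = "Pow (supp \<beta>)"
    have fin: "finite (supp \<alpha>)" "finite (supp \<beta>)" using \<alpha> \<beta> finite_supp by auto
    have disj: "supp \<alpha> \<inter> supp \<beta> = {}" using separated_disjoint[OF sep] .
    have zero: "g \<Lambda> ?m = 0" if \<Lambda>: "\<Lambda> \<in> Pow (supp ?m) - (?A \<union> ?B)" for \<Lambda>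
    proof -
      obtain x y where xy: "x \<in> \<Lambda>" "x \<in> supp \<alpha>" "y \<in> \<Lambda>" "y \<in> supp \<beta>"
        using \<Lambda> unfolding supp_merge by blast
      have \<Lambda>': "finite \<Lambda>" "\<Lambda> \<subseteq> X"
        using \<Lambda> fin supp_sub[of ?m] finite_subset[of \<Lambda> "supp \<alpha> \<union> supp \<beta>"] by (auto simp: supp_merge)
      have "finite ((\<lambda>(x, y). gdist E x y) ` (\<Lambda> \<times> \<Lambda>))" using \<Lambda>'(1) by simp
      moreover have "{gdist E x y | x y. x \<in> \<Lambda> \<and> y \<in> \<Lambda>} = (\<lambda>(x, y). gdist E x y) ` (\<Lambda> \<times> \<Lambda>)" by auto
      ultimately have "gdist E x y \<le> gdiam E \<Lambda>" unfolding gdiam_def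
        using xy by (intro le_cSup_finite) auto
      moreover have "gdist E x y > nat \<lceil>\<rho>\<rceil>" using sep xy by (auto simp: separated_def)
      ultimately have "real (gdiam E \<Lambda>) > \<rho>" by linarith
      then show ?thesis using \<rho>[OF \<Lambda>'] by simp
    qed
    have "f ?m = (\<Sum>\<Lambda>\<in>?A \<union> ?B. g \<Lambda> ?m)"
      unfolding exp[OF merge_FC[OF \<alpha> \<beta>]]
      by (rule sum.mono_neutral_right) (use fin zero in \<open>auto simp: supp_merge\<close>)
    also have "\<dots> = (\<Sum>\<Lambda>\<in>?A. g \<Lambda> ?m) + (\<Sum>\<Lambda>\<in>?B. g \<Lambda> ?m) - (\<Sum>\<Lambda>\<in>?A \<inter> ?B. g \<Lambda> ?m)"
      using sum.union_inter[of ?A ?B "\<lambda>\<Lambda>. g \<Lambda> ?m"] fin by simp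
    also have "?A \<inter> ?B = {{}}" using disj by auto
    also have "(\<Sum>\<Lambda>\<in>?A. g \<Lambda> ?m) = f \<alpha>" unfolding exp[OF \<alpha>]
    proof (rule sum.cong[OF refl])
      fix \<Lambda> assume "\<Lambda> \<in> ?A"
      then show "g \<Lambda> ?m = g \<Lambda> \<alpha>"
        using fin supp_sub[of \<alpha>] \<alpha> \<beta> disj
        by (intro loc merge_FC) (auto simp: merge_def supp_def intro: finite_subset)
    qed
    also have "(\<Sum>\<Lambda>\<in>?B. g \<Lambda> ?m) = f \<beta>" unfolding exp[OF \<beta>]
    proof (rule sum.cong[OF refl])
      fix \<Lambda> assume "\<Lambda> \<in> ?B"
      then show "g \<Lambda> ?m = g \<Lambda> \<beta>"
        using fin supp_sub[of \<beta>] \<alpha> \<beta> disj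
        by (intro loc merge_FC) (auto simp: merge_def supp_def intro: finite_subset)
    qed
    finally show ?thesis using g0 \<alpha> \<beta> by simp
  qed
  then show ?thesis by blast
qed

text \<open>
  By irreducibility an invariant function depends on the charge only. Charges can be realized
  far apart, where a uniform function is additive; hence it is an additive function of the
  charge, determined by the charges of single states.
\<close>

lemma kernel_charge:
  assumes unif: "uniform_fun X E b f" and f0: "f base = 0"
    and inv: "\<And>e \<eta>. e \<in> E \<Longrightarrow> \<eta> \<in> FC \<Longrightarrow> f (exch \<phi> e \<eta>) = f \<eta>"
  shows "\<exists>\<xi>\<in>Consv \<phi> b. \<forall>\<eta>\<in>FC. f \<eta> = (\<Sum>s\<in>#content \<eta>. \<xi> s)"
proof -
  have step: "f \<eta> = f \<eta>'" if "(\<eta>, \<eta>') \<in> steps X" for \<eta> \<eta>'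
    using that inv by (auto simp: steps_def)
  have eqc: "f \<eta> = f \<eta>'" if \<eta>: "\<eta> \<in> FC" "\<eta>' \<in> FC" "eqc (content \<eta>) (content \<eta>')" for \<eta> \<eta>'
    using connected_steps[OF order_refl connected_X \<eta>(1,2) supp_sub supp_sub \<eta>(3)]
    by (induction rule: rtrancl_induct) (use step in auto)
  define F where "F A = f (SOME \<alpha>. \<alpha> \<in> FC \<and> eqc (content \<alpha>) A)" for A
  have ex: "\<exists>\<alpha>. \<alpha> \<in> FC \<and> eqc (content \<alpha>) A" for A
    using placement_exists[OF order_refl, of A] infinite_X by blast
  have F: "F A = f \<alpha>" if \<alpha>: "\<alpha> \<in> FC" "eqc (content \<alpha>) A" for A \<alpha>
  proof -
    have "(SOME \<alpha>. \<alpha> \<in> FC \<and> eqc (content \<alpha>) A) \<in> FC \<and>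
        eqc (content (SOME \<alpha>. \<alpha> \<in> FC \<and> eqc (content \<alpha>) A)) A"
      by (rule someI_ex[OF ex])
    then show ?thesis unfolding F_def using eqc \<alpha> same_charge_trans same_charge_sym by metis
  qed
  have F_eqc: "F A = F B" if "eqc A B" for A B
    using ex[of A] F same_charge_trans[OF _ that] by metis
  obtain r where r: "\<And>\<alpha> \<beta>. \<alpha> \<in> FC \<Longrightarrow> \<beta> \<in> FC \<Longrightarrow> separated r (supp \<alpha>) (supp \<beta>) \<Longrightarrow>
      f (merge \<alpha> \<beta>) = f \<alpha> + f \<beta>"
    using uniform_additive[OF unif f0] by blast
  have F_add: "F (A + B) = F A + F B" for A B
  proof -
    obtain \<alpha> where \<alpha>: "\<alpha> \<in> FC" "eqc (content \<alpha>) A" using ex by blast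
    obtain L where L: "L \<subseteq> X" "separated r (supp \<alpha>) L" "infinite (X \<inter> L)"
      using far_connected_piece[OF finite_supp[OF \<alpha>(1)] supp_sub infinite_X order_refl] by blast
    then have "infinite L" by auto
    then obtain \<beta> where \<beta>: "\<beta> \<in> FC" "supp \<beta> \<subseteq> L" "eqc (content \<beta>) B"
      using placement_exists[OF L(1), of B] by blast
    have sep: "separated r (supp \<alpha>) (supp \<beta>)" using separated_mono[OF L(2) order_refl \<beta>(2)] .
    have "eqc (content (merge \<alpha> \<beta>)) (A + B)"
      unfolding content_merge[OF \<alpha>(1) \<beta>(1) separated_disjoint[OF sep]]
      using same_charge_add[OF \<alpha>(2) \<beta>(3)] .
    then have "F (A + B) = f (merge \<alpha> \<beta>)" using \<alpha> \<beta> by (intro F) auto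
    also have "\<dots> = F A + F B" using r[OF \<alpha>(1) \<beta>(1) sep] F \<alpha> \<beta> by simp
    finally show ?thesis .
  qed
  have F_empty: "F {#} = 0" using F[of base "{#}"] f0 by simp
  define \<xi> where "\<xi> s = F {#s#}" for s
  have F_sum: "F A = (\<Sum>s\<in>#A. \<xi> s)" for A
  proof (induction A)
    case (add s A)
    then show ?case using F_add[of "{#s#}" A] by (simp add: \<xi>_def)
  qed (simp add: F_empty)
  have "\<xi> b = F {#}" unfolding \<xi>_def by (rule F_eqc) (auto simp: same_charge_def Consv_def)
  moreover have "\<xi> s1 + \<xi> s2 = \<xi> (fst (\<phi> (s1, s2))) + \<xi> (snd (\<phi> (s1, s2)))" for s1 s2
  proof -
    have "F {#s1, s2#} = F {#fst (\<phi> (s1, s2)), snd (\<phi> (s1, s2))#}"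
      by (rule F_eqc) (auto simp: same_charge_def Consv_def)
    then show ?thesis by (simp add: F_sum)
  qed
  ultimately have "\<xi> \<in> Consv \<phi> b" by (simp add: Consv_def F_empty)
  moreover have "f \<eta> = (\<Sum>s\<in>#content \<eta>. \<xi> s)" if "\<eta> \<in> FC" for \<eta>
    using F[OF that same_charge_refl] F_sum by simp
  ultimately show ?thesis by blast
qed

definition total :: "('s \<Rightarrow> real) \<Rightarrow> ('a \<Rightarrow> 's) \<Rightarrow> real" where
  "total \<xi> \<eta> = (if \<eta> \<in> FC then \<Sum>s\<in>#content \<eta>. \<xi> s else 0)"

lemma total_kernel:
  assumes \<xi>: "\<xi> \<in> Consv \<phi> b"
  shows "total \<xi> \<in> C0_unif X E b" "differential X E \<phi> b (total \<xi>) = 0"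
proof -
  have "uniform_fun X E b (total \<xi>)"
  proof (rule uniform_fun_if_second_difference[of 0])
    fix x y \<zeta> assume xy: "x \<in> X" "y \<in> X" "gdist E x y > 0" and \<zeta>: "\<zeta> \<in> FC"
    have "x \<noteq> y" using xy(3) by auto
    have tot: "total \<xi> \<eta> = (\<Sum>z\<in>supp \<zeta>. \<xi> (\<eta> z))" if "\<eta> \<in> FC" "supp \<eta> \<subseteq> supp \<zeta>" for \<eta>
      using charge_sum[OF \<xi> finite_supp[OF \<zeta>] supp_sub that(2)] that(1) by (simp add: total_def)
    have "\<xi> b = 0" using \<xi> by (simp add: Consv_def)
    then have "\<xi> (\<zeta> z) - \<xi> (cut \<zeta> (X - {x}) z) - \<xi> (cut \<zeta> (X - {y}) z) + \<xi> (cut \<zeta> (X - {x, y}) z) = 0"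
      if "z \<in> supp \<zeta>" for z
      using that \<open>x \<noteq> y\<close> by (auto simp: cut_def supp_def)
    then have "(\<Sum>z\<in>supp \<zeta>. \<xi> (\<zeta> z) - \<xi> (cut \<zeta> (X - {x}) z) - \<xi> (cut \<zeta> (X - {y}) z) +
        \<xi> (cut \<zeta> (X - {x, y}) z)) = 0"
      by (intro sum.neutral) blast
    then show "total \<xi> \<zeta> - total \<xi> (cut \<zeta> (X - {x})) - total \<xi> (cut \<zeta> (X - {y})) +
        total \<xi> (cut \<zeta> (X - {x, y})) = 0"
      using \<zeta> by (simp add: tot supp_cut sum_subtractf sum.distrib)
  qed
  then show "total \<xi> \<in> C0_unif X E b"
    by (auto simp: C0_unif_def funs_on_def total_def)
  have "total \<xi> (exch \<phi> e \<eta>) = total \<xi> \<eta>" if "e \<in> E" "\<eta> \<in> FC" for e \<eta>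
    using exch_charge[of \<eta> "fst e" "snd e"] exch_FC(1)[of \<eta> "fst e" "snd e"] that \<xi>
    by (simp add: total_def same_charge_def)
  then have "total \<xi> (snd t) = total \<xi> (fst t)" if "t \<in> T" for t
    using that by (cases t) (auto simp: fin_transitions_iff)
  then show "differential X E \<phi> b (total \<xi>) = 0"
    by (intro ext) (simp add: differential_def)
qed

lemma H0_iso: "lin_iso (H0_unif X E \<phi> b) (fun_space (Consv \<phi> b))"
proof -
  obtain x where x: "x \<in> X" using connected_X by (auto simp: connected_graph_def)
  define ev where "ev f = (\<lambda>s. f (base(x := s)))" for f :: "('a \<Rightarrow> 's) \<Rightarrow> real"
  let ?K = "{f \<in> C0_unif X E b. differential X E \<phi> b f = 0}"
  have ev_total: "ev (total \<xi>) = \<xi>" if "\<xi> \<in> Consv \<phi> b" for \<xi>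
  proof
    fix s
    have "base x = b" using x by (simp add: base_config_def)
    note ins = content_insert[OF base_FC x this, of s]
    then show "ev (total \<xi>) s = \<xi> s" using that by (simp add: ev_def total_def same_charge_def)
  qed
  have total_ev: "\<exists>\<xi>\<in>Consv \<phi> b. f = total \<xi>" if f: "f \<in> ?K" for f
  proof -
    have "f (exch \<phi> e \<eta>) = f \<eta>" if "e \<in> E" "\<eta> \<in> FC" for e \<eta>
    proof -
      have "differential X E \<phi> b f (\<eta>, exch \<phi> e \<eta>) = 0" using f by simp
      then show ?thesis using T_exch[OF that(2,1)] by (simp add: differential_def)
    qed
    then obtain \<xi> where \<xi>: "\<xi> \<in> Consv \<phi> b" "\<forall>\<eta>\<in>FC. f \<eta> = (\<Sum>s\<in>#content \<eta>. \<xi> s)"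
      using kernel_charge[of f] f by (auto simp: C0_unif_def)
    moreover have "f \<eta> = 0" if "\<eta> \<notin> FC" for \<eta> using f that by (auto simp: C0_unif_def funs_on_def)
    ultimately have "f = total \<xi>" by (auto simp: total_def fun_eq_iff)
    then show ?thesis using \<xi> by blast
  qed
  have "bij_betw ev ?K (Consv \<phi> b)"
  proof (rule bij_betw_byWitness[of _ total])
    show "\<forall>f\<in>?K. total (ev f) = f"
    proof
      fix f assume "f \<in> ?K"
      then obtain \<xi> where "\<xi> \<in> Consv \<phi> b" "f = total \<xi>" using total_ev by blast
      then show "total (ev f) = f" using ev_total by simp
    qed
    show "\<forall>\<xi>\<in>Consv \<phi> b. ev (total \<xi>) = \<xi>" using ev_total by blast
    show "ev ` ?K \<subseteq> Consv \<phi> b"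
    proof
      fix \<zeta> assume "\<zeta> \<in> ev ` ?K"
      then obtain f where "f \<in> ?K" "\<zeta> = ev f" by blast
      moreover then obtain \<xi> where "\<xi> \<in> Consv \<phi> b" "f = total \<xi>" using total_ev by blast
      ultimately show "\<zeta> \<in> Consv \<phi> b" using ev_total by simp
    qed
    show "total ` Consv \<phi> b \<subseteq> ?K" using total_kernel by auto
  qed
  then show ?thesis unfolding lin_iso_def H0_unif_def fun_space_def
    by (intro exI[of _ ev]) (auto simp: ev_def fun_scale_def fun_eq_iff)
qed

section \<open>The first cohomology vanishes\<close>

lemma closed_uniform_exact:
  assumes tr: "transferable X E \<or> simple_interaction \<phi> b" and \<omega>: "\<omega> \<in> Z1_unif X E \<phi> b"
  shows "\<omega> \<in> differential X E \<phi> b ` C0_unif X E b"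
proof -
  obtain f where f: "f base = 0" "\<And>\<eta> \<eta>'. (\<eta>, \<eta>') \<in> T \<Longrightarrow> \<omega> (\<eta>, \<eta>') = f \<eta>' - f \<eta>"
    using closed_form_exact[of \<omega>] \<omega> unfolding Z1_unif_def by blast
  obtain \<rho> where \<rho>: "\<And>e. e \<in> E \<Longrightarrow> (\<lambda>\<eta>. \<omega> (\<eta>, exch \<phi> e \<eta>)) \<in> local_funs X b (edge_ball X E e \<rho>)"
    using \<omega> unfolding Z1_unif_def uniform_form_def by blast
  define R where "R = nat \<lceil>\<rho>\<rceil>"
  have "real n \<le> \<rho> \<Longrightarrow> n \<le> R" for n unfolding R_def by linarith
  then have sub: "edge_ball X E e \<rho> \<subseteq> edge_ball X E e (real R)" for e
    by (auto simp: edge_ball_def gball_def)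
  interpret potential X E \<phi> b f R
  proof
    fix e \<eta> \<eta>'
    assume e: "e \<in> E" "\<eta> \<in> FC" "\<eta>' \<in> FC" "\<And>x. x \<in> edge_ball X E e (real R) \<Longrightarrow> \<eta> x = \<eta>' x"
    then have "\<forall>x\<in>edge_ball X E e \<rho>. \<eta> x = \<eta>' x" using sub by blast
    then have "\<omega> (\<eta>, exch \<phi> e \<eta>) = \<omega> (\<eta>', exch \<phi> e \<eta>')"
      using \<rho>[OF e(1)] e(2,3) unfolding local_funs_def by blast
    then show "f (exch \<phi> e \<eta>) - f \<eta> = f (exch \<phi> e \<eta>') - f \<eta>'"
      using f(2) T_exch e by simp
  qed (rule f(1))
  obtain u where u: "\<And>e \<eta>. e \<in> E \<Longrightarrow> \<eta> \<in> FC \<Longrightarrow> u (content (exch \<phi> e \<eta>)) = u (content \<eta>)"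
    and "additive_potential X E \<phi> b (\<lambda>\<eta>. f \<eta> - u (content \<eta>)) R"
    using correction_exists[OF tr] by blast
  then interpret f': additive_potential X E \<phi> b "\<lambda>\<eta>. f \<eta> - u (content \<eta>)" R by simp
  define F where "F \<eta> = (if \<eta> \<in> FC then f \<eta> - u (content \<eta>) else 0)" for \<eta>
  have "uniform_fun X E b F"
    by (rule uniform_fun_if_second_difference[of R]) (use f'.second_difference in \<open>simp add: F_def\<close>)
  then have "F \<in> C0_unif X E b"
    using f'.f_base by (auto simp: C0_unif_def funs_on_def F_def)
  moreover have "\<omega> = differential X E \<phi> b F"
  proof
    fix t
    show "\<omega> t = differential X E \<phi> b F t"
    proof (cases "t \<in> T")
      case True
      then obtain \<eta> e where t: "t = (\<eta>, exch \<phi> e \<eta>)" "\<eta> \<in> FC" "e \<in> E"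
        by (cases t) (auto simp: fin_transitions_iff)
      then show ?thesis using f(2) True u[OF t(3,2)] T_FC[of \<eta> "exch \<phi> e \<eta>"]
        by (simp add: differential_def F_def)
    next
      case False
      then have "\<omega> t = 0" using \<omega> unfolding Z1_unif_def forms_def funs_on_def by blast
      then show ?thesis using False by (simp add: differential_def)
    qed
  qed
  ultimately show ?thesis by blast
qed

lemma C0_unif_diff:
  assumes "f \<in> C0_unif X E b" "g \<in> C0_unif X E b"
  shows "f - g \<in> C0_unif X E b"
proof -
  obtain p \<rho> where p: "expansion X b f p" "\<rho> > 0"
    "\<And>\<Lambda>. finite \<Lambda> \<and> \<Lambda> \<subseteq> X \<and> real (gdiam E \<Lambda>) > \<rho> \<Longrightarrow> p \<Lambda> = 0"
    using assms(1) unfolding C0_unif_def uniform_fun_def by blast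
  obtain q \<sigma> where q: "expansion X b g q" "\<sigma> > 0"
    "\<And>\<Lambda>. finite \<Lambda> \<and> \<Lambda> \<subseteq> X \<and> real (gdiam E \<Lambda>) > \<sigma> \<Longrightarrow> q \<Lambda> = 0"
    using assms(2) unfolding C0_unif_def uniform_fun_def by blast
  have "p \<Lambda> - q \<Lambda> \<in> exact_funs X b \<Lambda>" if "finite \<Lambda>" "\<Lambda> \<subseteq> X" for \<Lambda>
  proof -
    have pq: "p \<Lambda> \<in> exact_funs X b \<Lambda>" "q \<Lambda> \<in> exact_funs X b \<Lambda>"
      using that p(1) q(1) by (auto simp: expansion_def)
    have "(p \<Lambda> - q \<Lambda>) \<eta> = (p \<Lambda> - q \<Lambda>) \<eta>'"
      if "\<eta> \<in> FC" "\<eta>' \<in> FC" "\<forall>x\<in>\<Lambda>. \<eta> x = \<eta>' x" for \<eta> \<eta>'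
    proof -
      have "p \<Lambda> \<eta> = p \<Lambda> \<eta>'" "q \<Lambda> \<eta> = q \<Lambda> \<eta>'"
        using pq that unfolding exact_funs_def local_funs_def by blast+
      then show ?thesis by simp
    qed
    moreover have "(p \<Lambda> - q \<Lambda>) \<eta> = 0" if "\<eta> \<in> FC" "\<exists>x\<in>\<Lambda>. \<eta> x = b" for \<eta>
      using pq that by (simp add: exact_funs_def)
    moreover have "p \<Lambda> - q \<Lambda> \<in> funs_on FC"
      using pq by (simp add: exact_funs_def local_funs_def funs_on_def)
    ultimately show ?thesis unfolding exact_funs_def local_funs_def by blast
  qed
  then have "expansion X b (f - g) (\<lambda>\<Lambda>. p \<Lambda> - q \<Lambda>)"
    using p(1) q(1) by (simp add: expansion_def sum_subtractf)
  moreover have "p \<Lambda> - q \<Lambda> = 0" if "finite \<Lambda> \<and> \<Lambda> \<subseteq> X \<and> real (gdiam E \<Lambda>) > max \<rho> \<sigma>" for \<Lambda>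
    using p(3)[of \<Lambda>] q(3)[of \<Lambda>] that by simp
  moreover have "max \<rho> \<sigma> > 0" using p(2) by simp
  ultimately have "uniform_fun X E b (f - g)" unfolding uniform_fun_def by blast
  then show ?thesis using assms by (auto simp: C0_unif_def funs_on_def)
qed

text \<open>
  Every closed uniform form is a differential, so all its cosets modulo the differentials are the
  zero coset.
\<close>

lemma H_unif_trivial:
  assumes "transferable X E \<or> simple_interaction \<phi> b" "m \<noteq> 0"
  shows "lin_iso (H_unif X E \<phi> b m) (zero_space ())"
proof (cases "m = 1")
  case False
  then show ?thesis
    by (auto simp: H_unif_def lin_iso_def zero_space_def bij_betw_def)
next
  case True
  let ?d = "differential X E \<phi> b" and ?Z = "Z1_unif X E \<phi> b"
  let ?N = "?d ` C0_unif X E b"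
  have d_diff: "?d (f - g) = ?d f - ?d g" for f g by (auto simp: differential_def fun_eq_iff)
  have N_diff: "v - w \<in> ?N" if vw: "v \<in> ?N" "w \<in> ?N" for v w
  proof -
    obtain f where f: "v = ?d f" "f \<in> C0_unif X E b" using vw(1) by (rule imageE)
    obtain g where g: "w = ?d g" "g \<in> C0_unif X E b" using vw(2) by (rule imageE)
    from f g have "v - w = ?d (f - g)" "f - g \<in> C0_unif X E b" by (simp_all add: C0_unif_diff d_diff)
    then show ?thesis by blast
  qed
  have "sum_list (map (0 :: ('a \<Rightarrow> 's) \<times> ('a \<Rightarrow> 's) \<Rightarrow> real) p) = 0" for p
    by (induction p) auto
  then have "0 \<in> ?Z"
    by (auto simp: Z1_unif_def forms_def funs_on_def closed_form_def uniform_form_def local_funs_def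
        intro: exI[of _ 1])
  then have Z: "0 \<in> ?Z" "?Z \<subseteq> ?N" using closed_uniform_exact[OF assms(1)] by auto
  have coset: "(\<Union>v\<in>?N. {v + w}) = ?N" if w: "w \<in> ?Z" for w
  proof
    have "- w \<in> ?N" using N_diff[of 0 w] Z w by auto
    then show "(\<Union>v\<in>?N. {v + w}) \<subseteq> ?N" using N_diff[of _ "- w"] by auto
    show "?N \<subseteq> (\<Union>v\<in>?N. {v + w})"
    proof
      fix v assume "v \<in> ?N"
      then have "v - w \<in> ?N" "v = (v - w) + w" using N_diff Z w by auto
      then show "v \<in> (\<Union>v\<in>?N. {v + w})" by blast
    qed
  qed
  have "carrier (H_unif X E \<phi> b m) = (\<Union>w\<in>?Z. {\<Union>v\<in>?N. {v + w}})"
    by (simp add: True H_unif_def quot_space_def fun_space_def A_RCOSETS_def RCOSETS_def r_coset_def)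
  also have "\<dots> = {?N}" using coset Z by auto
  finally show ?thesis
    by (auto simp: lin_iso_def zero_space_def bij_betw_def)
qed

end

theorem theorem6:
  fixes X :: "'x set" and E :: "('x \<times> 'x) set"
    and \<phi> :: "'s \<times> 's \<Rightarrow> 's \<times> 's" and b :: 's
  assumes "particle_system X E \<phi>"
    and "irreducibly_quantified \<phi> b"
    and "transferable X E \<or> (simple_interaction \<phi> b \<and> weakly_transferable X E)"
  shows "lin_iso (H0_unif X E \<phi> b) (fun_space (Consv \<phi> b)) \<and>
         (\<forall>m::nat. m \<noteq> 0 \<longrightarrow> lin_iso (H_unif X E \<phi> b m) (zero_space ()))"
proof -
  interpret particle_locale X E \<phi> b
    by unfold_locales (use assms in \<open>auto simp: particle_system_def transferable_def\<close>)
  show ?thesis using H0_iso H_unif_trivial assms(3) by blast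
qed

end
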